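(* In the setting below, assume $\widehat W_{\infty,h}\subset W_{\sigma,h}$ for all $\sigma\in(0,\infty]$, $h\in(0,h_0]$, and for $\sigma\in(0,\infty]$ let $u_{\sigma,h}$ be a minimizer of $\mathcal E_\sigma$ over $W_{\sigma,h}$. Then for each fixed $h\in(0,h_0]$, $\|u_{\sigma,h}-u_{\infty,h}\|_{L^p(\Omega)}\to0$ as $\sigma\to\infty$.
   Context: Let $p\in[2,\infty)$, $p'=p/(p-1)$, and $\Omega\subset\mathbb R^d$ a bounded domain with piecewise flat boundary. For $\delta>0$ let $\Omega_{I_\delta}:=\{x\in\mathbb R^d\setminus\Omega:\mathrm{dist}(x,\partial\Omega)\le\delta\}$ and $\Omega_\delta:=\Omega\cup\Omega_{I_\delta}$. Let $\rho\in L^\infty(\mathbb R)$ be even, with $\mathrm{supp}\rho$ a compact subset of $(-1,1)$, $\rho\ge0$ and nonincreasing on $[0,1)$, $\rho\ge C_\rho>0$ on $[-c_\rho,c_\rho]$ for some $c_\rho\in(0,1)$, normalized by $\int_{B(0,1)}|z|^p\rho(|z|)dz=\overline C_{d,p}:=\frac{\sqrt\pi\,\Gamma(\frac{d+p}{2})}{\Gamma(\frac{p+1}{2})\Gamma(\frac d2)}$; put $\rho_\delta(r):=\delta^{-d}\rho(r/\delta)$. Define $[u]^p_{\mathcal S^p[\delta]}:=\int_{\Omega_\delta}\int_{\Omega_\delta}\rho_\delta(|x-y|)\big|\frac{u(x)-u(y)}{\delta}\big|^pdxdy$, $\mathcal S^p[\delta](\Omega):=\{u\in L^p(\Omega_\delta):[u]_{\mathcal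 S^p[\delta]}<\infty\}$ with norm $(\|u\|^p_{L^p(\Omega)}+[u]^p_{\mathcal S^p[\delta]})^{1/p}$, and $\mathcal S^p_0[\delta](\Omega):=\{u\in\mathcal S^p[\delta](\Omega):u=0\text{ a.e. on }\Omega_{I_\delta}\}$. Let $\delta_0\in(0,1)$ be such that there is $C>0$ with $\|u\|_{L^p(\Omega)}\le C[u]_{\mathcal S^p[\delta]}$ for all $\delta\in(0,\delta_0]$ and $u\in\mathcal S^p_0[\delta](\Omega)$. All functions are extended by zero to $\Omega_{\delta_0}$. For $\sigma\in(0,\infty)$, $\delta_\sigma:=\min\{\delta_0,1/\sigma\}$ and $\mathcal T_\sigma:=\mathcal S^p_0[\delta_\sigma](\Omega)$; $\mathcal T_\infty:=W^{1,p}_0(\Omega)$. Fix $f\in L^{p'}(\Omega_{\delta_0})$, $\langle f,u\rangle:=\int fu$. $\mathcal E_\sigma(u):=\frac1p[u]^p_{\mathcal S^p[\delta_\sigma]}-\langle f,u\rangle$ on $\mathcal T_\sigma$ ($\sigma\in(0,\infty)$), $\mathcal E_\infty(u):=\frac1p\int_\Omega|\nabla u|^pdx-\int_\Omega fu\,dx$ on $\mathcal T_\infty$. Let $\{\tau_h\}_{h\in(0,h_0]}$ be quasi-uniform, shape-regular triangulations of $\Omega$ with maximal element size $h$; fix $N\in\mathbb N$. Let $\widetilde W_h:=\{v\in L^p(\Omega):v|_\tau\in\mathcal P_N(\tau)\ \forall\tau\in\tau_h,\ v|_{\partial\Omega}=0\}$ (extended by zero), $W_{\sigma,h}:=\widetilde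 W_h\cap\mathcal T_\sigma$ for $\sigma\in(0,\infty]$, and $\widehat W_{\infty,h}$ the space of continuous piecewise linear functions on $\tau_h$ lying in $W^{1,p}_0(\Omega)$. *)

theory Defs
  imports "HOL-Analysis.Analysis"
begin

definition bounded_domain :: "'a::euclidean_space set \<Rightarrow> bool" where
  "bounded_domain \<Omega> \<longleftrightarrow> open \<Omega> \<and> connected \<Omega> \<and> \<Omega> \<noteq> {} \<and> bounded \<Omega>"

definition piecewise_flat_boundary :: "'a::euclidean_space set \<Rightarrow> bool" where
  "piecewise_flat_boundary \<Omega> \<longleftrightarrow>
     (\<exists>H :: ('a \<times> real) set. finite H \<and> (\<forall>(a,b)\<in>H. a \<noteq> 0) \<and>
        frontier \<Omega> \<subseteq> (\<Union>(a,b)\<in>H. {x. a \<bullet> x = b}))"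

definition interaction_layer :: "'a::euclidean_space set \<Rightarrow> real \<Rightarrow> 'a set" where
  "interaction_layer \<Omega> \<delta> = {x. x \<notin> \<Omega> \<and> infdist x (frontier \<Omega>) \<le> \<delta>}"

definition extended_domain :: "'a::euclidean_space set \<Rightarrow> real \<Rightarrow> 'a set" where
  "extended_domain \<Omega> \<delta> = \<Omega> \<union> interaction_layer \<Omega> \<delta>"

definition Cbar :: "nat \<Rightarrow> real \<Rightarrow> real" where
  "Cbar d p = sqrt pi * Gamma ((real d + p) / 2) / (Gamma ((p + 1) / 2) * Gamma (real d / 2))"

definition admissible_kernel :: "'a::euclidean_space itself \<Rightarrow> real \<Rightarrow> (real \<Rightarrow> real) \<Rightarrow> bool" where
  "admissible_kernel _ p \<rho> \<longleftrightarrow>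
     \<rho> \<in> borel_measurable borel \<and> (\<exists>M. \<forall>t. \<bar>\<rho> t\<bar> \<le> M) \<and>
     (\<forall>t. \<rho> (- t) = \<rho> t) \<and>
     compact (closure {t. \<rho> t \<noteq> 0}) \<and> closure {t. \<rho> t \<noteq> 0} \<subseteq> {-1<..<1} \<and>
     (\<forall>t. 0 \<le> \<rho> t) \<and>
     (\<forall>s t. 0 \<le> s \<longrightarrow> s \<le> t \<longrightarrow> t < 1 \<longrightarrow> \<rho> t \<le> \<rho> s) \<and>
     (\<exists>c C. 0 < c \<and> c < 1 \<and> 0 < C \<and> (\<forall>t. \<bar>t\<bar> \<le> c \<longrightarrow> C \<le> \<rho> t)) \<and>
     (\<integral>\<^sup>+ z \<in> ball (0::'a) 1. ennreal (norm z powr p * \<rho> (norm z)) \<partial>lebesgue)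
        = ennreal (Cbar DIM('a) p)"

definition rho_delta :: "'a::euclidean_space itself \<Rightarrow> (real \<Rightarrow> real) \<Rightarrow> real \<Rightarrow> real \<Rightarrow> real" where
  "rho_delta _ \<rho> \<delta> r = \<rho> (r / \<delta>) / \<delta> ^ DIM('a)"

definition Lp_space :: "real \<Rightarrow> 'a::euclidean_space set \<Rightarrow> ('a \<Rightarrow> 'b::real_normed_vector) \<Rightarrow> bool" where
  "Lp_space q A u \<longleftrightarrow> (\<lambda>x. indicator A x *\<^sub>R u x) \<in> borel_measurable lebesgue \<and>
     (\<integral>\<^sup>+ x \<in> A. ennreal (norm (u x) powr q) \<partial>lebesgue) < \<infinity>"

definition Lp_norm :: "real \<Rightarrow> 'a::euclidean_space set \<Rightarrow> ('a \<Rightarrow> 'b::real_normed_vector) \<Rightarrow> real" where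
  "Lp_norm q A u = enn2real (\<integral>\<^sup>+ x \<in> A. ennreal (norm (u x) powr q) \<partial>lebesgue) powr (1 / q)"

definition nl_seminorm_p :: "real \<Rightarrow> (real \<Rightarrow> real) \<Rightarrow> 'a::euclidean_space set \<Rightarrow> real \<Rightarrow> ('a \<Rightarrow> real) \<Rightarrow> ennreal" where
  "nl_seminorm_p p \<rho> \<Omega> \<delta> u =
     (\<integral>\<^sup>+ x \<in> extended_domain \<Omega> \<delta>. (\<integral>\<^sup>+ y \<in> extended_domain \<Omega> \<delta>.
        ennreal (rho_delta TYPE('a) \<rho> \<delta> (norm (x - y)) * \<bar>(u x - u y) / \<delta>\<bar> powr p) \<partial>lebesgue) \<partial>lebesgue)"

definition nl_seminorm :: "real \<Rightarrow> (real \<Rightarrow> real) \<Rightarrow> 'a::euclidean_space set \<Rightarrow> real \<Rightarrow> ('a \<Rightarrow> real) \<Rightarrow> real" where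
  "nl_seminorm p \<rho> \<Omega> \<delta> u = enn2real (nl_seminorm_p p \<rho> \<Omega> \<delta> u) powr (1 / p)"

definition Sp :: "real \<Rightarrow> (real \<Rightarrow> real) \<Rightarrow> 'a::euclidean_space set \<Rightarrow> real \<Rightarrow> ('a \<Rightarrow> real) set" where
  "Sp p \<rho> \<Omega> \<delta> = {u. Lp_space p (extended_domain \<Omega> \<delta>) u \<and> nl_seminorm_p p \<rho> \<Omega> \<delta> u < \<infinity>}"

definition Sp0 :: "real \<Rightarrow> (real \<Rightarrow> real) \<Rightarrow> 'a::euclidean_space set \<Rightarrow> real \<Rightarrow> ('a \<Rightarrow> real) set" where
  "Sp0 p \<rho> \<Omega> \<delta> = {u \<in> Sp p \<rho> \<Omega> \<delta>. AE x in lebesgue. x \<in> interaction_layer \<Omega> \<delta> \<longrightarrow> u x = 0}"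

text \<open>C^infinity functions on the whole space: all partial derivatives of all orders exist
  everywhere (coinductively: differentiable, and all partial derivatives are again smooth).\<close>
coinductive smooth_fun :: "('a::euclidean_space \<Rightarrow> real) \<Rightarrow> bool" where
  "(\<forall>x. f differentiable (at x)) \<Longrightarrow>
   (\<forall>i\<in>Basis. smooth_fun (\<lambda>x. frechet_derivative f (at x) i)) \<Longrightarrow> smooth_fun f"

definition test_fun :: "'a::euclidean_space set \<Rightarrow> ('a \<Rightarrow> real) \<Rightarrow> bool" where
  "test_fun \<Omega> \<phi> \<longleftrightarrow> smooth_fun \<phi> \<and> compact (closure {x. \<phi> x \<noteq> 0}) \<and>
     closure {x. \<phi> x \<noteq> 0} \<subseteq> \<Omega>"

definition cgrad :: "('a::euclidean_space \<Rightarrow> real) \<Rightarrow> 'a \<Rightarrow> 'a" where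
  "cgrad \<phi> x = (\<Sum>i\<in>Basis. frechet_derivative \<phi> (at x) i *\<^sub>R i)"

definition is_weak_grad :: "'a::euclidean_space set \<Rightarrow> ('a \<Rightarrow> real) \<Rightarrow> ('a \<Rightarrow> 'a) \<Rightarrow> bool" where
  "is_weak_grad \<Omega> u g \<longleftrightarrow>
     (\<forall>\<phi>. test_fun \<Omega> \<phi> \<longrightarrow> (\<forall>i\<in>Basis.
        (LINT x:\<Omega>|lebesgue. u x * frechet_derivative \<phi> (at x) i)
          = - (LINT x:\<Omega>|lebesgue. (g x \<bullet> i) * \<phi> x)))"

definition W1p :: "real \<Rightarrow> 'a::euclidean_space set \<Rightarrow> ('a \<Rightarrow> real) set" where
  "W1p p \<Omega> = {u. Lp_space p \<Omega> u \<and> (\<exists>g. Lp_space p \<Omega> g \<and> is_weak_grad \<Omega> u g)}"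

definition W1p0 :: "real \<Rightarrow> 'a::euclidean_space set \<Rightarrow> ('a \<Rightarrow> real) set" where
  "W1p0 p \<Omega> = {u \<in> W1p p \<Omega>. \<exists>g \<phi>s. Lp_space p \<Omega> g \<and> is_weak_grad \<Omega> u g \<and>
      (\<forall>n. test_fun \<Omega> (\<phi>s n)) \<and>
      (\<lambda>n. Lp_norm p \<Omega> (\<lambda>x. \<phi>s n x - u x) + Lp_norm p \<Omega> (\<lambda>x. cgrad (\<phi>s n) x - g x))
         \<longlonglongrightarrow> 0}"

definition weak_grad :: "real \<Rightarrow> 'a::euclidean_space set \<Rightarrow> ('a \<Rightarrow> real) \<Rightarrow> 'a \<Rightarrow> 'a" where
  "weak_grad p \<Omega> u = (SOME g. Lp_space p \<Omega> g \<and> is_weak_grad \<Omega> u g)"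

definition delta_sigma :: "real \<Rightarrow> real \<Rightarrow> real" where
  "delta_sigma \<delta>0 \<sigma> = min \<delta>0 (1 / \<sigma>)"

definition T_sigma :: "real \<Rightarrow> (real \<Rightarrow> real) \<Rightarrow> 'a::euclidean_space set \<Rightarrow> real \<Rightarrow> real \<Rightarrow> ('a \<Rightarrow> real) set" where
  "T_sigma p \<rho> \<Omega> \<delta>0 \<sigma> = Sp0 p \<rho> \<Omega> (delta_sigma \<delta>0 \<sigma>)"

text \<open>Duality pairing; functions are extended by zero, and they vanish (a.e.) outside Omega.\<close>
definition pairing :: "'a::euclidean_space set \<Rightarrow> ('a \<Rightarrow> real) \<Rightarrow> ('a \<Rightarrow> real) \<Rightarrow> real" where
  "pairing \<Omega> f u = (LINT x:\<Omega>|lebesgue. f x * u x)"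

definition E_sigma :: "real \<Rightarrow> (real \<Rightarrow> real) \<Rightarrow> 'a::euclidean_space set \<Rightarrow> real \<Rightarrow> ('a \<Rightarrow> real) \<Rightarrow> real \<Rightarrow> ('a \<Rightarrow> real) \<Rightarrow> real" where
  "E_sigma p \<rho> \<Omega> \<delta>0 f \<sigma> u =
     (1 / p) * enn2real (nl_seminorm_p p \<rho> \<Omega> (delta_sigma \<delta>0 \<sigma>) u) - pairing \<Omega> f u"

definition E_inf :: "real \<Rightarrow> 'a::euclidean_space set \<Rightarrow> ('a \<Rightarrow> real) \<Rightarrow> ('a \<Rightarrow> real) \<Rightarrow> real" where
  "E_inf p \<Omega> f u = (1 / p) * (LINT x:\<Omega>|lebesgue. norm (weak_grad p \<Omega> u x) powr p) - pairing \<Omega> f u"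

definition inradius :: "'a::euclidean_space set \<Rightarrow> real" where
  "inradius T = Sup {r. 0 \<le> r \<and> (\<exists>c. ball c r \<subseteq> T)}"

definition triangulation :: "'a::euclidean_space set \<Rightarrow> 'a set set \<Rightarrow> bool" where
  "triangulation \<Omega> \<T> \<longleftrightarrow> finite \<T> \<and> \<T> \<noteq> {} \<and>
     (\<forall>T\<in>\<T>. int DIM('a) simplex T) \<and> \<Union>\<T> = closure \<Omega> \<and>
     (\<forall>T1\<in>\<T>. \<forall>T2\<in>\<T>. T1 \<noteq> T2 \<longrightarrow> (T1 \<inter> T2) face_of T1 \<and> (T1 \<inter> T2) face_of T2)"

definition admissible_tri_family :: "'a::euclidean_space set \<Rightarrow> real \<Rightarrow> (real \<Rightarrow> 'a set set) \<Rightarrow> bool" where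
  "admissible_tri_family \<Omega> h0 tri \<longleftrightarrow>
     (\<forall>h\<in>{0<..h0}. triangulation \<Omega> (tri h) \<and> Max (diameter ` tri h) = h) \<and>
     (\<exists>C. \<forall>h\<in>{0<..h0}. \<forall>T\<in>tri h. diameter T \<le> C * inradius T) \<and>
     (\<exists>C. \<forall>h\<in>{0<..h0}. \<forall>T\<in>tri h. h \<le> C * diameter T)"

definition poly_deg_le :: "nat \<Rightarrow> ('a::euclidean_space \<Rightarrow> real) \<Rightarrow> bool" where
  "poly_deg_le N q \<longleftrightarrow> (\<exists>(A :: ('a \<Rightarrow> nat) set) c. finite A \<and>
      (\<forall>\<alpha>\<in>A. (\<Sum>b\<in>Basis. \<alpha> b) \<le> N) \<and>
      (\<forall>x. q x = (\<Sum>\<alpha>\<in>A. c \<alpha> * (\<Prod>b\<in>Basis. (x \<bullet> b) ^ \<alpha> b))))"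

definition Wtilde :: "real \<Rightarrow> nat \<Rightarrow> 'a::euclidean_space set \<Rightarrow> 'a set set \<Rightarrow> ('a \<Rightarrow> real) set" where
  "Wtilde p N \<Omega> \<T> = {v. Lp_space p \<Omega> v \<and> (\<forall>x. x \<notin> \<Omega> \<longrightarrow> v x = 0) \<and>
      (\<forall>T\<in>\<T>. \<exists>q. poly_deg_le N q \<and> (AE x in lebesgue. x \<in> T \<longrightarrow> v x = q x) \<and>
          (\<forall>x\<in>T \<inter> frontier \<Omega>. q x = 0))}"

definition W_sigma_h :: "real \<Rightarrow> (real \<Rightarrow> real) \<Rightarrow> nat \<Rightarrow> 'a::euclidean_space set \<Rightarrow> real \<Rightarrow> 'a set set \<Rightarrow> real \<Rightarrow> ('a \<Rightarrow> real) set" where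
  "W_sigma_h p \<rho> N \<Omega> \<delta>0 \<T> \<sigma> = Wtilde p N \<Omega> \<T> \<inter> T_sigma p \<rho> \<Omega> \<delta>0 \<sigma>"

definition W_inf_h :: "real \<Rightarrow> nat \<Rightarrow> 'a::euclidean_space set \<Rightarrow> 'a set set \<Rightarrow> ('a \<Rightarrow> real) set" where
  "W_inf_h p N \<Omega> \<T> = Wtilde p N \<Omega> \<T> \<inter> W1p0 p \<Omega>"

definition What_inf_h :: "real \<Rightarrow> 'a::euclidean_space set \<Rightarrow> 'a set set \<Rightarrow> ('a \<Rightarrow> real) set" where
  "What_inf_h p \<Omega> \<T> = {v \<in> W1p0 p \<Omega>. (\<forall>x. x \<notin> \<Omega> \<longrightarrow> v x = 0) \<and>
      continuous_on (closure \<Omega>) v \<and> (\<forall>T\<in>\<T>. \<exists>a b. \<forall>x\<in>T. v x = a \<bullet> x + b)}"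

end

theory Submission
  imports Defs
begin

text \<open>For a function \<open>u\<close> vanishing outside the domain, the substitution \<open>y = x + \<delta> z\<close> turns the
  nonlocal seminorm into \<open>J\<^sub>\<delta>(u) = \<integral>\<integral> \<rho>(|z|) |(u(x + \<delta> z) - u(x)) / \<delta>|\<^sup>p dz dx\<close> over the whole space.
  Telescoping and convexity give \<open>J\<^bsub>k\<delta>\<^esub> \<le> J\<^sub>\<delta>\<close> for every natural number \<open>k\<close>, and the normalisation of the kernel gives
  \<open>\<integral> \<rho>(|z|) |g \<bullet> z|\<^sup>p dz = |g|\<^sup>p\<close>. Letting \<open>k\<close> grow yields \<open>J\<^sub>\<delta>(v) \<le> \<integral> |\<nabla>v|\<^sup>p\<close> on \<open>W\<^sub>0\<^sup>1\<^sup>,\<^sup>p\<close>,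
  so the discrete local minimizer \<open>v\<close> is an admissible competitor and
  \<open>E\<^sub>\<sigma>(v) \<le> E\<^sub>\<infinity>(v)\<close> for all \<open>\<sigma>\<close>.

  By the Poincare inequality and finite dimensionality, a sequence of discrete nonlocal minimizers \<open>u\<^sub>\<sigma>\<close> has a subsequence
  converging to some piecewise polynomial \<open>w\<close>. Choosing \<open>k\<close> with \<open>k \<delta>\<^sub>\<sigma> \<rightarrow> t\<close> gives \<open>J\<^sub>t(w) \<le> lim J\<^bsub>\<delta>\<^sub>\<sigma>\<^esub>(u\<^sub>\<sigma>)\<close>
  for every fixed \<open>t > 0\<close>. A bound on \<open>J\<^sub>t(w)\<close> uniform in \<open>t\<close> forbids jumps, because \<open>p > 1\<close>; hence \<open>w\<close> is
  Lipschitz, vanishes on the boundary, belongs to \<open>W\<^sub>0\<^sup>1\<^sup>,\<^sup>p\<close>, and \<open>E\<^sub>\<infinity>(w) \<le> lim E\<^sub>\<sigma>(u\<^sub>\<sigma>)\<close>. Minimality of \<open>v\<close>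
  thus shows that \<open>E\<^sub>\<sigma>(v) - E\<^sub>\<sigma>(u\<^sub>\<sigma>)\<close> has limit superior at most \<open>0\<close>, and Clarkson's inequality (\<open>p \<ge> 2\<close>) together with the
  Poincare inequality bounds the \<open>p\<close>-th power of the \<open>L\<^sup>p\<close> distance of \<open>u\<^sub>\<sigma>\<close> and \<open>v\<close> by a multiple of that difference.\<close>

section \<open>Directional moments of radial kernels\<close>

text \<open>\<open>W_sigma_h\<close> contains functions that jump across mesh faces and are not
  admissible for \<open>E_inf\<close>, so a nonlocal minimizer cannot be tested in the local
  problem; only limits of such minimizers can. A jump of size a across a hypersurface contributes
  about a^p t^(1-p) to the energy at scale t. Along the minimizers the scale changes together with
  the function, and a shrinking jump may be affordable at scale \<open>\<delta>\<close> itself;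
  freezing t and returning to it through multiples of \<open>\<delta>\<close> separates the two
  limits and leaves a regular difference quotient, to which Fatou's lemma applies. The bound on the
  competitor needs the constant exactly one, with no error term in \<open>\<delta>\<close>. The
  normalisation provides it: \<open>Cbar\<close> is the quotient of the integrals of |z|^p and |z .
  e|^p over the unit ball, and a nonincreasing radial kernel, being a superposition of balls, has
  the same quotient. Clarkson's inequality makes strict convexity quantitative, so an energy gap
  tending to 0 already gives convergence, and the subsequence limit never has to be identified with
  the local minimizer beforehand.\<close>

lemma ball_measurable [measurable]: "ball (c::'a::euclidean_space) r \<in> sets borel"
  by simp

lemma nn_integral_lborel_affine:
  fixes f :: "'a::euclidean_space \<Rightarrow> ennreal"
  assumes [measurable]: "f \<in> borel_measurable borel" and c: "c \<noteq> 0"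
  shows "(\<integral>\<^sup>+x. f x \<partial>lborel) = ennreal (\<bar>c\<bar> ^ DIM('a)) * (\<integral>\<^sup>+x. f (t + c *\<^sub>R x) \<partial>lborel)"
  by (subst lborel_affine[OF c, of t])
     (simp add: nn_integral_density nn_integral_distr nn_integral_cmult ennreal_power)

lemma nn_integral_lborel_translate:
  fixes f :: "'a::euclidean_space \<Rightarrow> ennreal"
  assumes "f \<in> borel_measurable borel"
  shows "(\<integral>\<^sup>+x. f (x + t) \<partial>lborel) = (\<integral>\<^sup>+x. f x \<partial>lborel)"
  using nn_integral_lborel_affine[OF assms, of 1 t] by (simp add: add.commute)

text \<open>Uniqueness of Haar measure: evaluating \<open>\<integral>\<integral> f (R a) h (R a - y)\<close> in both orders, for the
  indicator \<open>h\<close> of the unit ball, compares \<open>f \<circ> R\<close> with \<open>f\<close>.\<close>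
lemma nn_integral_lborel_isometry:
  fixes f :: "'a::euclidean_space \<Rightarrow> ennreal" and R S :: "'a \<Rightarrow> 'a"
  assumes [measurable]: "f \<in> borel_measurable borel" and R: "linear R"
    and nR: "\<And>x. norm (R x) = norm x" and RS: "\<And>y. R (S y) = y"
  shows "(\<integral>\<^sup>+x. f (R x) \<partial>lborel) = (\<integral>\<^sup>+x. f x \<partial>lborel)"
proof -
  define h :: "'a \<Rightarrow> ennreal" where "h = indicator (ball 0 1)"
  have [measurable]: "h \<in> borel_measurable borel" unfolding h_def by measurable
  have [measurable]: "R \<in> borel_measurable borel"
    by (intro borel_measurable_continuous_onI linear_continuous_on linear_conv_bounded_linear[THEN iffD1] R)
  define H where "H = (\<integral>\<^sup>+x. h x \<partial>lborel)"
  have hR: "h (R x) = h x" for x by (simp add: h_def indicator_def nR)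
  have Hval: "H = emeasure lborel (ball (0::'a) 1)" by (simp add: H_def h_def)
  have "unit_ball_vol (real DIM('a)) \<noteq> 0"
    using unit_ball_vol_pos[of "real DIM('a)"] by linarith
  then have H: "H \<noteq> 0" "H \<noteq> \<infinity>"
    using emeasure_ball[of 1 "0::'a"] by (simp_all add: Hval)
  have 1: "(\<integral>\<^sup>+y. h (x - y) \<partial>lborel) = H" for x
    using nn_integral_lborel_affine[of h "-1" x] by (simp add: H_def)
  have "(\<integral>\<^sup>+x. f (R x) \<partial>lborel) * H = (\<integral>\<^sup>+a. (\<integral>\<^sup>+y. f (R a) * h (R a - y) \<partial>lborel) \<partial>lborel)"
    by (simp add: nn_integral_cmult nn_integral_multc 1)
  also have "\<dots> = (\<integral>\<^sup>+y. (\<integral>\<^sup>+a. f (R a) * h (R a - y) \<partial>lborel) \<partial>lborel)"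
    by (rule lborel_pair.Fubini'[symmetric]) measurable
  \<comment> \<open>For fixed \<open>y\<close>, shifting \<open>a\<close> by \<open>S y\<close>, a
    preimage of \<open>y\<close> under \<open>R\<close>, moves \<open>y\<close> from the argument of
    \<open>h\<close> to that of \<open>f\<close>.\<close>
  also have "\<dots> = (\<integral>\<^sup>+y. (\<integral>\<^sup>+a. f (R a + y) * h (R a) \<partial>lborel) \<partial>lborel)"
  proof (rule nn_integral_cong)
    fix y :: 'a
    assume "y \<in> space lborel"
    have "(\<integral>\<^sup>+a. f (R a) * h (R a - y) \<partial>lborel) = (\<integral>\<^sup>+a. f (R (a + S y)) * h (R (a + S y) - y) \<partial>lborel)"
      by (rule nn_integral_lborel_translate[symmetric]) measurable
    then show "(\<integral>\<^sup>+a. f (R a) * h (R a - y) \<partial>lborel) = (\<integral>\<^sup>+a. f (R a + y) * h (R a) \<partial>lborel)"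
      by (simp add: linear_add[OF R] RS)
  qed
  also have "\<dots> = (\<integral>\<^sup>+a. (\<integral>\<^sup>+y. f (R a + y) * h (R a) \<partial>lborel) \<partial>lborel)"
    by (rule lborel_pair.Fubini') measurable
  also have "\<dots> = (\<integral>\<^sup>+a. (\<integral>\<^sup>+y. f y \<partial>lborel) * h a \<partial>lborel)"
  proof (rule nn_integral_cong)
    fix a :: 'a
    have "(\<integral>\<^sup>+y. f (R a + y) \<partial>lborel) = (\<integral>\<^sup>+y. f y \<partial>lborel)"
      using nn_integral_lborel_translate[of f "R a"] by (simp add: add.commute)
    \<comment> \<open>Norm preservation enters here: \<open>h\<close> does not see \<open>R\<close>,
      and after translating \<open>y\<close> the map has disappeared.\<close>
    then show "(\<integral>\<^sup>+y. f (R a + y) * h (R a) \<partial>lborel) = (\<integral>\<^sup>+y. f y \<partial>lborel) * h a"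
      by (simp add: nn_integral_multc hR)
  qed
  also have "\<dots> = (\<integral>\<^sup>+y. f y \<partial>lborel) * H"
    by (simp add: nn_integral_cmult H_def)
  finally show ?thesis
    using H by (simp add: mult.commute[of _ H] ennreal_mult_cancel_left)
qed

text \<open>The reflection in the hyperplane orthogonal to \<open>g - b\<close> is an isometric
  involution that exchanges the unit vectors \<open>g\<close> and \<open>b\<close>, so it carries
  one integral into the other.\<close>

lemma nn_integral_radial_direction:
  fixes g b :: "'a::euclidean_space" and F :: "real \<Rightarrow> real \<Rightarrow> ennreal"
  assumes g: "norm g = 1" and b: "norm b = 1"
    and [measurable]: "case_prod F \<in> borel_measurable (borel \<Otimes>\<^sub>M borel)"
  shows "(\<integral>\<^sup>+z. F (norm z) (g \<bullet> z) \<partial>lborel) = (\<integral>\<^sup>+z. F (norm z) (b \<bullet> z) \<partial>lborel)"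
proof (cases "g = b")
  case False
  define v where "v = g - b"
  define R where "R = (\<lambda>z. z - (2 * (z \<bullet> v) / (v \<bullet> v)) *\<^sub>R v)"
  have v0: "v \<bullet> v \<noteq> 0" using False by (simp add: v_def)
  have gg: "g \<bullet> g = 1" "b \<bullet> b = 1" using g b by (simp_all add: norm_eq_1)
  have vv: "v \<bullet> v = 2 * (g \<bullet> v)"
    by (simp add: v_def inner_diff_left inner_diff_right gg inner_commute)
  have lin: "linear R"
    unfolding R_def
    by (rule linearI) (simp_all add: inner_add_left algebra_simps add_divide_distrib)
  have "R z \<bullet> R z = z \<bullet> z" for z
    using v0 by (simp add: R_def inner_diff_left inner_diff_right inner_commute power2_eq_square field_simps)
  then have nR: "norm (R z) = norm z" for z by (simp add: norm_eq_sqrt_inner)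
  have RR: "R (R z) = z" for z
    using v0 by (simp add: R_def inner_diff_left algebra_simps)
  have gR: "g \<bullet> R z = b \<bullet> z" for z
  proof -
    have "g \<bullet> R z = g \<bullet> z - 2 * (z \<bullet> v) / (v \<bullet> v) * (g \<bullet> v)"
      by (simp add: R_def inner_diff_right)
    also have "\<dots> = g \<bullet> z - z \<bullet> v" using v0 unfolding vv by simp
    also have "\<dots> = b \<bullet> z" by (simp add: v_def inner_diff_right inner_commute)
    finally show ?thesis .
  qed
  have "(\<integral>\<^sup>+z. F (norm (R z)) (g \<bullet> R z) \<partial>lborel) = (\<integral>\<^sup>+z. F (norm z) (g \<bullet> z) \<partial>lborel)"
    by (rule nn_integral_lborel_isometry[OF _ lin nR RR, where f = "\<lambda>z. F (norm z) (g \<bullet> z)"]) measurable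
  then show ?thesis by (simp add: nR gR)
qed simp

text \<open>Scaling by \<open>r\<close> produces the dimension in the exponent from the volume
  element and \<open>p\<close> from the homogeneity.\<close>

lemma nn_integral_ball_homogeneous:
  fixes w :: "'a::euclidean_space \<Rightarrow> real" and p :: real
  assumes [measurable]: "w \<in> borel_measurable borel" and w0: "\<And>z. 0 \<le> w z"
    and hom: "\<And>c z. 0 < c \<Longrightarrow> w (c *\<^sub>R z) = c powr p * w z" and r: "0 < r"
  shows "(\<integral>\<^sup>+z\<in>ball 0 r. w z \<partial>lborel) = ennreal (r powr (DIM('a) + p)) * (\<integral>\<^sup>+z\<in>ball 0 1. w z \<partial>lborel)"
proof -
  have "(\<integral>\<^sup>+z\<in>ball 0 r. w z \<partial>lborel) = ennreal (\<bar>r\<bar> ^ DIM('a)) *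
      (\<integral>\<^sup>+z. ennreal (w (0 + r *\<^sub>R z)) * indicator (ball 0 r) (0 + r *\<^sub>R z) \<partial>lborel)"
    by (rule nn_integral_lborel_affine, measurable) (use r in auto)
  also have "(\<integral>\<^sup>+z. ennreal (w (0 + r *\<^sub>R z)) * indicator (ball 0 r) (0 + r *\<^sub>R z) \<partial>lborel) =
      (\<integral>\<^sup>+z. ennreal (r powr p) * (ennreal (w z) * indicator (ball 0 1) z) \<partial>lborel)"
    using r by (intro nn_integral_cong) (auto simp: hom ennreal_mult' indicator_def w0 mult.assoc)
  also have "\<dots> = ennreal (r powr p) * (\<integral>\<^sup>+z\<in>ball 0 1. w z \<partial>lborel)"
    by (rule nn_integral_cmult) measurable
  finally show ?thesis
    using r by (simp add: powr_add powr_realpow ennreal_mult' mult.assoc)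
qed

text \<open>exp(-|z|^2) is the integral of exp(-s) over s > |z|^2, so the Gaussian moment is a
  superposition of moments over balls of radius sqrt s. Each of these is a power of s times the unit
  ball moment, and the remaining integral over s is a Gamma value. Moments over balls thus become
  computable from Gaussian integrals, which factor.\<close>

lemma nn_integral_gaussian_homogeneous:
  fixes w :: "'a::euclidean_space \<Rightarrow> real" and p :: real
  assumes [measurable]: "w \<in> borel_measurable borel" and w0: "\<And>z. 0 \<le> w z"
    and hom: "\<And>c z. 0 < c \<Longrightarrow> w (c *\<^sub>R z) = c powr p * w z" and p: "0 \<le> p"
  shows "(\<integral>\<^sup>+z. ennreal (exp (- (norm z)\<^sup>2) * w z) \<partial>lborel) =
    ennreal (Gamma ((DIM('a) + p) / 2 + 1)) * (\<integral>\<^sup>+z\<in>ball 0 1. w z \<partial>lborel)"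
proof -
  have 1: "(\<integral>\<^sup>+s. ennreal (exp (- s)) * indicator {t<..} s \<partial>lborel) = ennreal (exp (- t))" for t :: real
  proof -
    have lim: "((\<lambda>s::real. - exp (- s)) \<longlongrightarrow> 0) at_top"
      using tendsto_minus[OF filterlim_compose[OF exp_at_bot filterlim_uminus_at_bot_at_top]] by simp
    have "(\<integral>\<^sup>+s. ennreal (exp (- s)) * indicator {t<..} s \<partial>lborel) =
        (\<integral>\<^sup>+s. ennreal (exp (- s)) * indicator {t..} s \<partial>lborel)"
      by (intro nn_integral_cong_AE eventually_mono[OF AE_lborel_singleton[of t]])
         (auto simp: indicator_def)
    also have "\<dots> = ennreal (0 - (- exp (- t)))"
      by (rule nn_integral_FTC_atLeast[where F = "\<lambda>s. - exp (- s)"])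
         (auto intro!: derivative_eq_intros lim)
    finally show ?thesis by simp
  qed
  have "(\<integral>\<^sup>+z. ennreal (exp (- (norm z)\<^sup>2) * w z) \<partial>lborel) =
      (\<integral>\<^sup>+z. \<integral>\<^sup>+s. ennreal (exp (- s)) * indicator {(norm z)\<^sup>2<..} s * ennreal (w z) \<partial>lborel \<partial>lborel)"
    by (intro nn_integral_cong) (simp add: nn_integral_multc 1 ennreal_mult w0)
  also have "\<dots> = (\<integral>\<^sup>+z. \<integral>\<^sup>+s. ennreal (exp (- s)) * (if (norm z)\<^sup>2 < s then 1 else 0) * ennreal (w z) \<partial>lborel \<partial>lborel)"
    by (intro nn_integral_cong) (auto simp: indicator_def)
  also have "\<dots> = (\<integral>\<^sup>+s. \<integral>\<^sup>+z. ennreal (exp (- s)) * (if (norm z)\<^sup>2 < s then 1 else 0) * ennreal (w z) \<partial>lborel \<partial>lborel)"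
    by (rule lborel_pair.Fubini'[symmetric]) measurable
  also have "\<dots> = (\<integral>\<^sup>+s. ennreal (indicator {0..} s * s powr (((DIM('a) + p) / 2 + 1) - 1) / exp s) *
      (\<integral>\<^sup>+z\<in>ball 0 1. w z \<partial>lborel) \<partial>lborel)"
  proof (rule nn_integral_cong)
    fix s :: real
    show "(\<integral>\<^sup>+z. ennreal (exp (- s)) * (if (norm z)\<^sup>2 < s then 1 else 0) * ennreal (w z) \<partial>lborel) =
      ennreal (indicator {0..} s * s powr (((DIM('a) + p) / 2 + 1) - 1) / exp s) * (\<integral>\<^sup>+z\<in>ball 0 1. w z \<partial>lborel)"
    proof (cases "0 < s")
      case True
      have iff: "(norm z)\<^sup>2 < s \<longleftrightarrow> z \<in> ball 0 (sqrt s)" for z :: 'a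
        using real_sqrt_less_iff[of "(norm z)\<^sup>2" s] by simp
      have "(\<integral>\<^sup>+z. ennreal (exp (- s)) * (if (norm z)\<^sup>2 < s then 1 else 0) * ennreal (w z) \<partial>lborel) =
          (\<integral>\<^sup>+z. ennreal (exp (- s)) * (ennreal (w z) * indicator (ball 0 (sqrt s)) z) \<partial>lborel)"
        by (intro nn_integral_cong) (simp add: iff indicator_def)
      also have "\<dots> = ennreal (exp (- s)) * (ennreal (sqrt s powr (DIM('a) + p)) * (\<integral>\<^sup>+z\<in>ball 0 1. w z \<partial>lborel))"
        using nn_integral_ball_homogeneous[OF assms(1) w0 hom, of "sqrt s"] True
        by (subst nn_integral_cmult) simp_all
      finally have A: "(\<integral>\<^sup>+z. ennreal (exp (- s)) * (if (norm z)\<^sup>2 < s then 1 else 0) * ennreal (w z) \<partial>lborel) =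
          ennreal (exp (- s)) * (ennreal (sqrt s powr (DIM('a) + p)) * (\<integral>\<^sup>+z\<in>ball 0 1. w z \<partial>lborel))" .
      have B: "sqrt s powr (DIM('a) + p) = s powr ((DIM('a) + p) / 2)"
      proof -
        have "sqrt s = s powr (1/2)" using True by (simp add: powr_half_sqrt)
        then show ?thesis by (simp only: powr_powr) simp
      qed
      have C: "indicator {0..} s * s powr (((DIM('a) + p) / 2 + 1) - 1) / exp s = exp (- s) * s powr ((DIM('a) + p) / 2)"
        using True by (simp add: exp_minus inverse_eq_divide)
      show ?thesis unfolding A B C by (simp only: ennreal_mult' exp_ge_zero mult.assoc)
    next
      case False
      then have "\<not> (norm z)\<^sup>2 < s" for z :: 'a by (smt (verit) zero_le_power2)
      moreover have "0 < DIM('a) + p" using p by (simp add: add_pos_nonneg)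
      ultimately show ?thesis using False by (cases "s = 0") auto
    qed
  qed
  also have "\<dots> = (\<integral>\<^sup>+s. ennreal (indicator {0..} s * s powr (((DIM('a) + p) / 2 + 1) - 1) / exp s) \<partial>lborel) *
      (\<integral>\<^sup>+z\<in>ball 0 1. w z \<partial>lborel)"
    by (rule nn_integral_multc) measurable
  also have "(\<integral>\<^sup>+s. ennreal (indicator {0..} s * s powr (((DIM('a) + p) / 2 + 1) - 1) / exp s) \<partial>lborel) =
      ennreal (Gamma ((DIM('a) + p) / 2 + 1))"
    using p by (intro Gamma_conv_nn_integral_real[symmetric]) (simp add: add_nonneg_pos)
  finally show ?thesis .
qed

text \<open>By monotonicity a superlevel set of the kernel is a ball up to a null set. The point is
  the order of the quantifiers: the factor \<open>r\<close> is the same for all weights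
  \<open>w\<close>, which makes quotients of moments independent of the kernel.\<close>

lemma nn_integral_superlevel_homogeneous:
  fixes p :: real
  assumes [measurable]: "\<rho> \<in> borel_measurable borel"
    and mono: "\<And>s t. 0 \<le> s \<Longrightarrow> s \<le> t \<Longrightarrow> \<rho> t \<le> \<rho> s"
    and supp: "\<And>t. 1 \<le> t \<Longrightarrow> \<rho> t = (0::real)" and t: "0 \<le> t"
  shows "\<exists>r\<ge>0. \<forall>w. w \<in> borel_measurable borel \<longrightarrow> (\<forall>z. 0 \<le> w z) \<longrightarrow>
      (\<forall>c z. 0 < c \<longrightarrow> w (c *\<^sub>R z) = c powr p * w z) \<longrightarrow>
    (\<integral>\<^sup>+z. ennreal (w z) * indicator {z. t < \<rho> (norm z)} z \<partial>lborel) = ennreal r * (\<integral>\<^sup>+(z::'a::euclidean_space)\<in>ball 0 1. w z \<partial>lborel)"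
proof -
  define X where "X = {r. 0 \<le> r \<and> t < \<rho> r}"
  define r where "r = Sup X"
  have bdd: "bdd_above X"
  proof (rule bdd_aboveI)
    fix x assume "x \<in> X"
    then show "x \<le> 1" using supp[of x] t by (cases "1 \<le> x") (auto simp: X_def)
  qed
  show ?thesis
  \<comment> \<open>In this case the superlevel set is at most the origin, hence null. Otherwise it
    is, up to a sphere, the ball whose radius is the supremum of \<open>X\<close>.\<close>
  proof (cases "X \<subseteq> {0}")
    case True
    have "(\<integral>\<^sup>+z. ennreal (w z) * indicator {z::'a. t < \<rho> (norm z)} z \<partial>lborel) = 0"
      if "w \<in> borel_measurable borel" for w
    proof -
      have "AE z in lborel. ennreal (w z) * indicator {z::'a. t < \<rho> (norm z)} z = 0"
        using AE_lborel_singleton[of "0::'a"]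
      proof eventually_elim
        case (elim z)
        then have "norm z \<notin> X" using True by auto
        then show ?case by (simp add: X_def)
      qed
      then show ?thesis by (subst nn_integral_cong_AE[where v = "\<lambda>_. 0"]) auto
    qed
    then show ?thesis by (intro exI[of _ 0]) auto
  next
    case False
    then obtain s where s: "s \<in> X" "0 < s" by (force simp: X_def)
    have r: "0 < r" using cSup_upper[OF s(1) bdd] s by (simp add: r_def)
    have eq: "AE z in lborel. indicator {z::'a. t < \<rho> (norm z)} z = (indicator (ball 0 r) z :: ennreal)"
    proof -
      have "negligible (sphere (0::'a) r)" by (rule negligible_sphere)
      then have "AE z in lborel. z \<notin> sphere (0::'a) r"
        by (intro AE_not_in) (simp add: negligible_iff_null_sets null_sets_completion_iff)
      then show ?thesis
      proof eventually_elim
        case (elim z)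
        have "t < \<rho> (norm z) \<longleftrightarrow> norm z < r"
        proof
          assume "t < \<rho> (norm z)"
          then have "norm z \<le> r" unfolding r_def by (intro cSup_upper bdd) (simp add: X_def)
          then show "norm z < r" using elim by auto
        next
          assume "norm z < r"
          then obtain y where "y \<in> X" "norm z < y"
            using s(1) less_cSup_iff[OF _ bdd, of "norm z"] unfolding r_def by blast
          then show "t < \<rho> (norm z)" using mono[of "norm z" y] by (auto simp: X_def)
        qed
        then show ?case by (simp add: indicator_def)
      qed
    qed
    show ?thesis
    proof (intro exI[of _ "r powr (DIM('a) + p)"] conjI allI impI)
      fix w :: "'a \<Rightarrow> real"
      assume w: "w \<in> borel_measurable borel" "\<forall>z. 0 \<le> w z" "\<forall>c z. 0 < c \<longrightarrow> w (c *\<^sub>R z) = c powr p * w z"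
      have "(\<integral>\<^sup>+z. ennreal (w z) * indicator {z. t < \<rho> (norm z)} z \<partial>lborel) = (\<integral>\<^sup>+z\<in>ball 0 r. w z \<partial>lborel)"
        using eq by (intro nn_integral_cong_AE) (auto elim!: eventually_mono)
      also have "\<dots> = ennreal (r powr (DIM('a) + p)) * (\<integral>\<^sup>+z\<in>ball 0 1. w z \<partial>lborel)"
        by (rule nn_integral_ball_homogeneous) (use w r in auto)
      finally show "(\<integral>\<^sup>+z. ennreal (w z) * indicator {z. t < \<rho> (norm z)} z \<partial>lborel) =
          ennreal (r powr (DIM('a) + p)) * (\<integral>\<^sup>+z\<in>ball 0 1. w z \<partial>lborel)" .
    qed simp
  qed
qed

text \<open>Slicing by the values of the kernel, each superlevel set contributes a common factor to
  both moments, so their quotient is that of the unit ball moments. The cross-multiplied form avoids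
  division in the extended reals.\<close>

lemma nn_integral_radial_ratio:
  fixes w1 w2 :: "'a::euclidean_space \<Rightarrow> real" and p :: real
  assumes [measurable]: "\<rho> \<in> borel_measurable borel"
    and nonneg: "\<And>t. 0 \<le> \<rho> t"
    and mono: "\<And>s t. 0 \<le> s \<Longrightarrow> s \<le> t \<Longrightarrow> \<rho> t \<le> \<rho> s"
    and supp: "\<And>t. 1 \<le> t \<Longrightarrow> \<rho> t = (0::real)"
    and w1: "w1 \<in> borel_measurable borel" "\<And>z. 0 \<le> w1 z"
      "\<And>c z. 0 < c \<Longrightarrow> w1 (c *\<^sub>R z) = c powr p * w1 z"
    and w2: "w2 \<in> borel_measurable borel" "\<And>z. 0 \<le> w2 z"
      "\<And>c z. 0 < c \<Longrightarrow> w2 (c *\<^sub>R z) = c powr p * w2 z"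
  shows "(\<integral>\<^sup>+z\<in>ball 0 1. w1 z \<partial>lborel) * (\<integral>\<^sup>+z. ennreal (\<rho> (norm z) * w2 z) \<partial>lborel) =
    (\<integral>\<^sup>+z\<in>ball 0 1. w2 z \<partial>lborel) * (\<integral>\<^sup>+z. ennreal (\<rho> (norm z) * w1 z) \<partial>lborel)"
proof -
  have layer: "(\<integral>\<^sup>+z. ennreal (\<rho> (norm z) * w z) \<partial>lborel) =
      (\<integral>\<^sup>+t. indicator {0..} t * (\<integral>\<^sup>+z. ennreal (w z) * indicator {z. t < \<rho> (norm z)} z \<partial>lborel) \<partial>lborel)"
    if [measurable]: "w \<in> borel_measurable borel" and w0: "\<And>z. 0 \<le> w z" for w :: "'a \<Rightarrow> real"
  proof -
    have "(\<integral>\<^sup>+z. ennreal (\<rho> (norm z) * w z) \<partial>lborel) =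
        (\<integral>\<^sup>+z. \<integral>\<^sup>+t. indicator {0..<\<rho> (norm z)} t * ennreal (w z) \<partial>lborel \<partial>lborel)"
      by (intro nn_integral_cong) (simp add: nn_integral_multc ennreal_mult nonneg w0)
    also have "\<dots> = (\<integral>\<^sup>+z. \<integral>\<^sup>+t. indicator {0..} t * (if t < \<rho> (norm z) then 1 else 0) * ennreal (w z) \<partial>lborel \<partial>lborel)"
      by (intro nn_integral_cong) (auto simp: indicator_def)
    also have "\<dots> = (\<integral>\<^sup>+t. \<integral>\<^sup>+z. indicator {0..} t * (if t < \<rho> (norm z) then 1 else 0) * ennreal (w z) \<partial>lborel \<partial>lborel)"
      by (rule lborel_pair.Fubini'[symmetric]) measurable
    also have "\<dots> = (\<integral>\<^sup>+t. \<integral>\<^sup>+z. indicator {0..} t * (ennreal (w z) * indicator {z. t < \<rho> (norm z)} z) \<partial>lborel \<partial>lborel)"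
      by (intro nn_integral_cong) (auto simp: indicator_def)
    finally show ?thesis by (simp add: nn_integral_cmult)
  qed
  let ?A1 = "\<integral>\<^sup>+z\<in>ball 0 1. w1 z \<partial>lborel" and ?A2 = "\<integral>\<^sup>+z\<in>ball 0 1. w2 z \<partial>lborel"
  let ?I = "\<lambda>w t. \<integral>\<^sup>+z. ennreal (w z) * indicator {z::'a. t < \<rho> (norm z)} z \<partial>lborel"
  note [measurable] = w1(1) w2(1)
  have eq: "indicator {0..} t * (?A1 * ?I w2 t) = indicator {0..} t * (?A2 * ?I w1 t)" for t
  proof (cases "0 \<le> t")
    case True
    obtain r where r: "\<And>w::'a \<Rightarrow> real. w \<in> borel_measurable borel \<Longrightarrow> (\<forall>z. 0 \<le> w z) \<Longrightarrow>
      (\<forall>c z. 0 < c \<longrightarrow> w (c *\<^sub>R z) = c powr p * w z) \<Longrightarrow>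
      ?I w t = ennreal r * (\<integral>\<^sup>+z\<in>ball 0 1. w z \<partial>lborel)"
      using nn_integral_superlevel_homogeneous[OF assms(1) mono supp True, of p] by auto
    show ?thesis using r[of w1] r[of w2] w1 w2 by (simp add: mult_ac)
  qed simp
  have [measurable]: "?I w1 \<in> borel_measurable borel" "?I w2 \<in> borel_measurable borel"
    by measurable
  have "?A1 * (\<integral>\<^sup>+z. ennreal (\<rho> (norm z) * w2 z) \<partial>lborel) = (\<integral>\<^sup>+t. ?A1 * (indicator {0..} t * ?I w2 t) \<partial>lborel)"
    unfolding layer[OF w2(1,2)] by (rule nn_integral_cmult[symmetric]) measurable
  also have "\<dots> = (\<integral>\<^sup>+t. ?A2 * (indicator {0..} t * ?I w1 t) \<partial>lborel)"
    using eq by (intro nn_integral_cong) (simp add: mult_ac)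
  also have "\<dots> = ?A2 * (\<integral>\<^sup>+z. ennreal (\<rho> (norm z) * w1 z) \<partial>lborel)"
    unfolding layer[OF w1(1,2)] by (rule nn_integral_cmult) measurable
  finally show ?thesis .
qed

text \<open>|z|^p is the integral of p t^(p-1) over [0, |z|), so exchanging the integrals leaves
  volumes of spherical shells and a one-dimensional integral over [0, 1).\<close>

lemma nn_integral_ball_norm_powr:
  fixes p :: real
  assumes p: "0 < p"
  shows "(\<integral>\<^sup>+z\<in>ball (0::'a::euclidean_space) 1. ennreal (norm z powr p) \<partial>lborel) =
    ennreal (unit_ball_vol DIM('a) * (DIM('a) / (DIM('a) + p)))"
proof -
  let ?V = "unit_ball_vol (real DIM('a))"
  have d: "0 < real DIM('a)" by simp
  have 1: "(\<integral>\<^sup>+t. ennreal (p * t powr (p - 1)) * indicator {0..<s} t \<partial>lborel) = ennreal (s powr p)" if "0 \<le> s" for s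
  proof -
    have "((\<lambda>t. p * t powr (p - 1)) has_integral (s powr p - 0 powr p)) {0..s}"
    proof (rule fundamental_theorem_of_calculus_interior)
      show "continuous_on {0..s} (\<lambda>t. t powr p)" using p by (intro continuous_intros continuous_on_powr') auto
      show "((\<lambda>t. t powr p) has_vector_derivative p * x powr (p - 1)) (at x)" if "x \<in> {0<..<s}" for x
        using that has_real_derivative_powr[of x p] by (simp add: has_real_derivative_iff_has_vector_derivative)
    qed (use that in auto)
    then have "(\<integral>\<^sup>+t. ennreal (indicator {0..s} t * (p * t powr (p - 1))) \<partial>lborel) = ennreal (s powr p)"
      using p nn_integral_has_integral_lebesgue[of "{0..s}" "\<lambda>t. p * t powr (p - 1)" "s powr p"] by simp
    moreover have "(\<integral>\<^sup>+t. ennreal (p * t powr (p - 1)) * indicator {0..<s} t \<partial>lborel) =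
        (\<integral>\<^sup>+t. ennreal (indicator {0..s} t * (p * t powr (p - 1))) \<partial>lborel)"
      by (intro nn_integral_cong_AE eventually_mono[OF AE_lborel_singleton[of s]]) (auto simp: indicator_def)
    ultimately show ?thesis by simp
  qed
  have shell: "emeasure lborel {z::'a. t < norm z \<and> norm z < 1} = ennreal (?V * (1 - t ^ DIM('a)))"
    if "0 \<le> t" "t < 1" for t
  proof -
    have "{z::'a. t < norm z \<and> norm z < 1} = ball 0 1 - cball 0 t" by auto
    moreover have "emeasure lborel (ball (0::'a) 1 - cball 0 t) =
        emeasure lborel (ball (0::'a) 1) - emeasure lborel (cball (0::'a) t)"
      using that by (intro emeasure_Diff) (auto simp: emeasure_cball)
    ultimately show ?thesis
      using that by (simp add: emeasure_cball emeasure_ball ennreal_minus algebra_simps)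
  qed
  have "(\<integral>\<^sup>+z\<in>ball (0::'a) 1. ennreal (norm z powr p) \<partial>lborel) =
      (\<integral>\<^sup>+z. \<integral>\<^sup>+t. ennreal (p * t powr (p - 1)) * indicator {0..<norm z} t * indicator (ball (0::'a) 1) z \<partial>lborel \<partial>lborel)"
    by (intro nn_integral_cong) (simp add: nn_integral_multc 1)
  also have "\<dots> = (\<integral>\<^sup>+z. \<integral>\<^sup>+t. ennreal (p * t powr (p - 1)) * indicator {0..} t * (if t < norm z \<and> norm z < 1 then 1 else 0) \<partial>lborel \<partial>(lborel::'a measure))"
    by (intro nn_integral_cong) (auto simp: indicator_def)
  also have "\<dots> = (\<integral>\<^sup>+t. \<integral>\<^sup>+z. ennreal (p * t powr (p - 1)) * indicator {0..} t * (if t < norm z \<and> norm z < 1 then 1 else 0) \<partial>(lborel::'a measure) \<partial>lborel)"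
    by (rule lborel_pair.Fubini'[symmetric]) measurable
  also have "\<dots> = (\<integral>\<^sup>+t. ennreal (?V * (p * t powr (p - 1) - p * t powr (DIM('a) + p - 1))) * indicator {0..<1} t \<partial>lborel)"
  proof (rule nn_integral_cong)
    fix t :: real
    have "(\<integral>\<^sup>+z. ennreal (p * t powr (p - 1)) * indicator {0..} t * (if t < norm z \<and> norm z < 1 then 1 else 0) \<partial>(lborel::'a measure))
      = ennreal (p * t powr (p - 1)) * indicator {0..} t * (\<integral>\<^sup>+z. indicator {z. t < norm z \<and> norm z < 1} z \<partial>(lborel::'a measure))"
      by (subst nn_integral_cmult[symmetric]) (auto intro!: nn_integral_cong simp: indicator_def)
    also have "\<dots> = ennreal (?V * (p * t powr (p - 1) - p * t powr (DIM('a) + p - 1))) * indicator {0..<1} t"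
    proof (cases "0 \<le> t \<and> t < 1")
      case True
      have "t powr (p - 1) * t ^ DIM('a) = t powr (DIM('a) + p - 1)"
      proof (cases "t = 0")
        case False
        then show ?thesis using True by (simp add: powr_realpow[symmetric] powr_add[symmetric] algebra_simps)
      qed simp
      then show ?thesis
        using True p by (simp add: shell ennreal_mult'[symmetric] algebra_simps)
    next
      case False
      then consider "t < 0" | "{z::'a. t < norm z \<and> norm z < 1} = {}" "\<not> t < 1" by fastforce
      then show ?thesis
      proof cases
        case 2
        show ?thesis unfolding 2(1) using 2(2) by simp
      qed simp
    qed
    finally show "(\<integral>\<^sup>+z. ennreal (p * t powr (p - 1)) * indicator {0..} t * (if t < norm z \<and> norm z < 1 then 1 else 0) \<partial>(lborel::'a measure)) =
       ennreal (?V * (p * t powr (p - 1) - p * t powr (DIM('a) + p - 1))) * indicator {0..<1} t" .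
  qed
  also have "\<dots> = ennreal (?V * (1 - p / (DIM('a) + p)))"
  proof -
    let ?F = "\<lambda>t. ?V * (t powr p - p / (DIM('a) + p) * t powr (DIM('a) + p))"
    have "((\<lambda>t. ?V * (p * t powr (p - 1) - p * t powr (DIM('a) + p - 1))) has_integral (?F 1 - ?F 0)) {0..1}"
    proof (rule fundamental_theorem_of_calculus_interior)
      show "continuous_on {0..1} ?F" using p d by (intro continuous_intros continuous_on_powr') auto
      show "(?F has_vector_derivative ?V * (p * x powr (p - 1) - p * x powr (DIM('a) + p - 1))) (at x)" if "x \<in> {0<..<1}" for x
      proof -
        have "(?F has_real_derivative ?V * (p * x powr (p - 1) -
            p / (DIM('a) + p) * ((DIM('a) + p) * x powr (DIM('a) + p - 1)))) (at x)"
          using that by (intro DERIV_cmult DERIV_diff has_real_derivative_powr) auto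
        then show ?thesis
          using p d by (simp add: has_real_derivative_iff_has_vector_derivative)
      qed
    qed simp
    moreover have "0 \<le> ?V * (p * t powr (p - 1) - p * t powr (DIM('a) + p - 1))" if "t \<in> {0..1}" for t
    proof -
      have "t powr (DIM('a) + p - 1) \<le> t powr (p - 1)"
        using that by (cases "t = 0") (auto intro!: powr_mono')
      then show ?thesis using p by (intro mult_nonneg_nonneg) auto
    qed
    ultimately have "(\<integral>\<^sup>+t. ennreal (indicator {0..1} t * (?V * (p * t powr (p - 1) - p * t powr (DIM('a) + p - 1)))) \<partial>lborel) =
      ennreal (?V * (1 - p / (DIM('a) + p)))"
      using nn_integral_has_integral_lebesgue[of "{0..1}" "\<lambda>t. ?V * (p * t powr (p - 1) - p * t powr (DIM('a) + p - 1))" "?F 1 - ?F 0"] p by simp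
    moreover have "(\<integral>\<^sup>+t. ennreal (?V * (p * t powr (p - 1) - p * t powr (DIM('a) + p - 1))) * indicator {0..<1} t \<partial>lborel) =
      (\<integral>\<^sup>+t. ennreal (indicator {0..1} t * (?V * (p * t powr (p - 1) - p * t powr (DIM('a) + p - 1)))) \<partial>lborel)"
      by (intro nn_integral_cong_AE eventually_mono[OF AE_lborel_singleton[of 1]]) (auto simp: indicator_def)
    ultimately show ?thesis by simp
  qed
  also have "1 - p / (DIM('a) + p) = DIM('a) / (DIM('a) + p)"
    using p d by (simp add: field_simps)
  finally show ?thesis .
qed

text \<open>The weight exp(-|z|^2) |b . z|^p is a product over the coordinates: one factor is a
  Gaussian moment, the others are plain Gaussian integrals. Dividing by the Gamma factor of
  \<open>nn_integral_gaussian_homogeneous\<close> returns to the ball.\<close>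

lemma nn_integral_ball_inner_powr:
  fixes p :: real and b :: "'a::euclidean_space"
  assumes p: "0 < p" and b: "b \<in> Basis"
  shows "(\<integral>\<^sup>+z\<in>ball (0::'a) 1. ennreal (\<bar>b \<bullet> z\<bar> powr p) \<partial>lborel) =
    ennreal (Gamma ((p + 1) / 2) * sqrt pi ^ (DIM('a) - 1) / Gamma ((DIM('a) + p) / 2 + 1))"
proof -
  let ?G = "\<lambda>q s. ennreal (exp (- s\<^sup>2) * \<bar>s\<bar> powr q)"
  \<comment> \<open>In dimension one |s| is the norm, so the moment lemmas for balls evaluate the
    factors themselves.\<close>
  have g1: "(\<integral>\<^sup>+s. ?G q s \<partial>lborel) = ennreal (Gamma ((1 + q) / 2 + 1) * (2 / (1 + q)))" if q: "0 \<le> q" for q :: real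
  proof -
    have "(\<integral>\<^sup>+s. ?G q s \<partial>lborel) = (\<integral>\<^sup>+s. ennreal (exp (- (norm s)\<^sup>2) * \<bar>s\<bar> powr q) \<partial>lborel)" by simp
    also have "\<dots> = ennreal (Gamma ((DIM(real) + q) / 2 + 1)) * (\<integral>\<^sup>+(s::real)\<in>ball 0 1. \<bar>s\<bar> powr q \<partial>lborel)"
      using q by (intro nn_integral_gaussian_homogeneous) (auto simp: abs_mult powr_mult)
    also have "(\<integral>\<^sup>+(s::real)\<in>ball 0 1. \<bar>s\<bar> powr q \<partial>lborel) = ennreal (2 / (1 + q))"
    proof (cases "q = 0")
      case True
      have "(\<integral>\<^sup>+(s::real)\<in>ball 0 1. \<bar>s\<bar> powr q \<partial>lborel) = (\<integral>\<^sup>+(s::real). indicator (ball 0 1) s \<partial>lborel)"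
      proof (rule nn_integral_cong_AE)
        show "AE s in lborel. ennreal (\<bar>s\<bar> powr q) * indicator (ball 0 1) s = indicator (ball 0 1) s"
          using AE_lborel_singleton[of "0::real"] by eventually_elim (simp add: True)
      qed
      also have "\<dots> = emeasure lborel (ball (0::real) 1)" by (rule nn_integral_indicator) simp
      finally show ?thesis using True by (simp add: emeasure_ball)
    next
      case False
      then show ?thesis using nn_integral_ball_norm_powr[of q, where 'a = real] q by simp
    qed
    finally show ?thesis
      using q by (subst ennreal_mult'') auto
  qed
  have gp: "(\<integral>\<^sup>+s. ?G q s \<partial>lborel) = ennreal (Gamma ((q + 1) / 2))" if q: "0 \<le> q" for q :: real
  proof -
    have "Gamma ((1 + q) / 2 + 1) = ((1 + q) / 2) * Gamma ((1 + q) / 2)"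
      using q by (intro Gamma_plus1) (auto simp: nonpos_Ints_def)
    then show ?thesis using g1[OF q] q by (simp add: add.commute)
  qed
  have g0: "(\<integral>\<^sup>+s. ennreal (exp (- s\<^sup>2)) \<partial>lborel) = ennreal (sqrt pi)"
  proof -
    \<comment> \<open>Since \<open>0 powr 0 = 0\<close>, the two integrands differ at the
      origin.\<close>
    have "(\<integral>\<^sup>+s. ennreal (exp (- s\<^sup>2)) \<partial>lborel) = (\<integral>\<^sup>+s. ?G 0 s \<partial>lborel)"
      by (intro nn_integral_cong_AE eventually_mono[OF AE_lborel_singleton[of 0]]) auto
    then show ?thesis using gp[of 0] by (simp add: Gamma_one_half_real)
  qed
  define f :: "'a \<Rightarrow> real \<Rightarrow> real" where "f = (\<lambda>i s. exp (- s\<^sup>2) * (if i = b then \<bar>s\<bar> powr p else 1))"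
  have f: "exp (- (norm z)\<^sup>2) * \<bar>b \<bullet> z\<bar> powr p = (\<Prod>i\<in>Basis. f i (z \<bullet> i))" for z :: 'a
  proof -
    have "(norm z)\<^sup>2 = (\<Sum>i\<in>Basis. (z \<bullet> i)\<^sup>2)"
      unfolding power2_norm_eq_inner by (subst euclidean_inner) (simp add: power2_eq_square)
    then have "exp (- (norm z)\<^sup>2) = (\<Prod>i\<in>Basis. exp (- (z \<bullet> i)\<^sup>2))"
      by (simp add: exp_sum sum_negf[symmetric])
    moreover have "(\<Prod>i\<in>Basis. if i = b then \<bar>z \<bullet> i\<bar> powr p else 1) = \<bar>b \<bullet> z\<bar> powr p"
      using b by (simp add: prod.delta inner_commute)
    ultimately show ?thesis by (simp add: f_def prod.distrib)
  qed
  have "(\<integral>\<^sup>+z. ennreal (exp (- (norm z)\<^sup>2) * \<bar>b \<bullet> z\<bar> powr p) \<partial>lborel) =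
      (\<integral>\<^sup>+z. (\<Prod>i\<in>Basis. ennreal (f i (z \<bullet> i))) \<partial>(lborel::'a measure))"
    unfolding f by (intro nn_integral_cong) (subst prod_ennreal, auto simp: f_def)
  also have "\<dots> = (\<Prod>i\<in>(Basis::'a set). (\<integral>\<^sup>+s. ennreal (f i s) \<partial>lborel))"
    by (rule nn_integral_lborel_prod) (auto simp: f_def)
  also have "\<dots> = (\<Prod>i\<in>(Basis::'a set). if i = b then ennreal (Gamma ((p + 1) / 2)) else ennreal (sqrt pi))"
    using p gp[of p] g0 by (intro prod.cong) (auto simp: f_def)
  also have "\<dots> = ennreal (Gamma ((p + 1) / 2)) * ennreal (sqrt pi) ^ (DIM('a) - 1)"
    using b by (subst prod.remove[OF _ b]) (auto simp: prod_constant[symmetric] intro!: prod.cong)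
  also have "\<dots> = ennreal (Gamma ((p + 1) / 2) * sqrt pi ^ (DIM('a) - 1))"
    using p by (simp add: ennreal_power ennreal_mult' Gamma_real_nonneg)
  finally have L: "(\<integral>\<^sup>+z. ennreal (exp (- (norm z)\<^sup>2) * \<bar>b \<bullet> z\<bar> powr p) \<partial>lborel) =
      ennreal (Gamma ((p + 1) / 2) * sqrt pi ^ (DIM('a) - 1))" .
  have "(\<integral>\<^sup>+z. ennreal (exp (- (norm z)\<^sup>2) * \<bar>b \<bullet> z\<bar> powr p) \<partial>lborel) =
    ennreal (Gamma ((DIM('a) + p) / 2 + 1)) * (\<integral>\<^sup>+z\<in>ball (0::'a) 1. \<bar>b \<bullet> z\<bar> powr p \<partial>lborel)"
    using p by (intro nn_integral_gaussian_homogeneous) (auto simp: abs_mult powr_mult)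
  with L have eq: "ennreal (Gamma ((p + 1) / 2) * sqrt pi ^ (DIM('a) - 1)) =
    ennreal (Gamma ((DIM('a) + p) / 2 + 1)) * (\<integral>\<^sup>+z\<in>ball (0::'a) 1. \<bar>b \<bullet> z\<bar> powr p \<partial>lborel)" by simp
  have G: "0 < Gamma ((DIM('a) + p) / 2 + 1)"
    using p by (intro Gamma_real_pos) (simp add: add_nonneg_pos)
  have "ennreal (Gamma ((p + 1) / 2) * sqrt pi ^ (DIM('a) - 1)) =
    ennreal (Gamma ((DIM('a) + p) / 2 + 1)) * ennreal (Gamma ((p + 1) / 2) * sqrt pi ^ (DIM('a) - 1) / Gamma ((DIM('a) + p) / 2 + 1))"
    using G by (subst ennreal_mult'[symmetric]) auto
  with eq show ?thesis using G by (simp add: ennreal_mult_cancel_left)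
qed

text \<open>The two quantities compared with \<open>Cbar\<close> are the unit ball moments of |z|^p
  and |b . z|^p just computed. Hence a kernel whose p-th moment is \<open>Cbar\<close> has
  directional moment one.\<close>

lemma Cbar_ratio:
  fixes p :: real
  assumes p: "0 < p"
  shows "unit_ball_vol DIM('a::euclidean_space) * (DIM('a) / (DIM('a) + p)) =
    Cbar DIM('a) p * (Gamma ((p + 1) / 2) * sqrt pi ^ (DIM('a) - 1) / Gamma ((DIM('a) + p) / 2 + 1))"
proof -
  let ?d = "real DIM('a)"
  have d: "0 < ?d" by simp
  have "Gamma (x + 1) = x * Gamma x" if "0 < x" for x :: real
    using that nonpos_Ints_nonpos[of x] by (intro Gamma_plus1) auto
  then have 1: "Gamma (?d / 2 + 1) = ?d / 2 * Gamma (?d / 2)" "Gamma ((?d + p) / 2 + 1) = (?d + p) / 2 * Gamma ((?d + p) / 2)"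
    using p d by (metis half_gt_zero, metis half_gt_zero add_pos_pos)
  have pos: "0 < Gamma (?d / 2)" "0 < Gamma ((?d + p) / 2)" "0 < Gamma ((p + 1) / 2)"
    using p d by (auto intro!: Gamma_real_pos)
  have pi: "pi powr (?d / 2) = sqrt pi * sqrt pi ^ (DIM('a) - 1)"
  proof -
    have "pi powr (?d / 2) = (pi powr (1/2)) powr ?d" by (simp add: powr_powr)
    also have "\<dots> = sqrt pi ^ DIM('a)" by (simp add: powr_half_sqrt powr_realpow)
    also have "\<dots> = sqrt pi ^ Suc (DIM('a) - 1)" using d by simp
    finally show ?thesis by (simp only: power_Suc)
  qed
  \<comment> \<open>Here \<open>a\<close>, \<open>b\<close>, \<open>c\<close> stand for the Gamma
    values at d/2, (d+p)/2 and (p+1)/2, \<open>s\<close> for sqrt pi, \<open>q\<close> for its power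
    and \<open>e\<close> for d + p.\<close>
  have "s * q / (d / 2 * a) * (d / e) = s * b / (c * a) * (c * q / (e / 2 * b))"
    if "a \<noteq> 0" "b \<noteq> 0" "c \<noteq> 0" "d \<noteq> 0" "e \<noteq> 0" for a b c d e s q :: real
    using that by (simp add: field_simps)
  then show ?thesis
    unfolding unit_ball_vol_def Cbar_def 1 pi using pos d p by (metis less_irrefl add_pos_pos)
qed

section \<open>The normalised kernel and its directional moments\<close>

lemma kernel_vanishes:
  assumes "admissible_kernel TYPE('a::euclidean_space) p \<rho>" "1 \<le> t"
  shows "\<rho> t = 0"
proof (rule ccontr)
  assume "\<rho> t \<noteq> 0"
  then have "t \<in> closure {t. \<rho> t \<noteq> 0}" by (intro subsetD[OF closure_subset]) simp
  then show False using assms by (auto simp: admissible_kernel_def)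
qed

text \<open>Homogeneity reduces to a unit vector and rotation invariance to a basis vector, where
  the quotient of moments and the value of \<open>Cbar\<close> leave exactly one.\<close>

lemma kernel_directional_moment:
  fixes g :: "'a::euclidean_space"
  assumes kern: "admissible_kernel TYPE('a) p \<rho>" and p: "0 < p"
  shows "(\<integral>\<^sup>+z. ennreal (\<rho> (norm z) * \<bar>g \<bullet> z\<bar> powr p) \<partial>lborel) = ennreal (norm g powr p)"
proof (cases "g = 0")
  case False
  note k = kern[unfolded admissible_kernel_def]
  have [measurable]: "\<rho> \<in> borel_measurable borel" and nonneg: "\<And>t. 0 \<le> \<rho> t" using k by auto
  \<comment> \<open>Monotonicity is assumed on [0,1) only; it extends past 1 because the kernel
    vanishes there.\<close>
  have mono: "\<rho> t \<le> \<rho> s" if "0 \<le> s" "s \<le> t" for s t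
    using that k kernel_vanishes[OF kern, of t] by (cases "t < 1") (auto simp: not_less)
  obtain b :: 'a where b: "b \<in> Basis" using nonempty_Basis by blast
  let ?w1 = "\<lambda>z::'a. norm z powr p" and ?w2 = "\<lambda>z::'a. \<bar>b \<bullet> z\<bar> powr p"
  have mom: "(\<integral>\<^sup>+z. ennreal (\<rho> (norm z) * ?w1 z) \<partial>lborel) = ennreal (Cbar DIM('a) p)"
  proof -
    have "(\<integral>\<^sup>+z. ennreal (\<rho> (norm z) * ?w1 z) \<partial>lborel) = (\<integral>\<^sup>+z\<in>ball (0::'a) 1. ennreal (norm z powr p * \<rho> (norm z)) \<partial>lborel)"
      using kernel_vanishes[OF kern] by (intro nn_integral_cong) (auto simp: indicator_def mult.commute not_less)
    also have "\<dots> = ennreal (Cbar DIM('a) p)" using k by (simp add: nn_integral_completion)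
    finally show ?thesis .
  qed
  have ratio: "(\<integral>\<^sup>+z\<in>ball 0 1. ?w1 z \<partial>lborel) * (\<integral>\<^sup>+z. ennreal (\<rho> (norm z) * ?w2 z) \<partial>lborel) =
      (\<integral>\<^sup>+z\<in>ball 0 1. ?w2 z \<partial>lborel) * (\<integral>\<^sup>+z. ennreal (\<rho> (norm z) * ?w1 z) \<partial>lborel)"
    by (rule nn_integral_radial_ratio[where p = p])
       (auto simp: nonneg mono kernel_vanishes[OF kern] abs_mult powr_mult)
  let ?A = "Gamma ((p + 1) / 2) * sqrt pi ^ (DIM('a) - 1) / Gamma ((DIM('a) + p) / 2 + 1)"
  have A: "0 < ?A" and C: "0 < Cbar DIM('a) p"
    unfolding Cbar_def using p
    by (auto intro!: Gamma_real_pos divide_pos_pos mult_pos_pos zero_less_power simp: add_nonneg_pos add_pos_pos)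
  \<comment> \<open>The positive finite factor is kept on both sides so that it can be cancelled in
    the extended reals.\<close>
  have "ennreal (?A * Cbar DIM('a) p) * (\<integral>\<^sup>+z. ennreal (\<rho> (norm z) * ?w2 z) \<partial>lborel) = ennreal (?A * Cbar DIM('a) p) * 1"
    using ratio Cbar_ratio[OF p, where 'a = 'a] A C
    unfolding mom nn_integral_ball_norm_powr[OF p] nn_integral_ball_inner_powr[OF p b]
    by (simp add: mult.commute ennreal_mult'[symmetric])
  moreover have "ennreal (?A * Cbar DIM('a) p) \<noteq> 0" using mult_pos_pos[OF A C] by (metis ennreal_eq_0_iff not_le)
  ultimately have one: "(\<integral>\<^sup>+z. ennreal (\<rho> (norm z) * ?w2 z) \<partial>lborel) = 1"
    by (subst (asm) ennreal_mult_cancel_left) auto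
  let ?u = "g /\<^sub>R norm g"
  have "(\<integral>\<^sup>+z. ennreal (\<rho> (norm z) * \<bar>g \<bullet> z\<bar> powr p) \<partial>lborel) =
      (\<integral>\<^sup>+z. ennreal (norm g powr p) * ennreal (\<rho> (norm z) * \<bar>?u \<bullet> z\<bar> powr p) \<partial>lborel)"
  proof (rule nn_integral_cong)
    fix z
    have "\<bar>g \<bullet> z\<bar> powr p = norm g powr p * \<bar>?u \<bullet> z\<bar> powr p"
      using False by (simp add: powr_mult[symmetric] abs_mult mult.assoc[symmetric])
    then show "ennreal (\<rho> (norm z) * \<bar>g \<bullet> z\<bar> powr p) = ennreal (norm g powr p) * ennreal (\<rho> (norm z) * \<bar>?u \<bullet> z\<bar> powr p)"
      by (simp add: ennreal_mult'[symmetric] mult_ac)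
  qed
  also have "\<dots> = ennreal (norm g powr p) * (\<integral>\<^sup>+z. ennreal (\<rho> (norm z) * \<bar>?u \<bullet> z\<bar> powr p) \<partial>lborel)"
    by (rule nn_integral_cmult) measurable
  also have "(\<integral>\<^sup>+z. ennreal (\<rho> (norm z) * \<bar>?u \<bullet> z\<bar> powr p) \<partial>lborel) = (\<integral>\<^sup>+z. ennreal (\<rho> (norm z) * ?w2 z) \<partial>lborel)"
    using False b by (intro nn_integral_radial_direction[where F = "\<lambda>r s. ennreal (\<rho> r * \<bar>s\<bar> powr p)"]) auto
  finally show ?thesis by (simp add: one)
qed (use p in simp)

section \<open>Inequalities for powers\<close>

lemma convex_on_powr:
  assumes p: "1 \<le> p"
  shows "convex_on {0..} (\<lambda>x::real. x powr p)"
proof (rule convex_onI)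
  fix t x y :: real
  assume t: "0 < t" "t < 1" and xy: "x \<in> {0..}" "y \<in> {0..}"
  \<comment> \<open>At the endpoint 0 of the half-line convexity reduces to this inequality for the
    weights.\<close>
  have tp: "s powr p \<le> s" if "0 < s" "s < 1" for s
    using powr_mono'[of 1 p s] p that by simp
  show "((1 - t) *\<^sub>R x + t *\<^sub>R y) powr p \<le> (1 - t) * x powr p + t * y powr p"
  proof (cases "x = 0 \<or> y = 0")
    case True
    then show ?thesis
      using t xy tp[of t] tp[of "1 - t"] by (auto simp: powr_mult intro!: mult_right_mono)
  next
    case False
    then show ?thesis
      using convex_onD[OF powr_convex[OF p], of t x y] t xy by auto
  qed
qed simp

text \<open>Jensen's inequality with equal weights.\<close>

lemma sum_powr_le:
  fixes a :: "nat \<Rightarrow> real"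
  assumes p: "1 \<le> p" and k: "0 < k" and a: "\<And>j. j < k \<Longrightarrow> 0 \<le> a j"
  shows "(\<Sum>j<k. a j) powr p \<le> real k powr (p - 1) * (\<Sum>j<k. a j powr p)"
proof -
  have "(\<Sum>j<k. (1 / k) *\<^sub>R a j) powr p \<le> (\<Sum>j<k. (1 / k) * a j powr p)"
    by (rule convex_on_sum[OF _ _ convex_on_powr[OF p]]) (use k a in auto)
  then have "((\<Sum>j<k. a j) / k) powr p \<le> (\<Sum>j<k. a j powr p) / k"
    by (simp add: sum_divide_distrib)
  then have "(\<Sum>j<k. a j) powr p / k powr p \<le> (\<Sum>j<k. a j powr p) / k"
    using a by (simp add: powr_divide sum_nonneg)
  then have "(\<Sum>j<k. a j) powr p \<le> k powr p * ((\<Sum>j<k. a j powr p) / k)"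
    using k by (simp add: pos_divide_le_eq mult.commute)
  also have "\<dots> = real k powr (p - 1) * (\<Sum>j<k. a j powr p)"
    using k by (simp add: powr_diff)
  finally show ?thesis .
qed

text \<open>Convexity with weights \<open>1 - s\<close> and \<open>s\<close>. The factor of
  \<open>a\<close> tends to one as \<open>s\<close> tends to 0, so a perturbation \<open>b\<close>
  that vanishes in the limit costs nothing; equal weights would lose a constant.\<close>

lemma powr_add_le_weighted:
  fixes a b :: "'b::real_normed_vector"
  assumes p: "1 \<le> p" and s: "0 < s" "s < 1"
  shows "norm (a + b) powr p \<le> (1 - s) powr (1 - p) * norm a powr p + s powr (1 - p) * norm b powr p"
proof -
  have "norm (a + b) powr p \<le> (norm a + norm b) powr p"
    using p by (intro powr_mono2) (auto simp: norm_triangle_ineq)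
  also have "\<dots> = ((1 - s) *\<^sub>R (norm a / (1 - s)) + s *\<^sub>R (norm b / s)) powr p"
    using s by simp
  also have "\<dots> \<le> (1 - s) * (norm a / (1 - s)) powr p + s * (norm b / s) powr p"
    using s by (intro convex_onD[OF convex_on_powr[OF p]]) auto
  also have "\<dots> = (1 - s) powr (1 - p) * norm a powr p + s powr (1 - p) * norm b powr p"
    using s by (simp add: powr_divide powr_diff)
  finally show ?thesis .
qed

text \<open>Superadditivity of x^(p/2) merges the two terms on the left into a power of a sum of
  squares, the parallelogram identity rewrites that sum, and convexity of x^(p/2) splits it again.
  The first and the last step use p/2 \<ge> 1.\<close>

lemma clarkson_powr:
  fixes a b :: real
  assumes p: "2 \<le> p"
  shows "\<bar>(a + b) / 2\<bar> powr p + \<bar>(a - b) / 2\<bar> powr p \<le> (\<bar>a\<bar> powr p + \<bar>b\<bar> powr p) / 2"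
proof -
  have sq: "\<bar>x\<bar> powr p = (x\<^sup>2) powr (p / 2)" for x :: real
  proof -
    have "(x\<^sup>2) powr (p / 2) = (\<bar>x\<bar> powr 2) powr (p / 2)" by (cases "x = 0") auto
    also have "\<dots> = \<bar>x\<bar> powr p" unfolding powr_powr by simp
    finally show ?thesis by simp
  qed
  have super: "x powr q + y powr q \<le> (x + y) powr q" if "0 \<le> x" "0 \<le> y" "1 \<le> q" for x y q :: real
  proof (cases "x + y = 0")
    case True then show ?thesis using that by (simp add: add_nonneg_eq_0_iff)
  next
    case False
    then have xy: "0 < x + y" using that by simp
    have le: "v powr q \<le> v" if "0 \<le> v" "v \<le> 1" for v :: real
      using that \<open>1 \<le> q\<close> powr_mono'[of 1 q v] by simp
    have "(x / (x + y)) powr q + (y / (x + y)) powr q \<le> x / (x + y) + y / (x + y)"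
      using that xy by (intro add_mono le) (auto simp: divide_simps)
    also have "\<dots> = 1" using xy by (simp add: add_divide_distrib[symmetric])
    finally show ?thesis using that xy by (simp add: powr_divide add_divide_distrib[symmetric])
  qed
  have "\<bar>(a + b) / 2\<bar> powr p + \<bar>(a - b) / 2\<bar> powr p \<le> (((a + b) / 2)\<^sup>2 + ((a - b) / 2)\<^sup>2) powr (p / 2)"
    unfolding sq using p by (intro super) auto
  also have "((a + b) / 2)\<^sup>2 + ((a - b) / 2)\<^sup>2 = (1 - 1/2) *\<^sub>R a\<^sup>2 + (1/2) *\<^sub>R b\<^sup>2"
    by (simp add: power2_eq_square field_simps)
  also have "\<dots> powr (p / 2) \<le> (1 - 1/2) * a\<^sup>2 powr (p / 2) + (1/2) * b\<^sup>2 powr (p / 2)"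
    using p by (intro convex_onD[OF convex_on_powr]) auto
  finally show ?thesis by (simp add: sq)
qed

text \<open>Fubini and translation invariance in the first variable. It permits convergence outside
  a null set to be used at the shifted point of a difference quotient.\<close>

lemma AE_lborel_pair_notin:
  fixes Z :: "'a::euclidean_space set"
  assumes "Z \<in> null_sets lborel"
  shows "AE w in lborel \<Otimes>\<^sub>M lborel. fst w + t *\<^sub>R snd w \<notin> Z"
proof (rule lborel_pair.AE_pair_measure)
  have [measurable]: "Z \<in> sets borel" using assms by auto
  show S: "{w \<in> space (lborel \<Otimes>\<^sub>M lborel). fst w + t *\<^sub>R snd w \<notin> Z} \<in> sets (lborel \<Otimes>\<^sub>M lborel)"
    by measurable
  have *: "AE x in lborel. x + c \<notin> Z" for c
  proof -
    have "AE x in distr lborel borel ((+) c). x \<notin> Z"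
      unfolding lborel_distr_plus using assms by (rule AE_not_in)
    then show ?thesis by (subst (asm) AE_distr_iff) (auto simp: add.commute)
  qed
  have "AE z in lborel. AE x in lborel. x + t *\<^sub>R z \<notin> Z" using * by simp
  then show "AE x in lborel. AE z in lborel. fst (x, z) + t *\<^sub>R snd (x, z) \<notin> Z"
    using lborel_pair.AE_commute[OF S] by simp
qed

lemma AE_lborel_pair_fst:
  fixes Z :: "'a::euclidean_space set"
  assumes "Z \<in> null_sets lborel"
  shows "AE w in lborel \<Otimes>\<^sub>M (lborel :: 'a measure). fst w \<notin> Z"
  using AE_lborel_pair_notin[OF assms, of 0] by simp

section \<open>The nonlocal energy on the whole space\<close>

lemma directional_quotient_tendsto:
  fixes u :: "'a::euclidean_space \<Rightarrow> real"
  assumes "(u has_derivative (\<lambda>z. g \<bullet> z)) (at x)" and s: "s \<longlonglongrightarrow> (0::real)" "\<And>n. s n \<noteq> 0"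
  shows "(\<lambda>n. (u (x + s n *\<^sub>R z) - u x) / s n) \<longlonglongrightarrow> g \<bullet> z"
proof -
  have "((\<lambda>t. u (x + t *\<^sub>R z)) has_derivative (\<lambda>t. g \<bullet> (t *\<^sub>R z))) (at 0)"
    by (rule has_derivative_compose[of "\<lambda>t. x + t *\<^sub>R z" "\<lambda>t. t *\<^sub>R z" 0 UNIV u "\<lambda>z. g \<bullet> z"])
       (use assms in \<open>auto intro!: derivative_eq_intros\<close>)
  then have "((\<lambda>t. u (x + t *\<^sub>R z)) has_real_derivative (g \<bullet> z)) (at 0)"
    by (simp add: has_field_derivative_def mult_commute_abs)
  then have "((\<lambda>t. (u (x + t *\<^sub>R z) - u x) / t) \<longlongrightarrow> g \<bullet> z) (at 0)"
    by (simp add: has_field_derivative_iff)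
  then show ?thesis
    by (rule filterlim_compose) (use s in \<open>auto simp: filterlim_at\<close>)
qed

definition nl_integrand :: "real \<Rightarrow> (real \<Rightarrow> real) \<Rightarrow> real \<Rightarrow> ('a::euclidean_space \<Rightarrow> real) \<Rightarrow> 'a \<Rightarrow> 'a \<Rightarrow> real" where
  "nl_integrand p \<rho> t u x z = \<rho> (norm z) * \<bar>(u (x + t *\<^sub>R z) - u x) / t\<bar> powr p"

text \<open>In the variables \<open>x\<close> and \<open>z = (y - x) / \<delta>\<close> the nonlocal seminorm of a function vanishing outside
  the domain is an integral over the whole space against the fixed kernel \<open>\<rho>\<close>.\<close>
definition nl_energy :: "real \<Rightarrow> (real \<Rightarrow> real) \<Rightarrow> real \<Rightarrow> ('a::euclidean_space \<Rightarrow> real) \<Rightarrow> ennreal" where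
  "nl_energy p \<rho> t u = (\<integral>\<^sup>+w. ennreal (nl_integrand p \<rho> t u (fst w) (snd w)) \<partial>(lborel \<Otimes>\<^sub>M lborel))"

locale nonlocal_setting =
  fixes p :: real and \<rho> :: "real \<Rightarrow> real" and \<Omega> :: "'a::euclidean_space set"
  assumes p: "2 \<le> p" and kern: "admissible_kernel TYPE('a) p \<rho>"
    and dom: "bounded_domain \<Omega>" and flat: "piecewise_flat_boundary \<Omega>"
begin

lemma kernel_measurable [measurable]: "\<rho> \<in> borel_measurable borel"
  using kern by (simp add: admissible_kernel_def)

lemma kernel_nonneg: "0 \<le> \<rho> t"
  using kern by (simp add: admissible_kernel_def)

lemma kernel_bounded: obtains C where "0 < C" "\<And>t. \<rho> t \<le> C"
proof -
  obtain M where "\<And>t. \<bar>\<rho> t\<bar> \<le> M" using kern unfolding admissible_kernel_def by blast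
  then have "\<rho> t \<le> max M 1" for t using abs_le_D1 le_max_iff_disj by blast
  then show ?thesis using that[of "max M 1"] by simp
qed

lemmas kernel_zero = kernel_vanishes[OF kern]

lemma nl_integrand_nonneg: "0 \<le> nl_integrand p \<rho> t u x z"
  by (simp add: nl_integrand_def kernel_nonneg)

lemma nl_integrand_measurable [measurable]:
  fixes u :: "'a \<Rightarrow> real"
  assumes [measurable]: "u \<in> borel_measurable borel"
  shows "(\<lambda>w. nl_integrand p \<rho> t u (fst w) (snd w)) \<in> borel_measurable (lborel \<Otimes>\<^sub>M lborel)"
  unfolding nl_integrand_def by measurable

lemma nl_energy_fst:
  fixes u :: "'a \<Rightarrow> real"
  assumes [measurable]: "u \<in> borel_measurable borel"
  shows "nl_energy p \<rho> t u = (\<integral>\<^sup>+x. \<integral>\<^sup>+z. ennreal (nl_integrand p \<rho> t u x z) \<partial>lborel \<partial>lborel)"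
  unfolding nl_energy_def by (subst lborel.nn_integral_fst[symmetric]) auto

lemma nl_energy_snd:
  fixes u :: "'a \<Rightarrow> real"
  assumes [measurable]: "u \<in> borel_measurable borel"
  shows "nl_energy p \<rho> t u = (\<integral>\<^sup>+z. \<integral>\<^sup>+x. ennreal (nl_integrand p \<rho> t u x z) \<partial>lborel \<partial>lborel)"
  unfolding nl_energy_def by (subst lborel_pair.nn_integral_snd[symmetric]) auto

text \<open>Telescoping into \<open>k\<close> steps of size \<open>t\<close>, convexity and translation invariance.\<close>
lemma nl_energy_multiple:
  fixes u :: "'a \<Rightarrow> real"
  assumes [measurable]: "u \<in> borel_measurable borel" and t: "0 < t" and k: "0 < k"
  shows "nl_energy p \<rho> (real k * t) u \<le> nl_energy p \<rho> t u"
  unfolding nl_energy_snd[OF assms(1)]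
proof (rule nn_integral_mono)
  fix z :: 'a
  let ?c = "real k powr (p - 1)"
  let ?N = "\<lambda>x. ennreal (nl_integrand p \<rho> t u x z)"
  have pt: "nl_integrand p \<rho> (real k * t) u x z \<le> (\<Sum>j<k. nl_integrand p \<rho> t u (x + (real j * t) *\<^sub>R z) z) / k" for x
  proof -
    define D where "D = (\<lambda>j. (u (x + (real (Suc j) * t) *\<^sub>R z) - u (x + (real j * t) *\<^sub>R z)) / t)"
    have D: "(u (x + (real k * t) *\<^sub>R z) - u x) / (real k * t) = (\<Sum>j<k. D j) / k"
      unfolding D_def sum_divide_distrib[symmetric]
      using sum_lessThan_telescope[of "\<lambda>j. u (x + (real j * t) *\<^sub>R z)" k] by simp
    have "\<bar>(\<Sum>j<k. D j) / k\<bar> powr p \<le> ((\<Sum>j<k. \<bar>D j\<bar>) / k) powr p"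
      using p by (intro powr_mono2) (auto intro!: divide_right_mono sum_abs)
    also have "\<dots> = (\<Sum>j<k. \<bar>D j\<bar>) powr p / k powr p"
      by (rule powr_divide)
    also have "\<dots> \<le> ?c * (\<Sum>j<k. \<bar>D j\<bar> powr p) / k powr p"
      using p k by (intro divide_right_mono sum_powr_le) auto
    also have "\<dots> = (\<Sum>j<k. \<bar>D j\<bar> powr p) / k"
      using k by (simp add: powr_diff)
    finally have "\<rho> (norm z) * \<bar>(\<Sum>j<k. D j) / k\<bar> powr p \<le> \<rho> (norm z) * ((\<Sum>j<k. \<bar>D j\<bar> powr p) / k)"
      by (rule mult_left_mono) (rule kernel_nonneg)
    also have "\<dots> = (\<Sum>j<k. nl_integrand p \<rho> t u (x + (real j * t) *\<^sub>R z) z) / k"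
      by (simp add: nl_integrand_def D_def sum_distrib_left algebra_simps scaleR_add_left)
    finally show ?thesis unfolding nl_integrand_def[of p \<rho> "real k * t"] D .
  qed
  have "(\<integral>\<^sup>+x. ennreal (nl_integrand p \<rho> (real k * t) u x z) \<partial>lborel) \<le>
      (\<integral>\<^sup>+x. ennreal (1 / k) * (\<Sum>j<k. ?N (x + (real j * t) *\<^sub>R z)) \<partial>lborel)"
  proof (rule nn_integral_mono)
    fix x
    have "ennreal (nl_integrand p \<rho> (real k * t) u x z) \<le> ennreal (1 / k * (\<Sum>j<k. nl_integrand p \<rho> t u (x + (real j * t) *\<^sub>R z) z))"
      using pt[of x] by (intro ennreal_leI) simp
    also have "\<dots> = ennreal (1 / k) * (\<Sum>j<k. ?N (x + (real j * t) *\<^sub>R z))"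
      by (subst ennreal_mult') (simp_all add: nl_integrand_nonneg)
    finally show "ennreal (nl_integrand p \<rho> (real k * t) u x z) \<le> ennreal (1 / k) * (\<Sum>j<k. ?N (x + (real j * t) *\<^sub>R z))" .
  qed
  also have "\<dots> = ennreal (1 / k) * (\<Sum>j<k. \<integral>\<^sup>+x. ?N (x + (real j * t) *\<^sub>R z) \<partial>lborel)"
    unfolding nl_integrand_def by (subst nn_integral_cmult, measurable) (subst nn_integral_sum, auto)
  also have "\<dots> = ennreal (1 / k) * (\<Sum>j<k. \<integral>\<^sup>+x. ?N x \<partial>lborel)"
    unfolding nl_integrand_def
    by (intro arg_cong2[where f = "(*)"] sum.cong refl nn_integral_lborel_translate[where f = "\<lambda>x. ennreal (\<rho> (norm z) * \<bar>(u (x + t *\<^sub>R z) - u x) / t\<bar> powr p)"]) measurable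
  also have "\<dots> = (\<integral>\<^sup>+x. ?N x \<partial>lborel)"
    using k by (simp add: mult.assoc[symmetric] ennreal_of_nat_eq_real_of_nat ennreal_mult'[symmetric])
  finally show "(\<integral>\<^sup>+x. ennreal (nl_integrand p \<rho> (real k * t) u x z) \<partial>lborel) \<le> (\<integral>\<^sup>+x. ?N x \<partial>lborel)" .
qed

lemma frontier_null: "frontier \<Omega> \<in> null_sets lborel"
proof -
  obtain H :: "('a \<times> real) set" where H: "finite H" "\<forall>(a,b)\<in>H. a \<noteq> 0"
    "frontier \<Omega> \<subseteq> (\<Union>(a,b)\<in>H. {x. a \<bullet> x = b})"
    using flat by (auto simp: piecewise_flat_boundary_def)
  have "negligible (\<Union>(a,b)\<in>H. {x. a \<bullet> x = b})"
    using H by (intro negligible_Union) (auto intro!: negligible_hyperplane)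
  then have "negligible (frontier \<Omega>)" using H(3) negligible_subset by blast
  then show ?thesis by (simp add: negligible_iff_null_sets null_sets_completion_iff)
qed

lemma open_dom: "open \<Omega>" and bounded_dom: "bounded \<Omega>"
  using dom by (auto simp: bounded_domain_def)

text \<open>A segment leaving the domain meets its frontier, so its endpoint is closer to the
  frontier than the length of the segment.\<close>

lemma near_domain_in_extension:
  assumes "x \<in> \<Omega>" "norm (x - y) < \<delta>"
  shows "y \<in> extended_domain \<Omega> \<delta>"
proof (cases "y \<in> \<Omega>")
  case False
  have "closed_segment x y \<inter> frontier \<Omega> \<noteq> {}"
    by (rule connected_Int_frontier) (use assms(1) False in auto)
  then obtain c where c: "c \<in> closed_segment x y" "c \<in> frontier \<Omega>" by auto
  have "infdist y (frontier \<Omega>) \<le> dist y c" by (rule infdist_le[OF c(2)])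
  also have "\<dots> \<le> norm (x - y)"
    using segment_bound(2)[OF c(1)] by (simp add: dist_norm norm_minus_commute)
  finally show ?thesis using assms False by (simp add: extended_domain_def interaction_layer_def)
qed (simp add: extended_domain_def)

lemma nl_seminorm_p_eq_energy:
  fixes u :: "'a \<Rightarrow> real"
  assumes [measurable]: "u \<in> borel_measurable borel" and u0: "\<And>x. x \<notin> \<Omega> \<Longrightarrow> u x = 0" and d: "0 < \<delta>"
  shows "nl_seminorm_p p \<rho> \<Omega> \<delta> u = nl_energy p \<rho> \<delta> u"
proof -
  let ?E = "extended_domain \<Omega> \<delta>"
  let ?K = "\<lambda>x y. rho_delta TYPE('a) \<rho> \<delta> (norm (x - y)) * \<bar>(u x - u y) / \<delta>\<bar> powr p"
  have zero: "?K x y = 0" if "x \<notin> ?E \<or> y \<notin> ?E" for x y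
  proof (cases "norm (x - y) < \<delta>")
    case True
    then have "x \<notin> \<Omega> \<and> y \<notin> \<Omega>"
      using that near_domain_in_extension[of x y \<delta>] near_domain_in_extension[of y x \<delta>]
      by (auto simp: norm_minus_commute extended_domain_def)
    then show ?thesis using u0 by simp
  next
    case False
    then show ?thesis using d kernel_zero[of "norm (x - y) / \<delta>"] by (simp add: rho_delta_def)
  qed
  have "nl_seminorm_p p \<rho> \<Omega> \<delta> u = (\<integral>\<^sup>+x. \<integral>\<^sup>+y. ennreal (?K x y) \<partial>lborel \<partial>lborel)"
    unfolding nl_seminorm_p_def nn_integral_completion
  proof (rule nn_integral_cong)
    fix x
    have "(\<integral>\<^sup>+y\<in>?E. ennreal (?K x y) \<partial>lborel) * indicator ?E x = (\<integral>\<^sup>+y. ennreal (?K x y) \<partial>lborel)"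
    proof (cases "x \<in> ?E")
      case True
      have "ennreal (?K x y) * indicator ?E y = ennreal (?K x y)" for y
      proof (cases "y \<in> ?E")
        case False
        then have "?K x y = 0" by (intro zero) simp
        then show ?thesis by (simp only: ennreal_0 mult_zero_left)
      qed simp
      then show ?thesis using True by simp
    next
      case False
      then have "?K x y = 0" for y by (intro zero) simp
      then have "(\<integral>\<^sup>+y. ennreal (?K x y) \<partial>lborel) = (\<integral>\<^sup>+(y::'a). 0 \<partial>lborel)"
        by (simp only: ennreal_0)
      then show ?thesis using False by simp
    qed
    then show "(\<integral>\<^sup>+y\<in>?E. ennreal (?K x y) \<partial>lborel) * indicator ?E x = (\<integral>\<^sup>+y. ennreal (?K x y) \<partial>lborel)" .
  qed
  also have "\<dots> = nl_energy p \<rho> \<delta> u"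
    unfolding nl_energy_fst[OF assms(1)]
  proof (rule nn_integral_cong)
    fix x
    have "(\<integral>\<^sup>+y. ennreal (?K x y) \<partial>lborel) = ennreal (\<bar>\<delta>\<bar> ^ DIM('a)) * (\<integral>\<^sup>+z. ennreal (?K x (x + \<delta> *\<^sub>R z)) \<partial>lborel)"
      unfolding rho_delta_def by (rule nn_integral_lborel_affine, measurable) (use d in auto)
    also have "\<dots> = (\<integral>\<^sup>+z. ennreal (\<bar>\<delta>\<bar> ^ DIM('a)) * ennreal (?K x (x + \<delta> *\<^sub>R z)) \<partial>lborel)"
      unfolding rho_delta_def by (rule nn_integral_cmult[symmetric]) measurable
    also have "\<dots> = (\<integral>\<^sup>+z. ennreal (nl_integrand p \<rho> \<delta> u x z) \<partial>lborel)"
    proof (rule nn_integral_cong)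
      fix z
      have "\<bar>(u x - u (x + \<delta> *\<^sub>R z)) / \<delta>\<bar> = \<bar>(u (x + \<delta> *\<^sub>R z) - u x) / \<delta>\<bar>"
        by (simp add: abs_minus_commute)
      then show "ennreal (\<bar>\<delta>\<bar> ^ DIM('a)) * ennreal (?K x (x + \<delta> *\<^sub>R z)) = ennreal (nl_integrand p \<rho> \<delta> u x z)"
        using d by (simp add: ennreal_mult'[symmetric] rho_delta_def nl_integrand_def)
    qed
    finally show "(\<integral>\<^sup>+y. ennreal (?K x y) \<partial>lborel) = (\<integral>\<^sup>+z. ennreal (nl_integrand p \<rho> \<delta> u x z) \<partial>lborel)" .
  qed
  finally show ?thesis .
qed

lemma nl_seminorm_p_cong_AE:
  fixes u v :: "'a \<Rightarrow> real"
  assumes "AE x in lebesgue. u x = v x"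
  shows "nl_seminorm_p p \<rho> \<Omega> \<delta> u = nl_seminorm_p p \<rho> \<Omega> \<delta> v"
  unfolding nl_seminorm_p_def
proof (rule nn_integral_cong_AE)
  let ?K = "\<lambda>u x. \<integral>\<^sup>+y\<in>extended_domain \<Omega> \<delta>. ennreal (rho_delta TYPE('a) \<rho> \<delta> (norm (x - y)) * \<bar>(u x - u y) / \<delta>\<bar> powr p) \<partial>lebesgue"
  show "AE x in lebesgue. ?K u x * indicator (extended_domain \<Omega> \<delta>) x = ?K v x * indicator (extended_domain \<Omega> \<delta>) x"
    using assms
  proof eventually_elim
    case (elim x)
    have "?K u x = ?K v x"
      by (rule nn_integral_cong_AE) (use assms in eventually_elim, simp add: elim)
    then show ?case by simp
  qed
qed

lemma nl_energy_finite:
  fixes u :: "'a \<Rightarrow> real"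
  assumes [measurable]: "u \<in> borel_measurable borel" and u0: "\<And>x. x \<notin> \<Omega> \<Longrightarrow> u x = 0"
    and bd: "\<And>x. \<bar>u x\<bar> \<le> K" and t: "0 < t"
  shows "nl_energy p \<rho> t u < \<infinity>"
proof -
  obtain C where C: "0 < C" "\<And>t. \<rho> t \<le> C" using kernel_bounded by blast
  obtain r where r: "0 < r" "\<Omega> \<subseteq> ball 0 r" using bounded_dom bounded_subset_ballD by blast
  let ?A = "ball (0::'a) (r + t)" and ?B = "ball (0::'a) 1"
  let ?c = "C * (2 * K / t) powr p"
  have K: "0 \<le> K" using bd[of 0] by simp
  \<comment> \<open>For |z| < 1 and |x| \<ge> r + t neither x nor x + t z can lie in the domain, and
    for larger z the kernel vanishes; only a bounded set of pairs remains. The same estimate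
    provides dominating functions later.\<close>
  have bound: "nl_integrand p \<rho> t u x z \<le> ?c * indicator ?A x * indicator ?B z" for x z
  proof (cases "norm z < 1 \<and> x \<in> ?A")
    case True
    have "\<bar>(u (x + t *\<^sub>R z) - u x) / t\<bar> \<le> 2 * K / t"
      using bd[of x] bd[of "x + t *\<^sub>R z"] t by (auto intro!: divide_right_mono simp: abs_divide)
    then have "nl_integrand p \<rho> t u x z \<le> ?c"
      unfolding nl_integrand_def using p C kernel_nonneg by (intro mult_mono powr_mono2) auto
    then show ?thesis using True by simp
  next
    case False
    have "nl_integrand p \<rho> t u x z = 0"
    proof (cases "norm z < 1")
      case True
      then have x: "r + t \<le> norm x" using False by simp
      have "norm x \<le> norm (x + t *\<^sub>R z) + norm (t *\<^sub>R z)"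
        using norm_triangle_ineq4[of "x + t *\<^sub>R z" "t *\<^sub>R z"] by simp
      moreover have "norm (t *\<^sub>R z) \<le> t" using True t by simp
      ultimately have "r \<le> norm x" "r \<le> norm (x + t *\<^sub>R z)" using x t by linarith+
      then have "x \<notin> \<Omega>" "x + t *\<^sub>R z \<notin> \<Omega>" by (auto dest!: subsetD[OF r(2)])
      then show ?thesis by (simp add: nl_integrand_def u0)
    qed (simp add: nl_integrand_def kernel_zero)
    then show ?thesis using C by simp
  qed
  have "nl_energy p \<rho> t u \<le> (\<integral>\<^sup>+w. ennreal ?c * indicator (?A \<times> ?B) w \<partial>(lborel \<Otimes>\<^sub>M lborel))"
    unfolding nl_energy_def
  proof (rule nn_integral_mono)
    fix w :: "'a \<times> 'a"
    show "ennreal (nl_integrand p \<rho> t u (fst w) (snd w)) \<le> ennreal ?c * indicator (?A \<times> ?B) w"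
      using ennreal_leI[OF bound[of "fst w" "snd w"]]
      by (cases w) (auto simp: indicator_def split: if_splits)
  qed
  also have "\<dots> = ennreal ?c * (emeasure lborel ?A * emeasure lborel ?B)"
    by (subst nn_integral_cmult_indicator) (auto simp: lborel.emeasure_pair_measure_Times)
  also have "\<dots> < \<infinity>"
    using emeasure_lborel_ball_finite[of "0::'a"] by (simp add: ennreal_mult_less_top)
  finally show ?thesis .
qed

text \<open>Fatou's lemma with the step and the function varying together. Convergence is demanded
  along the moving points x + s n z, and a nonzero limit step keeps the quotient continuous.\<close>

lemma nl_energy_liminf:
  fixes u :: "'a \<Rightarrow> real" and v :: "nat \<Rightarrow> 'a \<Rightarrow> real"
  assumes [measurable]: "u \<in> borel_measurable borel" "\<And>n. v n \<in> borel_measurable borel"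
    and Z: "Z \<in> null_sets lborel" and t: "s \<longlonglongrightarrow> t" "t \<noteq> 0"
    and conv: "\<And>x. x \<notin> Z \<Longrightarrow> (\<lambda>n. v n x) \<longlonglongrightarrow> u x"
      "\<And>x z. x + t *\<^sub>R z \<notin> Z \<Longrightarrow> (\<lambda>n. v n (x + s n *\<^sub>R z)) \<longlonglongrightarrow> u (x + t *\<^sub>R z)"
  shows "nl_energy p \<rho> t u \<le> liminf (\<lambda>n. nl_energy p \<rho> (s n) (v n))"
proof -
  have "nl_energy p \<rho> t u = (\<integral>\<^sup>+w. liminf (\<lambda>n. ennreal (nl_integrand p \<rho> (s n) (v n) (fst w) (snd w))) \<partial>(lborel \<Otimes>\<^sub>M lborel))"
    unfolding nl_energy_def
  proof (rule nn_integral_cong_AE)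
    show "AE w in lborel \<Otimes>\<^sub>M lborel. ennreal (nl_integrand p \<rho> t u (fst w) (snd w)) =
        liminf (\<lambda>n. ennreal (nl_integrand p \<rho> (s n) (v n) (fst w) (snd w)))"
      using AE_lborel_pair_notin[OF Z, of t] AE_lborel_pair_fst[OF Z]
    proof eventually_elim
      case (elim w)
      have "(\<lambda>n. nl_integrand p \<rho> (s n) (v n) (fst w) (snd w)) \<longlonglongrightarrow> nl_integrand p \<rho> t u (fst w) (snd w)"
        unfolding nl_integrand_def using p t
        by (intro tendsto_intros conv elim tendsto_powr2) auto
      then show ?case
        by (intro lim_imp_Liminf[symmetric]) (auto intro!: tendsto_ennrealI)
    qed
  qed
  also have "\<dots> \<le> liminf (\<lambda>n. nl_energy p \<rho> (s n) (v n))"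
    unfolding nl_energy_def by (rule nn_integral_liminf) measurable
  finally show ?thesis .
qed

text \<open>Fatou's lemma as the step tends to 0; the directional moment of the kernel converts the
  limit integrand into the norm of the gradient.\<close>

lemma gradient_le_liminf_energy:
  fixes u :: "'a \<Rightarrow> real" and g :: "'a \<Rightarrow> 'a"
  assumes [measurable]: "u \<in> borel_measurable borel" "g \<in> borel_measurable borel"
    and Z: "Z \<in> null_sets lborel" and s: "s \<longlonglongrightarrow> 0" "\<And>n. s n \<noteq> 0"
    and der: "\<And>x. x \<notin> Z \<Longrightarrow> (u has_derivative (\<lambda>z. g x \<bullet> z)) (at x)"
  shows "(\<integral>\<^sup>+x. ennreal (norm (g x) powr p) \<partial>lborel) \<le> liminf (\<lambda>n. nl_energy p \<rho> (s n) u)"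
proof -
  have "(\<integral>\<^sup>+x. ennreal (norm (g x) powr p) \<partial>lborel) =
      (\<integral>\<^sup>+x. \<integral>\<^sup>+z. ennreal (\<rho> (norm z) * \<bar>g x \<bullet> z\<bar> powr p) \<partial>lborel \<partial>lborel)"
    using p by (intro nn_integral_cong) (subst kernel_directional_moment[OF kern], auto)
  also have "\<dots> = (\<integral>\<^sup>+w. ennreal (\<rho> (norm (snd w)) * \<bar>g (fst w) \<bullet> snd w\<bar> powr p) \<partial>(lborel \<Otimes>\<^sub>M lborel))"
    by (subst lborel.nn_integral_fst[symmetric]) auto
  also have "\<dots> = (\<integral>\<^sup>+w. liminf (\<lambda>n. ennreal (nl_integrand p \<rho> (s n) u (fst w) (snd w))) \<partial>(lborel \<Otimes>\<^sub>M lborel))"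
  proof (rule nn_integral_cong_AE)
    show "AE w in lborel \<Otimes>\<^sub>M lborel. ennreal (\<rho> (norm (snd w)) * \<bar>g (fst w) \<bullet> snd w\<bar> powr p) =
        liminf (\<lambda>n. ennreal (nl_integrand p \<rho> (s n) u (fst w) (snd w)))"
      using AE_lborel_pair_fst[OF Z]
    proof eventually_elim
      case (elim w)
      have "(\<lambda>n. nl_integrand p \<rho> (s n) u (fst w) (snd w)) \<longlonglongrightarrow> \<rho> (norm (snd w)) * \<bar>g (fst w) \<bullet> snd w\<bar> powr p"
        unfolding nl_integrand_def using p
        by (intro tendsto_intros directional_quotient_tendsto der elim s tendsto_powr2) auto
      then show ?case
        by (intro lim_imp_Liminf[symmetric]) (auto intro!: tendsto_ennrealI)
    qed
  qed
  also have "\<dots> \<le> liminf (\<lambda>n. nl_energy p \<rho> (s n) u)"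
    unfolding nl_energy_def by (rule nn_integral_liminf) measurable
  finally show ?thesis .
qed

end

section \<open>Test functions and the Sobolev space\<close>

lemma smooth_fun_derivative:
  assumes "smooth_fun f"
  shows "(f has_derivative (\<lambda>z. cgrad f x \<bullet> z)) (at x)"
proof -
  have d: "(f has_derivative frechet_derivative f (at x)) (at x)"
    using assms by (auto elim: smooth_fun.cases simp: frechet_derivative_works[symmetric])
  then interpret bounded_linear "frechet_derivative f (at x)" by (rule has_derivative_bounded_linear)
  have "frechet_derivative f (at x) z = cgrad f x \<bullet> z" for z
  proof -
    have "frechet_derivative f (at x) z = frechet_derivative f (at x) (\<Sum>i\<in>Basis. (z \<bullet> i) *\<^sub>R i)"
      by (simp add: euclidean_representation)
    also have "\<dots> = (\<Sum>i\<in>Basis. (z \<bullet> i) * frechet_derivative f (at x) i)"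
      by (simp add: sum scale)
    finally show ?thesis by (simp add: cgrad_def inner_sum_left inner_commute[of z] mult.commute)
  qed
  then show ?thesis using d by (metis ext)
qed

lemma smooth_fun_continuous: "smooth_fun f \<Longrightarrow> continuous_on A f"
  by (meson continuous_at_imp_continuous_on has_derivative_continuous smooth_fun_derivative)

lemma smooth_fun_partial: "smooth_fun f \<Longrightarrow> i \<in> Basis \<Longrightarrow> smooth_fun (\<lambda>x. frechet_derivative f (at x) i)"
  by (auto elim: smooth_fun.cases)

lemma cgrad_continuous: "smooth_fun f \<Longrightarrow> continuous_on A (cgrad f)"
  unfolding cgrad_def by (intro continuous_intros smooth_fun_continuous smooth_fun_partial)

lemma cgrad_inner:
  assumes "i \<in> Basis" shows "cgrad f x \<bullet> i = frechet_derivative f (at x) i"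
  using assms by (simp add: cgrad_def inner_sum_left inner_Basis if_distrib sum.If_cases cong: if_cong)

lemma has_derivative_cgrad_unique:
  assumes "(f has_derivative (\<lambda>z. g \<bullet> z)) (at x)"
  shows "cgrad f x = g"
proof -
  have "frechet_derivative f (at x) = (\<lambda>z. g \<bullet> z)"
    using frechet_derivative_at[OF assms] by simp
  then have "cgrad f x \<bullet> i = g \<bullet> i" if "i \<in> Basis" for i
    using that by (simp add: cgrad_inner)
  then show ?thesis by (rule euclidean_eqI)
qed

lemma test_fun_zero:
  assumes "test_fun \<Omega> \<phi>" "x \<notin> \<Omega>" shows "\<phi> x = 0"
  using assms closure_subset[of "{x. \<phi> x \<noteq> 0}"] by (auto simp: test_fun_def)

lemma test_fun_cgrad_zero:
  assumes "test_fun \<Omega> \<phi>" "x \<notin> closure {x. \<phi> x \<noteq> 0}" shows "cgrad \<phi> x = 0"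
proof (rule has_derivative_cgrad_unique)
  have "((\<lambda>x. 0) has_derivative (\<lambda>z. 0 \<bullet> z)) (at x)" by simp
  then show "(\<phi> has_derivative (\<lambda>z. 0 \<bullet> z)) (at x)"
  proof (rule has_derivative_transform_within_open)
    show "open (- closure {x. \<phi> x \<noteq> 0})" by auto
    show "x \<in> - closure {x. \<phi> x \<noteq> 0}" using assms by simp
    show "0 = \<phi> y" if "y \<in> - closure {x. \<phi> x \<noteq> 0}" for y
      using that closure_subset[of "{x. \<phi> x \<noteq> 0}"] by auto
  qed
qed

lemma test_fun_bounded:
  assumes t: "test_fun \<Omega> \<phi>"
  shows "\<exists>L\<ge>0. (\<forall>x. \<bar>\<phi> x\<bar> \<le> L) \<and> (\<forall>x. norm (cgrad \<phi> x) \<le> L) \<and> (\<forall>x y. \<bar>\<phi> x - \<phi> y\<bar> \<le> L * norm (x - y))"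
proof -
  let ?K = "closure {x. \<phi> x \<noteq> 0}"
  have K: "compact ?K" and s: "smooth_fun \<phi>" using t by (auto simp: test_fun_def)
  have "bounded (\<phi> ` ?K)" "bounded (cgrad \<phi> ` ?K)"
    using K s by (auto intro!: compact_imp_bounded compact_continuous_image cgrad_continuous smooth_fun_continuous)
  then obtain A B where A: "\<And>x. x \<in> ?K \<Longrightarrow> norm (\<phi> x) \<le> A" and B: "\<And>x. x \<in> ?K \<Longrightarrow> norm (cgrad \<phi> x) \<le> B"
    by (force simp: bounded_iff)
  define L where "L = max 0 (max A B)"
  have L: "\<bar>\<phi> x\<bar> \<le> L" "norm (cgrad \<phi> x) \<le> L" for x
    using A[of x] B[of x] test_fun_cgrad_zero[OF t, of x] closure_subset[of "{x. \<phi> x \<noteq> 0}"]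
    by (cases "x \<in> ?K"; force simp: L_def)+
  have "norm (\<phi> x - \<phi> y) \<le> L * norm (x - y)" for x y
  proof (rule differentiable_bound[of UNIV \<phi> "\<lambda>x z. cgrad \<phi> x \<bullet> z"])
    show "onorm (\<lambda>z. cgrad \<phi> x \<bullet> z) \<le> L" for x
    proof (rule onorm_le)
      fix z
      have "norm (cgrad \<phi> x \<bullet> z) \<le> norm (cgrad \<phi> x) * norm z" by (simp add: Cauchy_Schwarz_ineq2)
      also have "\<dots> \<le> L * norm z" using L by (intro mult_right_mono) auto
      finally show "norm (cgrad \<phi> x \<bullet> z) \<le> L * norm z" .
    qed
  qed (auto intro: smooth_fun_derivative[OF s])
  then show ?thesis using L by (intro exI[of _ L]) (simp add: L_def)
qed

lemma test_fun_measurable: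
  assumes "test_fun \<Omega> \<phi>"
  shows "\<phi> \<in> borel_measurable borel" "cgrad \<phi> \<in> borel_measurable borel"
  using assms by (auto simp: test_fun_def intro!: borel_measurable_continuous_onI smooth_fun_continuous cgrad_continuous)

text \<open>\<open>Lp_norm\<close> is defined through \<open>enn2real\<close>, which sends infinity
  to 0, so finiteness has to be supplied before returning to the extended integral.\<close>

lemma Lp_norm_tendsto_0D:
  assumes q: "0 < q" and lim: "(\<lambda>n. Lp_norm q A (v n)) \<longlonglongrightarrow> 0"
    and fin: "\<And>n. (\<integral>\<^sup>+x\<in>A. ennreal (norm (v n x) powr q) \<partial>lebesgue) < \<infinity>"
  shows "(\<lambda>n. \<integral>\<^sup>+x\<in>A. ennreal (norm (v n x) powr q) \<partial>lebesgue) \<longlonglongrightarrow> 0"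
proof -
  let ?a = "\<lambda>n. \<integral>\<^sup>+x\<in>A. ennreal (norm (v n x) powr q) \<partial>lebesgue"
  have "(\<lambda>n. Lp_norm q A (v n) powr q) \<longlonglongrightarrow> 0 powr q"
    using lim q by (intro tendsto_powr2) (auto simp: Lp_norm_def)
  then have "(\<lambda>n. enn2real (?a n)) \<longlonglongrightarrow> 0"
    using q by (simp add: Lp_norm_def powr_powr)
  then have "(\<lambda>n. ennreal (enn2real (?a n))) \<longlonglongrightarrow> ennreal 0"
    by (rule tendsto_ennrealI)
  then show ?thesis using fin by (simp add: ennreal_enn2real)
qed

section \<open>The gradient integral as an upper bound for the nonlocal energy\<close>

context nonlocal_setting
begin

text \<open>The Lipschitz bound dominates the difference quotients, so the energies at the scales
  \<open>\<delta>\<close> / (n+1) converge to the gradient integral, and each of them bounds the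
  energy at \<open>\<delta>\<close> from above.\<close>

lemma nl_energy_le_gradient:
  fixes u :: "'a \<Rightarrow> real" and g :: "'a \<Rightarrow> 'a"
  assumes [measurable]: "u \<in> borel_measurable borel" "g \<in> borel_measurable borel"
    and u0: "\<And>x. x \<notin> \<Omega> \<Longrightarrow> u x = 0" and lip: "\<And>x y. \<bar>u x - u y\<bar> \<le> L * norm (x - y)"
    and Z: "Z \<in> null_sets lborel" and d: "0 < \<delta>"
    and der: "\<And>x. x \<notin> Z \<Longrightarrow> (u has_derivative (\<lambda>z. g x \<bullet> z)) (at x)"
  shows "nl_energy p \<rho> \<delta> u \<le> (\<integral>\<^sup>+x. ennreal (norm (g x) powr p) \<partial>lborel)"
proof -
  define s where "s = (\<lambda>n. \<delta> / real (Suc n))"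
  have s: "0 < s n" "s n \<le> \<delta>" for n using d by (auto simp: s_def field_simps)
  have s0: "s \<longlonglongrightarrow> 0" unfolding s_def by (rule LIMSEQ_Suc[OF lim_const_over_n])
  obtain C where C: "0 < C" "\<And>t. \<rho> t \<le> C" using kernel_bounded by blast
  obtain r where r: "0 < r" "\<Omega> \<subseteq> ball 0 r" using bounded_dom bounded_subset_ballD by blast
  let ?A = "ball (0::'a) (r + \<delta>)" and ?B = "ball (0::'a) 1"
  obtain b :: 'a where b: "norm b = 1" by (metis norm_Basis SOME_Basis)
  have L: "0 \<le> L" using order_trans[OF abs_ge_zero lip[of b 0]] b by simp
  have bound: "nl_integrand p \<rho> (s n) u x z \<le> C * L powr p * indicator ?A x * indicator ?B z" for n x z
  proof (cases "norm z < 1 \<and> x \<in> ?A")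
    case True
    have "\<bar>(u (x + s n *\<^sub>R z) - u x) / s n\<bar> \<le> L * norm (s n *\<^sub>R z) / s n"
      using lip[of "x + s n *\<^sub>R z" x] s[of n] by (simp add: abs_divide pos_divide_le_eq mult_ac)
    also have "\<dots> \<le> L" using True s[of n] L by (simp add: mult_left_le)
    finally have "nl_integrand p \<rho> (s n) u x z \<le> C * L powr p"
      unfolding nl_integrand_def using p C kernel_nonneg by (intro mult_mono powr_mono2) auto
    then show ?thesis using True by simp
  next
    case False
    have "nl_integrand p \<rho> (s n) u x z = 0"
    proof (cases "norm z < 1")
      case True
      then have x: "r + \<delta> \<le> norm x" using False by simp
      have "norm x \<le> norm (x + s n *\<^sub>R z) + norm (s n *\<^sub>R z)"
        using norm_triangle_ineq4[of "x + s n *\<^sub>R z" "s n *\<^sub>R z"] by simp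
      moreover have "norm (s n *\<^sub>R z) \<le> s n" using True s[of n] by simp
      ultimately have "r \<le> norm x" "r \<le> norm (x + s n *\<^sub>R z)" using x s[of n] d by linarith+
      then have "x \<notin> \<Omega>" "x + s n *\<^sub>R z \<notin> \<Omega>" by (auto dest!: subsetD[OF r(2)])
      then show ?thesis by (simp add: nl_integrand_def u0)
    qed (simp add: nl_integrand_def kernel_zero)
    then show ?thesis using C by simp
  qed
  have "(\<lambda>n. nl_energy p \<rho> (s n) u) \<longlonglongrightarrow>
      (\<integral>\<^sup>+w. ennreal (\<rho> (norm (snd w)) * \<bar>g (fst w) \<bullet> snd w\<bar> powr p) \<partial>(lborel \<Otimes>\<^sub>M lborel))"
    unfolding nl_energy_def
  proof (rule nn_integral_dominated_convergence[where w = "\<lambda>w. ennreal (C * L powr p) * indicator (?A \<times> ?B) w"])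
    show "AE w in lborel \<Otimes>\<^sub>M lborel. (\<lambda>n. ennreal (nl_integrand p \<rho> (s n) u (fst w) (snd w))) \<longlonglongrightarrow>
        ennreal (\<rho> (norm (snd w)) * \<bar>g (fst w) \<bullet> snd w\<bar> powr p)"
      using AE_lborel_pair_fst[OF Z]
    proof eventually_elim
      case (elim w)
      show ?case
        unfolding nl_integrand_def using p s(1)
        by (intro tendsto_intros directional_quotient_tendsto der elim s0 tendsto_powr2) (auto simp: less_imp_neq[THEN not_sym])
    qed
    show "AE w in lborel \<Otimes>\<^sub>M lborel. ennreal (nl_integrand p \<rho> (s n) u (fst w) (snd w)) \<le> ennreal (C * L powr p) * indicator (?A \<times> ?B) w" for n
    proof (rule AE_I2)
      fix w :: "'a \<times> 'a"
      show "ennreal (nl_integrand p \<rho> (s n) u (fst w) (snd w)) \<le> ennreal (C * L powr p) * indicator (?A \<times> ?B) w"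
        using ennreal_leI[OF bound[of n "fst w" "snd w"]]
        by (cases w) (auto simp: indicator_def split: if_splits)
    qed
    have "(\<integral>\<^sup>+w. ennreal (C * L powr p) * indicator (?A \<times> ?B) w \<partial>(lborel \<Otimes>\<^sub>M lborel)) =
        ennreal (C * L powr p) * (emeasure lborel ?A * emeasure lborel ?B)"
      by (subst nn_integral_cmult_indicator) (auto simp: lborel.emeasure_pair_measure_Times)
    also have "\<dots> < \<infinity>"
      using emeasure_lborel_ball_finite[of "0::'a"] by (simp add: ennreal_mult_less_top)
    finally show "(\<integral>\<^sup>+w. ennreal (C * L powr p) * indicator (?A \<times> ?B) w \<partial>(lborel \<Otimes>\<^sub>M lborel)) < \<infinity>" .
  qed auto
  also have "(\<integral>\<^sup>+w. ennreal (\<rho> (norm (snd w)) * \<bar>g (fst w) \<bullet> snd w\<bar> powr p) \<partial>(lborel \<Otimes>\<^sub>M lborel)) =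
      (\<integral>\<^sup>+x. \<integral>\<^sup>+z. ennreal (\<rho> (norm z) * \<bar>g x \<bullet> z\<bar> powr p) \<partial>lborel \<partial>lborel)"
    by (subst lborel.nn_integral_fst[symmetric]) auto
  also have "\<dots> = (\<integral>\<^sup>+x. ennreal (norm (g x) powr p) \<partial>lborel)"
    using p by (intro nn_integral_cong) (subst kernel_directional_moment[OF kern], auto)
  finally show ?thesis
  proof (rule LIMSEQ_le_const)
    have "nl_energy p \<rho> \<delta> u \<le> nl_energy p \<rho> (s n) u" for n
      using nl_energy_multiple[OF assms(1) s(1)[of n], of "Suc n"] by (simp add: s_def)
    then show "\<exists>N. \<forall>n\<ge>N. nl_energy p \<rho> \<delta> u \<le> nl_energy p \<rho> (s n) u" by blast
  qed
qed

lemma test_fun_energy_le: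
  assumes t: "test_fun \<Omega> \<phi>" and d: "0 < \<delta>"
  shows "nl_energy p \<rho> \<delta> \<phi> \<le> (\<integral>\<^sup>+x\<in>\<Omega>. ennreal (norm (cgrad \<phi> x) powr p) \<partial>lebesgue)"
proof -
  obtain L where L: "\<And>x y. \<bar>\<phi> x - \<phi> y\<bar> \<le> L * norm (x - y)" using test_fun_bounded[OF t] by blast
  have "nl_energy p \<rho> \<delta> \<phi> \<le> (\<integral>\<^sup>+x. ennreal (norm (cgrad \<phi> x) powr p) \<partial>lborel)"
    by (rule nl_energy_le_gradient[where Z = "{}" and L = L])
       (use t d L test_fun_measurable[OF t] test_fun_zero[OF t] in \<open>simp_all add: test_fun_def smooth_fun_derivative\<close>)
  also have "\<dots> = (\<integral>\<^sup>+x\<in>\<Omega>. ennreal (norm (cgrad \<phi> x) powr p) \<partial>lebesgue)"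
    unfolding nn_integral_completion
  proof (rule nn_integral_cong)
    fix x
    show "ennreal (norm (cgrad \<phi> x) powr p) = ennreal (norm (cgrad \<phi> x) powr p) * indicator \<Omega> x"
      using test_fun_cgrad_zero[OF t, of x] t p by (cases "x \<in> \<Omega>") (auto simp: test_fun_def)
  qed
  finally show ?thesis .
qed

lemma Lp_bounded_diff_finite:
  fixes v :: "'a \<Rightarrow> 'b::{real_normed_vector,second_countable_topology}" and w :: "'a \<Rightarrow> 'b"
  assumes v: "Lp_space p \<Omega> v" and w: "\<And>x. norm (w x) \<le> K"
  shows "(\<integral>\<^sup>+x\<in>\<Omega>. ennreal (norm (w x - v x) powr p) \<partial>lebesgue) < \<infinity>"
proof -
  have [measurable]: "\<Omega> \<in> sets lebesgue" using open_dom by auto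
  have vm [measurable]: "(\<lambda>x. indicator \<Omega> x *\<^sub>R v x) \<in> borel_measurable lebesgue" using v by (simp add: Lp_space_def)
  let ?c = "(1/2) powr (1 - p)"
  have "(\<integral>\<^sup>+x\<in>\<Omega>. ennreal (norm (w x - v x) powr p) \<partial>lebesgue) \<le>
    (\<integral>\<^sup>+x. ennreal (?c * K powr p) * indicator \<Omega> x + ennreal ?c * (ennreal (norm (indicator \<Omega> x *\<^sub>R v x) powr p) * indicator \<Omega> x) \<partial>lebesgue)"
  proof (rule nn_integral_mono)
    fix x
    have "norm (w x - v x) powr p \<le> ?c * norm (w x) powr p + ?c * norm (v x) powr p"
      using powr_add_le_weighted[of p "1/2" "w x" "- v x"] p by simp
    also have "\<dots> \<le> ?c * K powr p + ?c * norm (v x) powr p"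
      using p w[of x] by (intro add_right_mono mult_left_mono powr_mono2) auto
    finally show "ennreal (norm (w x - v x) powr p) * indicator \<Omega> x \<le>
       ennreal (?c * K powr p) * indicator \<Omega> x + ennreal ?c * (ennreal (norm (indicator \<Omega> x *\<^sub>R v x) powr p) * indicator \<Omega> x)"
      by (cases "x \<in> \<Omega>") (auto simp: ennreal_mult'[symmetric] ennreal_plus[symmetric] simp del: ennreal_plus intro!: ennreal_leI)
  qed
  also have "\<dots> = ennreal (?c * K powr p) * emeasure lebesgue \<Omega> +
      ennreal ?c * (\<integral>\<^sup>+x. ennreal (norm (indicator \<Omega> x *\<^sub>R v x) powr p) * indicator \<Omega> x \<partial>lebesgue)"
  proof -
    have m: "(\<lambda>x. ennreal (norm (indicator \<Omega> x *\<^sub>R v x) powr p) * indicator \<Omega> x) \<in> borel_measurable lebesgue"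
      using vm by measurable
    have m1: "(\<lambda>x. ennreal (?c * K powr p) * indicator \<Omega> x) \<in> borel_measurable lebesgue"
      by (intro borel_measurable_times_ennreal borel_measurable_const borel_measurable_indicator) simp
    have m2: "(\<lambda>x. ennreal ?c * (ennreal (norm (indicator \<Omega> x *\<^sub>R v x) powr p) * indicator \<Omega> x)) \<in> borel_measurable lebesgue"
      by (intro borel_measurable_times_ennreal[OF borel_measurable_const m])
    show ?thesis
      unfolding nn_integral_add[OF m1 m2] nn_integral_cmult[OF m] by (simp add: nn_integral_cmult_indicator)
  qed
  also have "(\<integral>\<^sup>+x. ennreal (norm (indicator \<Omega> x *\<^sub>R v x) powr p) * indicator \<Omega> x \<partial>lebesgue) =
      (\<integral>\<^sup>+x\<in>\<Omega>. ennreal (norm (v x) powr p) \<partial>lebesgue)"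
    by (intro nn_integral_cong) (auto simp: indicator_def)
  also have "ennreal (?c * K powr p) * emeasure lebesgue \<Omega> + ennreal ?c * (\<integral>\<^sup>+x\<in>\<Omega>. ennreal (norm (v x) powr p) \<partial>lebesgue) < \<infinity>"
  proof -
    have "emeasure lebesgue \<Omega> < \<infinity>"
      using emeasure_bounded_finite[OF bounded_dom] open_dom by simp
    then show ?thesis using v by (auto simp: Lp_space_def ennreal_mult_less_top)
  qed
  finally show ?thesis .
qed

text \<open>On the left, a subsequence of the test functions converges almost everywhere and Fatou's
  lemma applies. On the right, the gradient of a test function is split as g plus an error tending
  to 0 in the p-th mean, with a factor of g arbitrarily close to one.\<close>

lemma W1p0_energy_le:
  fixes v :: "'a \<Rightarrow> real"
  assumes [measurable]: "v \<in> borel_measurable borel" and v0: "\<And>x. x \<notin> \<Omega> \<Longrightarrow> v x = 0"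
    and v: "Lp_space p \<Omega> v" and g: "Lp_space p \<Omega> g" and d: "0 < \<delta>"
    and t: "\<And>n. test_fun \<Omega> (\<phi> n)"
    and lim: "(\<lambda>n. Lp_norm p \<Omega> (\<lambda>x. \<phi> n x - v x) + Lp_norm p \<Omega> (\<lambda>x. cgrad (\<phi> n) x - g x)) \<longlonglongrightarrow> 0"
  shows "nl_energy p \<rho> \<delta> v \<le> (\<integral>\<^sup>+x\<in>\<Omega>. ennreal (norm (g x) powr p) \<partial>lebesgue)"
proof -
  have [measurable]: "\<phi> n \<in> borel_measurable borel" for n using test_fun_measurable[OF t[of n]] by simp
  have cm [measurable]: "cgrad (\<phi> n) \<in> borel_measurable borel" for n using test_fun_measurable[OF t[of n]] by simp
  have \<Omega>m [measurable]: "\<Omega> \<in> sets borel" using open_dom by auto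
  have "(\<lambda>n. Lp_norm p \<Omega> (\<lambda>x. \<phi> n x - v x)) \<longlonglongrightarrow> 0" "(\<lambda>n. Lp_norm p \<Omega> (\<lambda>x. cgrad (\<phi> n) x - g x)) \<longlonglongrightarrow> 0"
    by (rule tendsto_sandwich[OF _ _ tendsto_const lim]; simp add: Lp_norm_def)+
  moreover have fin: "(\<integral>\<^sup>+x\<in>\<Omega>. ennreal (norm (\<phi> n x - v x) powr p) \<partial>lebesgue) < \<infinity>"
       and fin': "(\<integral>\<^sup>+x\<in>\<Omega>. ennreal (norm (cgrad (\<phi> n) x - g x) powr p) \<partial>lebesgue) < \<infinity>" for n
  proof -
    obtain L where L: "\<And>x. \<bar>\<phi> n x\<bar> \<le> L" "\<And>x. norm (cgrad (\<phi> n) x) \<le> L" using test_fun_bounded[OF t[of n]] by blast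
    show "(\<integral>\<^sup>+x\<in>\<Omega>. ennreal (norm (\<phi> n x - v x) powr p) \<partial>lebesgue) < \<infinity>"
      using L by (intro Lp_bounded_diff_finite[OF v, of _ L]) simp
    show "(\<integral>\<^sup>+x\<in>\<Omega>. ennreal (norm (cgrad (\<phi> n) x - g x) powr p) \<partial>lebesgue) < \<infinity>"
      using L by (intro Lp_bounded_diff_finite[OF g, of _ L]) simp
  qed
  ultimately have a0: "(\<lambda>n. \<integral>\<^sup>+x\<in>\<Omega>. ennreal (norm (\<phi> n x - v x) powr p) \<partial>lebesgue) \<longlonglongrightarrow> 0"
    and b0: "(\<lambda>n. \<integral>\<^sup>+x\<in>\<Omega>. ennreal (norm (cgrad (\<phi> n) x - g x) powr p) \<partial>lebesgue) \<longlonglongrightarrow> 0"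
    using p by (auto intro!: Lp_norm_tendsto_0D simp del: real_norm_def)
  \<comment> \<open>The p-th powers converge to 0 in the mean, which is the form needed to extract
    an almost everywhere convergent subsequence.\<close>
  define h where "h = (\<lambda>n x. indicator \<Omega> x * \<bar>\<phi> n x - v x\<bar> powr p)"
  have hn: "(\<integral>\<^sup>+x. ennreal (h n x) \<partial>lborel) = (\<integral>\<^sup>+x\<in>\<Omega>. ennreal (norm (\<phi> n x - v x) powr p) \<partial>lebesgue)" for n
    unfolding nn_integral_completion by (intro nn_integral_cong) (auto simp: h_def indicator_def)
  have hm [measurable]: "h n \<in> borel_measurable borel" for n unfolding h_def by measurable
  have h0: "0 \<le> h n x" for n x by (simp add: h_def)
  have hint: "integrable lborel (h n)" for n
    using fin[of n] h0 by (intro integrableI_nonneg) (auto simp: hn)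
  have "(\<lambda>n. \<integral>x. norm (h n x) \<partial>lborel) \<longlonglongrightarrow> 0"
  proof -
    have "ennreal (\<integral>x. norm (h n x) \<partial>lborel) = (\<integral>\<^sup>+x. ennreal (h n x) \<partial>lborel)" for n
      using nn_integral_eq_integral[OF hint[of n]] h0 by simp
    then have "(\<lambda>n. ennreal (\<integral>x. norm (h n x) \<partial>lborel)) \<longlonglongrightarrow> ennreal 0" using a0 by (simp add: hn)
    then show ?thesis by (subst (asm) tendsto_ennreal_iff) (auto intro!: always_eventually)
  qed
  then obtain r where r: "strict_mono r" "AE x in lborel. (\<lambda>n. h (r n) x) \<longlonglongrightarrow> 0"
    using tendsto_L1_AE_subseq[of lborel h, OF hint] by blast
  from r(2) obtain Z where "{x \<in> space lborel. \<not> (\<lambda>n. h (r n) x) \<longlonglongrightarrow> 0} \<subseteq> Z" "emeasure lborel Z = 0" "Z \<in> sets lborel"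
    by (rule AE_E)
  then have Z: "Z \<in> null_sets lborel" "\<And>x. x \<notin> Z \<Longrightarrow> (\<lambda>n. h (r n) x) \<longlonglongrightarrow> 0"
    by (auto simp: null_sets_def)
  have conv: "(\<lambda>n. \<phi> (r n) x) \<longlonglongrightarrow> v x" if "x \<notin> Z" for x
  proof (cases "x \<in> \<Omega>")
    case True
    have "(\<lambda>n. h (r n) x powr (1 / p)) \<longlonglongrightarrow> 0 powr (1 / p)"
      using Z(2)[OF that] p h0 by (intro tendsto_powr2) auto
    then have "(\<lambda>n. \<bar>\<phi> (r n) x - v x\<bar>) \<longlonglongrightarrow> 0"
      using True p by (simp add: h_def powr_powr)
    then show ?thesis by (rule LIM_zero_cancel[OF tendsto_rabs_zero_cancel])
  next
    case False
    then show ?thesis using test_fun_zero[OF t] v0 by simp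
  qed
  define G where "G = (\<integral>\<^sup>+x\<in>\<Omega>. ennreal (norm (g x) powr p) \<partial>lebesgue)"
  have gm [measurable]: "(\<lambda>x. indicator \<Omega> x *\<^sub>R g x) \<in> borel_measurable lebesgue" using g by (simp add: Lp_space_def)
  have G: "G < \<infinity>" using g by (simp add: Lp_space_def G_def)
  let ?b = "\<lambda>n. \<integral>\<^sup>+x\<in>\<Omega>. ennreal (norm (cgrad (\<phi> (r n)) x - g x) powr p) \<partial>lebesgue"
  \<comment> \<open>The order of the limits matters: for fixed \<open>s\<close> the error term
    disappears along the subsequence although its factor is large for small \<open>s\<close>; only
    afterwards does \<open>s\<close> tend to 0.\<close>
  have le: "nl_energy p \<rho> \<delta> v \<le> ennreal ((1 - s) powr (1 - p)) * G" if s: "0 < s" "s < 1" for s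
  proof -
    have 1: "nl_energy p \<rho> \<delta> (\<phi> (r n)) \<le> ennreal ((1 - s) powr (1 - p)) * G + ennreal (s powr (1 - p)) * ?b n" for n
    proof -
      have "nl_energy p \<rho> \<delta> (\<phi> (r n)) \<le> (\<integral>\<^sup>+x\<in>\<Omega>. ennreal (norm (cgrad (\<phi> (r n)) x) powr p) \<partial>lebesgue)"
        by (rule test_fun_energy_le[OF t d])
      also have "\<dots> \<le> (\<integral>\<^sup>+x. ennreal ((1 - s) powr (1 - p)) * (ennreal (norm (indicator \<Omega> x *\<^sub>R g x) powr p) * indicator \<Omega> x) +
          ennreal (s powr (1 - p)) * (ennreal (norm (cgrad (\<phi> (r n)) x - indicator \<Omega> x *\<^sub>R g x) powr p) * indicator \<Omega> x) \<partial>lebesgue)"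
      proof (rule nn_integral_mono)
        fix x
        show "ennreal (norm (cgrad (\<phi> (r n)) x) powr p) * indicator \<Omega> x \<le>
          ennreal ((1 - s) powr (1 - p)) * (ennreal (norm (indicator \<Omega> x *\<^sub>R g x) powr p) * indicator \<Omega> x) +
          ennreal (s powr (1 - p)) * (ennreal (norm (cgrad (\<phi> (r n)) x - indicator \<Omega> x *\<^sub>R g x) powr p) * indicator \<Omega> x)"
          using powr_add_le_weighted[of p s "g x" "cgrad (\<phi> (r n)) x - g x"] p s
          by (cases "x \<in> \<Omega>") (auto simp: ennreal_mult'[symmetric] ennreal_plus[symmetric] simp del: ennreal_plus intro!: ennreal_leI)
      qed
      also have "\<dots> = ennreal ((1 - s) powr (1 - p)) * (\<integral>\<^sup>+x. ennreal (norm (indicator \<Omega> x *\<^sub>R g x) powr p) * indicator \<Omega> x \<partial>lebesgue) +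
          ennreal (s powr (1 - p)) * (\<integral>\<^sup>+x. ennreal (norm (cgrad (\<phi> (r n)) x - indicator \<Omega> x *\<^sub>R g x) powr p) * indicator \<Omega> x \<partial>lebesgue)"
      proof -
        have [measurable]: "(\<lambda>x::'a. x) \<in> borel_measurable lebesgue" by (rule measurable_completion) simp
        have m1: "(\<lambda>x. ennreal (norm (indicator \<Omega> x *\<^sub>R g x) powr p) * indicator \<Omega> x) \<in> borel_measurable lebesgue"
          using gm by measurable
        have m2: "(\<lambda>x. ennreal (norm (cgrad (\<phi> (r n)) x - indicator \<Omega> x *\<^sub>R g x) powr p) * indicator \<Omega> x) \<in> borel_measurable lebesgue"
          using gm by measurable
        show ?thesis
          by (subst nn_integral_add[OF borel_measurable_times_ennreal[OF borel_measurable_const m1] borel_measurable_times_ennreal[OF borel_measurable_const m2]])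
             (simp only: nn_integral_cmult[OF m1] nn_integral_cmult[OF m2])
      qed
      also have "(\<integral>\<^sup>+x. ennreal (norm (indicator \<Omega> x *\<^sub>R g x) powr p) * indicator \<Omega> x \<partial>lebesgue) = G"
        unfolding G_def by (intro nn_integral_cong) (auto simp: indicator_def)
      also have "(\<integral>\<^sup>+x. ennreal (norm (cgrad (\<phi> (r n)) x - indicator \<Omega> x *\<^sub>R g x) powr p) * indicator \<Omega> x \<partial>lebesgue) = ?b n"
        by (intro nn_integral_cong) (auto simp: indicator_def)
      finally show ?thesis .
    qed
    have "nl_energy p \<rho> \<delta> v \<le> liminf (\<lambda>n. nl_energy p \<rho> \<delta> (\<phi> (r n)))"
      by (rule nl_energy_liminf[OF _ _ Z(1)]) (use d conv in auto)
    also have "\<dots> \<le> liminf (\<lambda>n. ennreal ((1 - s) powr (1 - p)) * G + ennreal (s powr (1 - p)) * ?b n)"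
      by (intro Liminf_mono always_eventually allI 1)
    also have "\<dots> = ennreal ((1 - s) powr (1 - p)) * G + ennreal (s powr (1 - p)) * 0"
    proof (intro lim_imp_Liminf tendsto_add tendsto_const)
      show "(\<lambda>n. ennreal (s powr (1 - p)) * ?b n) \<longlonglongrightarrow> ennreal (s powr (1 - p)) * 0"
        using LIMSEQ_subseq_LIMSEQ[OF b0 r(1)] by (intro ennreal_tendsto_cmult) (auto simp: o_def)
    qed simp
    finally show ?thesis by simp
  qed
  \<comment> \<open>The choice s = 1/(n+2) keeps \<open>s\<close> strictly below one from n = 0
    on.\<close>
  have "(\<lambda>n. ennreal ((1 - 1 / real (Suc (Suc n))) powr (1 - p)) * G) \<longlonglongrightarrow> ennreal ((1 - 0) powr (1 - p)) * G"
    unfolding mult.commute[of _ G] using G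
    by (intro ennreal_tendsto_cmult tendsto_ennrealI tendsto_const tendsto_powr tendsto_diff LIMSEQ_Suc[OF LIMSEQ_Suc[OF lim_const_over_n]]) auto
  then have "nl_energy p \<rho> \<delta> v \<le> ennreal ((1 - 0) powr (1 - p)) * G"
    by (rule LIMSEQ_le_const) (auto intro!: exI[of _ 0] le)
  then show ?thesis by (simp add: G_def)
qed

end

section \<open>Bump functions, mollifiers and the fundamental lemma\<close>

text \<open>The classical function exp(-1/t), flat at 0, with a pole t^(-k) that does not affect the
  flatness. The poles are what differentiation produces, so the family over \<open>k\<close> has its
  derivatives in its own linear span.\<close>

definition flat_exp :: "nat \<Rightarrow> real \<Rightarrow> real" where
  "flat_exp k t = (if t \<le> 0 then 0 else exp (- (1 / t)) / t ^ k)"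

lemma flat_exp_nonneg: "0 \<le> flat_exp k t"
  by (simp add: flat_exp_def)

lemma flat_exp_pos_iff: "0 < flat_exp k t \<longleftrightarrow> 0 < t"
  by (simp add: flat_exp_def)

lemma flat_exp_derivative:
  "(flat_exp k has_real_derivative (flat_exp (k + 2) t - real k * flat_exp (k + 1) t)) (at t)"
proof -
  consider "t < 0" | "t = 0" | "0 < t" by linarith
  then show ?thesis
  proof cases
    case 1
    have "((\<lambda>t. 0) has_real_derivative 0) (at t)" by simp
    then have "(flat_exp k has_real_derivative 0) (at t)"
      by (rule has_field_derivative_transform_within_open[of _ _ _ "{..<0}"]) (use 1 in \<open>auto simp: flat_exp_def\<close>)
    then show ?thesis using 1 by (simp add: flat_exp_def)
  next
    case 2
    \<comment> \<open>With x = 1/s the difference quotient at 0 from the right becomes a power of x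
      divided by exp x.\<close>
    have "((\<lambda>x::real. x ^ Suc k / exp x) \<longlongrightarrow> 0) at_top" by (rule tendsto_power_div_exp_0)
    then have "((\<lambda>s. (1 / s) ^ Suc k / exp (1 / s)) \<longlongrightarrow> (0::real)) (at_right 0)"
      by (rule filterlim_compose) (simp add: filterlim_inverse_at_top_right inverse_eq_divide[symmetric])
    then have "((\<lambda>s. flat_exp k s / s) \<longlongrightarrow> 0) (at_right 0)"
    proof (rule Lim_transform_eventually)
      show "\<forall>\<^sub>F s in at_right 0. (1 / s) ^ Suc k / exp (1 / s) = flat_exp k s / s"
        unfolding eventually_at_right_field
        by (intro exI[of _ 1]) (auto simp: flat_exp_def exp_minus field_simps power_divide)
    qed
    moreover have "((\<lambda>s. flat_exp k s / s) \<longlongrightarrow> 0) (at_left 0)"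
    proof (rule Lim_transform_eventually[OF tendsto_const])
      show "\<forall>\<^sub>F s in at_left 0. 0 = flat_exp k s / s"
        unfolding eventually_at_left_field by (intro exI[of _ "-1"]) (auto simp: flat_exp_def)
    qed
    ultimately have "((\<lambda>s. flat_exp k s / s) \<longlongrightarrow> 0) (at 0)" by (simp add: filterlim_split_at)
    then show ?thesis using 2 by (simp add: has_field_derivative_iff flat_exp_def[of _ 0])
  next
    case 3
    have "((\<lambda>t. exp (- (1 / t)) / t ^ k) has_real_derivative (flat_exp (k + 2) t - real k * flat_exp (k + 1) t)) (at t)"
    proof (cases k)
      case 0
      then show ?thesis using 3 by (auto intro!: derivative_eq_intros simp: flat_exp_def power2_eq_square)
    next
      case (Suc m)
      show ?thesis using 3 unfolding Suc
        by (auto intro!: derivative_eq_intros simp: flat_exp_def field_simps power2_eq_square) (cases m; simp)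
    qed
    then show ?thesis
      by (rule has_field_derivative_transform_within_open[of _ _ _ "{0<..}"]) (use 3 in \<open>auto simp: flat_exp_def\<close>)
  qed
qed

text \<open>A class of functions closed under partial derivatives, hence consisting of smooth functions.\<close>
inductive elem_smooth :: "('a::euclidean_space \<Rightarrow> real) \<Rightarrow> bool" where
  const: "elem_smooth (\<lambda>x. c)"
| flat: "elem_smooth (\<lambda>x. flat_exp k (a \<bullet> x + c))"
| add: "elem_smooth f \<Longrightarrow> elem_smooth g \<Longrightarrow> elem_smooth (\<lambda>x. f x + g x)"
| mult: "elem_smooth f \<Longrightarrow> elem_smooth g \<Longrightarrow> elem_smooth (\<lambda>x. f x * g x)"
| exp: "elem_smooth f \<Longrightarrow> elem_smooth (\<lambda>x. exp (f x))"

lemma elem_smooth_derivative: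
  assumes "elem_smooth f"
  shows "\<exists>D. (\<forall>x. (f has_derivative D x) (at x)) \<and> (\<forall>i. elem_smooth (\<lambda>x. D x i))"
  using assms
proof induction
  case (const c)
  show ?case by (intro exI[of _ "\<lambda>x i. 0"]) (auto intro: elem_smooth.const)
next
  case (flat k a c)
  let ?d = "\<lambda>x. flat_exp (k + 2) (a \<bullet> x + c) - real k * flat_exp (k + 1) (a \<bullet> x + c)"
  have "((\<lambda>x. flat_exp k (a \<bullet> x + c)) has_derivative (\<lambda>z. (a \<bullet> z) * ?d x)) (at x)" for x
  proof -
    have "((\<lambda>x. a \<bullet> x + c) has_derivative (\<lambda>z. a \<bullet> z)) (at x)"
      by (auto intro!: derivative_eq_intros)
    from has_derivative_compose[OF this flat_exp_derivative[of k "a \<bullet> x + c", unfolded has_field_derivative_def]]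
    show ?thesis by (simp add: mult.commute)
  qed
  moreover have "elem_smooth (\<lambda>x. (a \<bullet> z) * ?d x)" for z
  proof -
    have "elem_smooth (\<lambda>x. (a \<bullet> z) * (flat_exp (k + 2) (a \<bullet> x + c) + (- real k) * flat_exp (k + 1) (a \<bullet> x + c)))"
      by (intro elem_smooth.intros)
    then show ?thesis by simp
  qed
  ultimately show ?case by (intro exI[of _ "\<lambda>x z. (a \<bullet> z) * ?d x"]) auto
next
  case (add f g)
  then obtain D E where "\<forall>x. (f has_derivative D x) (at x)" "\<forall>i. elem_smooth (\<lambda>x. D x i)"
    "\<forall>x. (g has_derivative E x) (at x)" "\<forall>i. elem_smooth (\<lambda>x. E x i)" by blast
  then show ?case
    by (intro exI[of _ "\<lambda>x z. D x z + E x z"]) (auto intro!: derivative_intros elem_smooth.add)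
next
  case (mult f g)
  then obtain D E where "\<forall>x. (f has_derivative D x) (at x)" "\<forall>i. elem_smooth (\<lambda>x. D x i)"
    "\<forall>x. (g has_derivative E x) (at x)" "\<forall>i. elem_smooth (\<lambda>x. E x i)" by blast
  with mult.hyps show ?case
    by (intro exI[of _ "\<lambda>x z. f x * E x z + D x z * g x"]) (auto intro!: has_derivative_mult elem_smooth.add elem_smooth.mult)
next
  case (exp f)
  then obtain D where D: "\<forall>x. (f has_derivative D x) (at x)" "\<forall>i. elem_smooth (\<lambda>x. D x i)" by blast
  have "((\<lambda>x. exp (f x)) has_derivative (\<lambda>z. exp (f x) * D x z)) (at x)" for x
    using has_derivative_exp[OF D(1)[rule_format, of x]] by (simp add: mult.commute)
  with D exp.hyps show ?case
    by (intro exI[of _ "\<lambda>x z. exp (f x) * D x z"]) (auto intro!: elem_smooth.mult elem_smooth.exp)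
qed

lemma elem_smooth_smooth:
  assumes "elem_smooth f" shows "smooth_fun f"
  using assms
proof (coinduction arbitrary: f)
  case smooth_fun
  then obtain D where D: "\<And>x. (f has_derivative D x) (at x)" "\<And>i. elem_smooth (\<lambda>x. D x i)"
    using elem_smooth_derivative by blast
  then have "frechet_derivative f (at x) = D x" for x
    using frechet_derivative_at by metis
  then show ?case using D by (auto simp: differentiable_def)
qed

lemma elem_smooth_prod:
  "finite I \<Longrightarrow> (\<And>i. i \<in> I \<Longrightarrow> elem_smooth (f i)) \<Longrightarrow> elem_smooth (\<lambda>x. \<Prod>i\<in>I. f i x)"
  by (induction I rule: finite_induct) (auto intro: elem_smooth.intros)

text \<open>Each face of the box contributes one factor, positive exactly on its inner side.\<close>

definition box_bump :: "'a::euclidean_space \<Rightarrow> 'a \<Rightarrow> 'a \<Rightarrow> real" where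
  "box_bump a b x = (\<Prod>i\<in>Basis. flat_exp 0 (i \<bullet> x + - (a \<bullet> i)) * flat_exp 0 ((- i) \<bullet> x + b \<bullet> i))"

lemma box_bump_elem: "elem_smooth (box_bump a b)"
proof -
  have "elem_smooth (\<lambda>x. box_bump a b x)"
    unfolding box_bump_def by (intro elem_smooth_prod elem_smooth.intros) auto
  then show ?thesis by simp
qed

lemma box_bump_nonneg: "0 \<le> box_bump a b x"
  unfolding box_bump_def by (intro prod_nonneg) (simp add: flat_exp_nonneg)

lemma box_bump_pos: "x \<in> box a b \<Longrightarrow> 0 < box_bump a b x"
  unfolding box_bump_def
  by (intro prod_pos) (auto simp: flat_exp_pos_iff mem_box inner_commute)

lemma box_bump_zero: "x \<notin> box a b \<Longrightarrow> box_bump a b x = 0"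
  unfolding box_bump_def by (auto simp: flat_exp_def mem_box inner_commute not_less intro!: prod_zero)

text \<open>As \<open>n\<close> grows these functions increase to the indicator of the open box
  while keeping their supports inside the closed one.\<close>

lemma test_fun_box:
  assumes "cbox a b \<subseteq> \<Omega>"
  shows "test_fun \<Omega> (\<lambda>x. 1 - exp (- real n * box_bump a b x))"
proof -
  have "elem_smooth (\<lambda>x. 1 + (-1) * exp ((- real n) * box_bump a b x))"
    by (intro elem_smooth.intros box_bump_elem)
  then have "smooth_fun (\<lambda>x. 1 - exp (- real n * box_bump a b x))"
    using elem_smooth_smooth by fastforce
  moreover have "closure {x. 1 - exp (- real n * box_bump a b x) \<noteq> 0} \<subseteq> cbox a b"
  proof (rule closure_minimal[OF _ closed_cbox], rule subsetI)
    fix x assume "x \<in> {x. 1 - exp (- real n * box_bump a b x) \<noteq> 0}"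
    then have "x \<in> box a b" using box_bump_zero[of x a b] by (cases "x \<in> box a b") auto
    then show "x \<in> cbox a b" using box_subset_cbox by blast
  qed
  ultimately show ?thesis
    unfolding test_fun_def using assms compact_eq_bounded_closed bounded_subset[OF bounded_cbox] by blast
qed

text \<open>Testing against approximations of indicators shows that the integral of G over every
  closed box in the domain vanishes. Lebesgue differentiation along shrinking cubes then gives G = 0
  at almost every point.\<close>

lemma fundamental_lemma:
  fixes G :: "'a::euclidean_space \<Rightarrow> real"
  assumes op: "open \<Omega>" and int: "set_integrable lebesgue \<Omega> G"
    and zero: "\<And>\<phi>. test_fun \<Omega> \<phi> \<Longrightarrow> (LINT x:\<Omega>|lebesgue. G x * \<phi> x) = 0"
  shows "AE x in lebesgue. x \<in> \<Omega> \<longrightarrow> G x = 0"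
proof -
  define F where "F = (\<lambda>x. indicator \<Omega> x * G x)"
  have F: "integrable lebesgue F" using int by (simp add: set_integrable_def F_def)
  have sF: "set_integrable lebesgue (cbox a b) F" for a b :: 'a
    unfolding set_integrable_def by (rule integrable_mult_indicator[OF _ F]) simp
  have box0: "integral (cbox a b) F = 0" if ab: "cbox a b \<subseteq> \<Omega>" for a b
  proof -
    let ?f = "\<lambda>n x. 1 - exp (- real n * box_bump a b x)"
    have [measurable]: "box_bump a b \<in> borel_measurable lebesgue"
      by (intro measurable_completion) (simp add: borel_measurable_continuous_onI smooth_fun_continuous elem_smooth_smooth box_bump_elem)
    have [measurable]: "box a b \<in> sets lebesgue" by simp
    have Fm [measurable]: "F \<in> borel_measurable lebesgue" using F by simp
    have "(\<lambda>n. \<integral>x. F x * ?f n x \<partial>lebesgue) \<longlonglongrightarrow> (\<integral>x. indicator (box a b) x * F x \<partial>lebesgue)"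
    proof (rule integral_dominated_convergence[where w = "\<lambda>x. \<bar>F x\<bar>"])
      show "AE x in lebesgue. norm (F x * ?f n x) \<le> \<bar>F x\<bar>" for n
        using box_bump_nonneg[of a b] by (auto intro!: AE_I2 mult_left_le simp: abs_mult)
      show "AE x in lebesgue. (\<lambda>n. F x * ?f n x) \<longlonglongrightarrow> indicator (box a b) x * F x"
      proof (rule AE_I2)
        fix x
        show "(\<lambda>n. F x * ?f n x) \<longlonglongrightarrow> indicator (box a b) x * F x"
        proof (cases "x \<in> box a b")
          case True
          have "(\<lambda>n. exp (- box_bump a b x) ^ n) \<longlonglongrightarrow> 0"
            using box_bump_pos[OF True] by (intro LIMSEQ_power_zero) simp
          then have "(\<lambda>n. exp (- real n * box_bump a b x)) \<longlonglongrightarrow> 0"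
            by (simp add: exp_of_nat_mult[symmetric])
          then have "(\<lambda>n. F x * ?f n x) \<longlonglongrightarrow> F x * (1 - 0)" by (intro tendsto_intros)
          then show ?thesis using True by simp
        qed (simp add: box_bump_zero)
      qed
    qed (use F in auto)
    moreover have "(\<integral>x. F x * ?f n x \<partial>lebesgue) = 0" for n
      using zero[OF test_fun_box[OF ab, of n]] by (simp add: set_lebesgue_integral_def F_def mult.assoc)
    ultimately have "(\<integral>x. indicator (box a b) x * F x \<partial>lebesgue) = 0"
      by (simp add: LIMSEQ_const_iff)
    moreover have "integral (cbox a b) F = integral (box a b) F"
      by (simp add: integral_open_interval)
    moreover have "integral (box a b) F = (LINT x:box a b|lebesgue. F x)"
      by (rule set_lebesgue_integral_eq_integral(2)[symmetric])
         (unfold set_integrable_def, rule integrable_mult_indicator[OF _ F], simp)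
    ultimately show ?thesis by (simp add: set_lebesgue_integral_def)
  qed
  have "\<And>a b. F integrable_on cbox a b"
    by (rule set_lebesgue_integral_eq_integral(1)[OF sF])
  then obtain N where N: "negligible N" and
    lim: "\<And>x e. \<lbrakk>x \<notin> N; 0 < e\<rbrakk> \<Longrightarrow> \<exists>d>0. \<forall>h. 0 < h \<and> h < d \<longrightarrow>
        norm (integral (cbox x (x + h *\<^sub>R One)) F /\<^sub>R h ^ DIM('a) - F x) < e"
    using integrable_ccontinuous_explicit[of F] by blast
  have "G x = 0" if x: "x \<in> \<Omega>" "x \<notin> N" for x
  proof (rule ccontr)
    assume "G x \<noteq> 0"
    then have "0 < \<bar>F x\<bar>" using x by (simp add: F_def)
    then obtain d where d: "0 < d" "\<And>h. 0 < h \<Longrightarrow> h < d \<Longrightarrow>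
        norm (integral (cbox x (x + h *\<^sub>R One)) F /\<^sub>R h ^ DIM('a) - F x) < \<bar>F x\<bar>"
      using lim[OF x(2)] by blast
    obtain e where e: "0 < e" "ball x e \<subseteq> \<Omega>" using op x(1) openE by blast
    \<comment> \<open>A side length small enough for the differentiation estimate and for the cube
      with corner \<open>x\<close> to stay inside the ball of radius \<open>e\<close>.\<close>
    define h where "h = min (d / 2) (e / (2 * (1 + norm (One::'a))))"
    have pos: "0 < 1 + norm (One::'a)" by (simp add: add_pos_nonneg)
    have h: "0 < h" "h < d" using d(1) e(1) pos by (auto simp: h_def)
    have "h * norm (One::'a) \<le> h * (1 + norm (One::'a))" using h by (intro mult_left_mono) auto
    also have "\<dots> \<le> e / (2 * (1 + norm (One::'a))) * (1 + norm (One::'a))"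
      using pos by (intro mult_right_mono) (auto simp: h_def)
    also have "\<dots> = e / 2" using pos by (simp add: field_simps)
    finally have he: "h * norm (One::'a) < e" using e(1) by simp
    have "cbox x (x + h *\<^sub>R One) \<subseteq> ball x e"
    proof
      fix y assume y: "y \<in> cbox x (x + h *\<^sub>R One)"
      have "norm (y - x) \<le> norm (h *\<^sub>R (One::'a))"
        using y h by (intro norm_le_componentwise) (auto simp: mem_box algebra_simps)
      then show "y \<in> ball x e" using he h by (simp add: dist_norm norm_minus_commute)
    qed
    then have "integral (cbox x (x + h *\<^sub>R One)) F = 0" using e by (intro box0) blast
    then show False using d(2)[OF h] by simp
  qed
  then have "{x. \<not> (x \<in> \<Omega> \<longrightarrow> G x = 0)} \<subseteq> N" by blast
  then show ?thesis
    using N by (intro AE_I'[of N]) (auto simp: negligible_iff_null_sets)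
qed

section \<open>Mollification by convolution\<close>

lemma mollifier_exists:
  assumes r: "0 < (r::real)"
  shows "\<exists>\<eta>::'a::euclidean_space \<Rightarrow> real. smooth_fun \<eta> \<and> (\<forall>x. 0 \<le> \<eta> x) \<and> (\<forall>x. r \<le> norm x \<longrightarrow> \<eta> x = 0) \<and>
    integrable lborel \<eta> \<and> (\<integral>x. \<eta> x \<partial>lborel) = 1"
proof -
  \<comment> \<open>Points of the cube with half side \<open>s\<close> have norm at most
    \<open>s * norm One\<close>, which the added 1 keeps strictly below \<open>r\<close>.\<close>
  define s where "s = r / (1 + norm (One::'a))"
  have pos: "0 < 1 + norm (One::'a)" by (simp add: add_pos_nonneg)
  have s: "0 < s" using r pos by (simp add: s_def)
  let ?B = "box_bump (- s *\<^sub>R One) (s *\<^sub>R (One::'a))"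
  have far: "?B x = 0" if "r \<le> norm x" for x
  proof (rule box_bump_zero, rule)
    assume x: "x \<in> box (- s *\<^sub>R One) (s *\<^sub>R (One::'a))"
    have "norm x \<le> norm (s *\<^sub>R (One::'a))"
      using x s by (intro norm_le_componentwise) (force simp: mem_box)
    also have "\<dots> < r" using r pos s by (simp add: s_def field_simps)
    finally show False using that by simp
  qed
  have cont: "continuous_on UNIV ?B" by (intro smooth_fun_continuous elem_smooth_smooth box_bump_elem)
  have [measurable]: "?B \<in> borel_measurable borel" by (intro borel_measurable_continuous_onI cont)
  have int: "integrable lborel ?B"
  proof -
    have "integrable lborel (\<lambda>x. indicator (cball 0 r) x *\<^sub>R ?B x)"
      using borel_integrable_compact[OF compact_cball continuous_on_subset[OF cont subset_UNIV]]
      by (simp add: set_integrable_def)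
    moreover have "(\<lambda>x. indicator (cball 0 r) x *\<^sub>R ?B x) = ?B"
      using far by (auto simp: indicator_def fun_eq_iff)
    ultimately show ?thesis by simp
  qed
  have I: "0 < (\<integral>x. ?B x \<partial>lborel)"
  proof -
    have "(\<integral>x. ?B x \<partial>lborel) \<noteq> 0"
    proof
      assume "(\<integral>x. ?B x \<partial>lborel) = 0"
      then have "AE x in lborel. ?B x = 0"
        using integral_nonneg_eq_0_iff_AE[OF int] box_bump_nonneg by auto
      then have "AE x in lborel. x \<notin> box (- s *\<^sub>R One) (s *\<^sub>R (One::'a))"
        by eventually_elim (metis box_bump_pos less_irrefl)
      then have "emeasure lborel (box (- s *\<^sub>R One) (s *\<^sub>R (One::'a))) = 0"
        by (subst (asm) AE_iff_measurable[OF _ refl]) auto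
      moreover have "0 < prod ((\<bullet>) (s *\<^sub>R One + s *\<^sub>R One)) (Basis :: 'a set)"
        using s by (intro prod_pos) (simp add: inner_add_left)
      ultimately show False using s by (simp add: emeasure_lborel_box_eq ennreal_eq_0_iff)
    qed
    moreover have "0 \<le> (\<integral>x. ?B x \<partial>lborel)" by (simp add: box_bump_nonneg)
    ultimately show ?thesis by simp
  qed
  let ?c = "1 / (\<integral>x. ?B x \<partial>lborel)"
  have "smooth_fun (\<lambda>x. ?c * ?B x)"
    by (intro elem_smooth_smooth elem_smooth.intros box_bump_elem)
  then show ?thesis
    using I int far by (intro exI[of _ "\<lambda>x. ?c * ?B x"]) (auto simp: box_bump_nonneg)
qed

text \<open>A partial derivative of such a convolution is a convolution of the same shape, with
  \<open>\<eta>\<close> replaced by its partial derivative. The coinduction therefore generalises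
  over \<open>\<eta>\<close>, and only first derivatives under the integral have to be
  justified.\<close>

lemma smooth_fun_convolution:
  fixes w :: "'a::euclidean_space \<Rightarrow> real"
  assumes w: "continuous_on UNIV w" and e: "smooth_fun \<eta>"
  shows "smooth_fun (\<lambda>x. integral (cbox a b) (\<lambda>y. w y * \<eta> (x - y)))"
  using e
proof (coinduction arbitrary: \<eta>)
  case smooth_fun
  have cont: "continuous_on UNIV (\<lambda>x. frechet_derivative \<eta> (at x) i)" if "i \<in> Basis" for i
    by (intro smooth_fun_continuous smooth_fun_partial smooth_fun that)
  \<comment> \<open>The derivative in \<open>x\<close> as a bounded linear map, jointly continuous
    in both variables as the Leibniz rule requires.\<close>
  define fx :: "'a \<Rightarrow> 'a \<Rightarrow> 'a \<Rightarrow>\<^sub>L real" where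
    "fx = (\<lambda>x y. \<Sum>i\<in>Basis. (w y * frechet_derivative \<eta> (at (x - y)) i) *\<^sub>R blinfun_inner_left i)"
  have fx: "blinfun_apply (fx x y) z = w y * (cgrad \<eta> (x - y) \<bullet> z)" for x y z
    by (simp add: fx_def blinfun.sum_left blinfun.scaleR_left cgrad_def inner_sum_left sum_distrib_left mult.assoc inner_commute[of z])
  have der: "((\<lambda>x. integral (cbox a b) (\<lambda>y. w y * \<eta> (x - y))) has_derivative
      blinfun_apply (integral (cbox a b) (fx x))) (at x within UNIV)" for x
  proof (rule leibniz_rule)
    fix x y
    have "((\<lambda>x. \<eta> (x - y)) has_derivative (\<lambda>z. cgrad \<eta> (x - y) \<bullet> z)) (at x)"
      by (rule has_derivative_compose[of "\<lambda>x. x - y" "\<lambda>z. z" x UNIV \<eta>])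
         (auto intro!: derivative_eq_intros smooth_fun_derivative smooth_fun)
    then show "((\<lambda>x. w y * \<eta> (x - y)) has_derivative blinfun_apply (fx x y)) (at x within UNIV)"
      by (subst fx[THEN ext]) (auto intro!: derivative_eq_intros)
  next
    fix x
    show "(\<lambda>y. w y * \<eta> (x - y)) integrable_on cbox a b"
      by (intro integrable_continuous continuous_intros continuous_on_subset[OF w]
          continuous_on_compose2[OF smooth_fun_continuous[OF smooth_fun, of UNIV]]) auto
  next
    show "continuous_on (UNIV \<times> cbox a b) (\<lambda>(x, t). fx x t)"
      unfolding fx_def split_beta
      by (intro continuous_intros continuous_on_compose2[OF w] continuous_on_compose2[OF cont]) auto
  qed auto
  have part: "blinfun_apply (integral (cbox a b) (fx x)) i = integral (cbox a b) (\<lambda>y. w y * frechet_derivative \<eta> (at (x - y)) i)"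
    if "i \<in> Basis" for x i
  proof -
    have "fx x integrable_on cbox a b"
      unfolding fx_def
      by (intro integrable_continuous continuous_intros continuous_on_subset[OF w]
          continuous_on_compose2[OF cont]) auto
    then have "blinfun_apply (integral (cbox a b) (fx x)) i = integral (cbox a b) (\<lambda>y. blinfun_apply (fx x y) i)"
      by (rule blinfun_apply_integral)
    then show ?thesis using that by (simp add: fx cgrad_inner)
  qed
  have fd: "frechet_derivative (\<lambda>x. integral (cbox a b) (\<lambda>y. w y * \<eta> (x - y))) (at x) = blinfun_apply (integral (cbox a b) (fx x))" for x
    using frechet_derivative_at[OF der[of x]] by simp
  let ?conv = "\<lambda>\<eta> x. integral (cbox a b) (\<lambda>y. w y * \<eta> (x - y))"
  have "\<forall>x. ?conv \<eta> differentiable (at x)" using der unfolding differentiable_def by auto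
  moreover have "\<exists>\<eta>'. (\<lambda>x. frechet_derivative (?conv \<eta>) (at x) i) = ?conv \<eta>' \<and> smooth_fun \<eta>'" if "i \<in> Basis" for i
    using that smooth_fun_partial[OF smooth_fun that]
    by (intro exI[of _ "\<lambda>x. frechet_derivative \<eta> (at x) i"]) (simp add: fd part)
  ultimately show ?case by blast
qed

lemma integral_lborel_reflect:
  fixes f :: "'a::euclidean_space \<Rightarrow> real"
  assumes [measurable]: "f \<in> borel_measurable borel"
  shows "(\<integral>y. f (x - y) \<partial>lborel) = (\<integral>y. f y \<partial>lborel)"
proof -
  have "lborel = distr lborel borel (\<lambda>y::'a. x + (-1) *\<^sub>R y)"
    using lborel_affine[of "-1" x] by (simp add: density_1)
  then have "(\<integral>y. f y \<partial>lborel) = (\<integral>y. f y \<partial>distr lborel borel (\<lambda>y::'a. x + (-1) *\<^sub>R y))" by simp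
  also have "\<dots> = (\<integral>y. f (x + (-1) *\<^sub>R y) \<partial>lborel)" by (rule integral_distr) auto
  finally show ?thesis by simp
qed

text \<open>The form over a box serves for smoothness; the form over the whole space, with the shift
  moved onto \<open>w\<close>, is an average of values of \<open>w\<close> near \<open>x\<close> and
  serves for estimates.\<close>

lemma convolution_eq:
  fixes w :: "'a::euclidean_space \<Rightarrow> real"
  assumes w: "continuous_on UNIV w" and e: "smooth_fun \<eta>" and supp: "\<And>x. x \<notin> cbox a b \<Longrightarrow> w x = 0"
  shows "integral (cbox a b) (\<lambda>y. w y * \<eta> (x - y)) = (\<integral>y. w (x - y) * \<eta> y \<partial>lborel)"
proof -
  have c: "continuous_on UNIV (\<lambda>y. w y * \<eta> (x - y))"
    by (intro continuous_intros w continuous_on_compose2[OF smooth_fun_continuous[OF e, of UNIV]]) auto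
  have "set_integrable lborel (cbox a b) (\<lambda>y. w y * \<eta> (x - y))"
    using borel_integrable_compact[OF compact_cbox continuous_on_subset[OF c subset_UNIV]]
    by (simp add: set_integrable_def)
  then have "integral (cbox a b) (\<lambda>y. w y * \<eta> (x - y)) = (LINT y:cbox a b|lborel. w y * \<eta> (x - y))"
    by (rule set_borel_integral_eq_integral(2)[symmetric])
  also have "\<dots> = (\<integral>y. w y * \<eta> (x - y) \<partial>lborel)"
    unfolding set_lebesgue_integral_def
    by (intro Bochner_Integration.integral_cong) (auto simp: indicator_def supp)
  also have "\<dots> = (\<integral>y. w (x - y) * \<eta> (x - (x - y)) \<partial>lborel)"
    by (rule integral_lborel_reflect[symmetric]) (intro borel_measurable_continuous_onI c)
  finally show ?thesis by simp
qed

text \<open>\<open>\<eta>\<close> is a probability density concentrated on the ball of radius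
  \<open>r\<close>, so averaging against it preserves any bound valid on that ball.\<close>

lemma mollifier_average:
  fixes f :: "'a::euclidean_space \<Rightarrow> real"
  assumes f: "continuous_on UNIV f" and e: "smooth_fun \<eta>" "\<And>x. 0 \<le> \<eta> x" "\<And>x. r \<le> norm x \<Longrightarrow> \<eta> x = 0"
    "integrable lborel \<eta>" "(\<integral>x. \<eta> x \<partial>lborel) = 1"
    and bd: "\<And>y. norm y < r \<Longrightarrow> \<bar>f y - c\<bar> \<le> k"
  shows "integrable lborel (\<lambda>y. f y * \<eta> y)" "\<bar>(\<integral>y. f y * \<eta> y \<partial>lborel) - c\<bar> \<le> k"
proof -
  have c: "continuous_on UNIV (\<lambda>y. f y * \<eta> y)"
    by (intro continuous_intros f smooth_fun_continuous e)
  have "integrable lborel (\<lambda>y. indicator (cball 0 r) y *\<^sub>R (f y * \<eta> y))"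
    using borel_integrable_compact[OF compact_cball continuous_on_subset[OF c subset_UNIV]]
    by (simp add: set_integrable_def)
  moreover have "(\<lambda>y. indicator (cball 0 r) y *\<^sub>R (f y * \<eta> y)) = (\<lambda>y. f y * \<eta> y)"
    using e(3) by (auto simp: indicator_def fun_eq_iff)
  ultimately show int: "integrable lborel (\<lambda>y. f y * \<eta> y)" by simp
  have "(\<integral>y. f y * \<eta> y \<partial>lborel) - c = (\<integral>y. f y * \<eta> y - c * \<eta> y \<partial>lborel)"
    using int e by (simp add: Bochner_Integration.integral_diff)
  also have "\<bar>\<dots>\<bar> \<le> (\<integral>y. k * \<eta> y \<partial>lborel)"
  proof -
    have "norm (\<integral>y. f y * \<eta> y - c * \<eta> y \<partial>lborel) \<le> (\<integral>y. k * \<eta> y \<partial>lborel)"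
    proof (rule order_trans[OF integral_norm_bound integral_mono])
      fix y
      have "\<bar>(f y - c) * \<eta> y\<bar> \<le> k * \<eta> y"
        using bd[of y] e(2)[of y] e(3)[of y] by (cases "norm y < r") (auto simp: abs_mult intro!: mult_right_mono)
      then show "norm (f y * \<eta> y - c * \<eta> y) \<le> k * \<eta> y" by (simp add: left_diff_distrib)
    qed (use int e in auto)
    then show ?thesis by simp
  qed
  finally show "\<bar>(\<integral>y. f y * \<eta> y \<partial>lborel) - c\<bar> \<le> k" using e by simp
qed

text \<open>Above \<open>A\<close> the number y/A is at most its p-th power. With A = 1 this
  compares integrals of powers on a set of finite measure; with \<open>A\<close> large and p > 1 the
  factor A^(1-p) is small, which removes the jumps in the Lipschitz argument.\<close>

lemma le_add_powr:
  fixes y A :: real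
  assumes "1 \<le> p" "0 \<le> y" "0 < A"
  shows "y \<le> A + A powr (1 - p) * y powr p"
proof (cases "y \<le> A")
  case False
  then have "(y / A) powr 1 \<le> (y / A) powr p" using assms by (intro powr_mono) auto
  then have "y \<le> A * (y powr p / A powr p)" using assms by (simp add: powr_divide field_simps)
  also have "\<dots> = A powr (1 - p) * y powr p" using assms by (simp add: powr_diff)
  finally show ?thesis using assms by simp
next
  case True
  then show ?thesis using assms by (simp add: add_increasing2)
qed

section \<open>Integrability on the domain and uniqueness of weak gradients\<close>

context nonlocal_setting
begin

lemma dom_measurable [measurable]: "\<Omega> \<in> sets borel" "\<Omega> \<in> sets lebesgue"
  using open_dom by auto

lemma dom_finite: "emeasure lebesgue \<Omega> < \<infinity>"
  using emeasure_bounded_finite[OF bounded_dom] by simp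

lemma Lp_space_set_integrable:
  fixes g :: "'a \<Rightarrow> 'b::{banach,second_countable_topology}"
  assumes q: "1 \<le> q" and g: "Lp_space q \<Omega> g"
  shows "set_integrable lebesgue \<Omega> g"
  unfolding set_integrable_def
proof (rule integrableI_bounded)
  show m: "(\<lambda>x. indicator \<Omega> x *\<^sub>R g x) \<in> borel_measurable lebesgue" using g by (simp add: Lp_space_def)
  have m': "(\<lambda>x. ennreal (norm (indicator \<Omega> x *\<^sub>R g x) powr q)) \<in> borel_measurable lebesgue"
    using m by measurable
  have "(\<integral>\<^sup>+x. ennreal (norm (indicator \<Omega> x *\<^sub>R g x)) \<partial>lebesgue) \<le>
      (\<integral>\<^sup>+x. indicator \<Omega> x + ennreal (norm (indicator \<Omega> x *\<^sub>R g x) powr q) \<partial>lebesgue)"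
  proof (rule nn_integral_mono)
    fix x
    have "norm (g x) \<le> 1 + norm (g x) powr q" using le_add_powr[OF q norm_ge_zero, of 1 "g x"] by simp
    then show "ennreal (norm (indicator \<Omega> x *\<^sub>R g x)) \<le> indicator \<Omega> x + ennreal (norm (indicator \<Omega> x *\<^sub>R g x) powr q)"
      by (cases "x \<in> \<Omega>") (auto simp: ennreal_1[symmetric] ennreal_plus[symmetric] simp del: ennreal_1 ennreal_plus intro!: ennreal_leI)
  qed
  also have "\<dots> = emeasure lebesgue \<Omega> + (\<integral>\<^sup>+x. ennreal (norm (indicator \<Omega> x *\<^sub>R g x) powr q) \<partial>lebesgue)"
    by (subst nn_integral_add[OF borel_measurable_indicator m']) auto
  also have "(\<integral>\<^sup>+x. ennreal (norm (indicator \<Omega> x *\<^sub>R g x) powr q) \<partial>lebesgue) = (\<integral>\<^sup>+x\<in>\<Omega>. ennreal (norm (g x) powr q) \<partial>lebesgue)"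
    using q by (intro nn_integral_cong) (auto simp: indicator_def)
  also have "emeasure lebesgue \<Omega> + (\<integral>\<^sup>+x\<in>\<Omega>. ennreal (norm (g x) powr q) \<partial>lebesgue) < \<infinity>"
    using g dom_finite by (simp add: Lp_space_def)
  finally show "(\<integral>\<^sup>+x. ennreal (norm (indicator \<Omega> x *\<^sub>R g x)) \<partial>lebesgue) < \<infinity>" .
qed

text \<open>The fundamental lemma in each component. It makes the choice hidden in
  \<open>weak_grad\<close> harmless: every admissible gradient has the same Dirichlet
  integral.\<close>

lemma weak_grad_unique:
  assumes g: "Lp_space p \<Omega> g" "is_weak_grad \<Omega> u g" and h: "Lp_space p \<Omega> h" "is_weak_grad \<Omega> u h"
  shows "AE x in lebesgue. x \<in> \<Omega> \<longrightarrow> g x = h x"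
proof -
  have int: "set_integrable lebesgue \<Omega> (\<lambda>x. g x \<bullet> i)" "set_integrable lebesgue \<Omega> (\<lambda>x. h x \<bullet> i)" for i
    using Lp_space_set_integrable[OF _ g(1)] Lp_space_set_integrable[OF _ h(1)] p
    by (auto simp: set_integrable_def inner_scaleR_left[symmetric] simp del: inner_scaleR_left intro!: integrable_inner_left)
  have "AE x in lebesgue. x \<in> \<Omega> \<longrightarrow> g x \<bullet> i - h x \<bullet> i = 0" if i: "i \<in> Basis" for i
  proof (rule fundamental_lemma[OF open_dom])
    show "set_integrable lebesgue \<Omega> (\<lambda>x. g x \<bullet> i - h x \<bullet> i)"
      by (intro set_integral_diff int)
    fix \<phi> assume t: "test_fun \<Omega> \<phi>"
    obtain L where L: "\<And>x. \<bar>\<phi> x\<bar> \<le> L" using test_fun_bounded[OF t] by blast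
    have m: "\<phi> \<in> borel_measurable lebesgue"
      by (intro measurable_completion) (simp add: test_fun_measurable[OF t])
    have bi: "set_integrable lebesgue \<Omega> (\<lambda>x. f x * \<phi> x)" if "set_integrable lebesgue \<Omega> f" for f :: "'a \<Rightarrow> real"
    proof -
      let ?f = "\<lambda>x. indicator \<Omega> x *\<^sub>R f x"
      have i: "integrable lebesgue ?f" using that by (simp add: set_integrable_def)
      have "integrable lebesgue (\<lambda>x. ?f x * \<phi> x)"
      proof (rule Bochner_Integration.integrable_bound[OF integrable_mult_right[OF i, of L]])
        show "(\<lambda>x. ?f x * \<phi> x) \<in> borel_measurable lebesgue"
          by (rule borel_measurable_times[OF borel_measurable_integrable[OF i] m])
        have "norm (?f x * \<phi> x) \<le> norm (L * ?f x)" for x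
          using mult_right_mono[OF order_trans[OF L abs_ge_self], of "\<bar>?f x\<bar>" x] by (simp add: abs_mult mult.commute)
        then show "AE x in lebesgue. norm (?f x * \<phi> x) \<le> norm (L * ?f x)" by simp
      qed
      then show ?thesis by (simp add: set_integrable_def mult.assoc)
    qed
    have "(LINT x:\<Omega>|lebesgue. (g x \<bullet> i) * \<phi> x) = (LINT x:\<Omega>|lebesgue. (h x \<bullet> i) * \<phi> x)"
      using g(2) h(2) t i by (simp add: is_weak_grad_def)
    then show "(LINT x:\<Omega>|lebesgue. (g x \<bullet> i - h x \<bullet> i) * \<phi> x) = 0"
      using bi[OF int(1)[of i]] bi[OF int(2)[of i]] by (simp add: left_diff_distrib set_integral_diff)
  qed
  then have "AE x in lebesgue. \<forall>i\<in>Basis. x \<in> \<Omega> \<longrightarrow> g x \<bullet> i - h x \<bullet> i = 0"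
    by (intro AE_finite_allI) auto
  then show ?thesis by eventually_elim (auto intro: euclidean_eqI)
qed

section \<open>Lipschitz regularity from bounded energy\<close>

text \<open>An energy bound at all scales forbids jumps: over \<open>k\<close> small steps the increments exceeding
  slope \<open>L\<close> occur on a set of vanishing measure, and \<open>p > 1\<close> makes their total contribution vanish.\<close>
lemma bounded_energy_imp_lipschitz:
  fixes u :: "'a \<Rightarrow> real" and g :: "'a \<Rightarrow> 'a"
  assumes um [measurable]: "u \<in> borel_measurable borel"
    and u0: "\<And>x. x \<notin> \<Omega> \<Longrightarrow> u x = 0"
    and Z: "Z \<in> null_sets lborel"
    and der: "\<And>x. x \<notin> Z \<Longrightarrow> (u has_derivative (\<lambda>z. g x \<bullet> z)) (at x)"
    and gL: "\<And>x. x \<notin> Z \<Longrightarrow> norm (g x) < L"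
    and M: "0 \<le> M" "\<And>t. 0 < t \<Longrightarrow> nl_energy p \<rho> t u \<le> ennreal M"
    and xy: "x \<notin> Z" "y \<notin> Z"
  shows "\<bar>u x - u y\<bar> \<le> L * norm (x - y)"
proof -
  obtain C where C: "0 < C" "\<And>t. \<rho> t \<le> C" using kernel_bounded by blast
  obtain c C0 where c: "0 < c" "c < 1" "0 < C0" "\<And>t. \<bar>t\<bar> \<le> c \<Longrightarrow> C0 \<le> \<rho> t"
    using kern by (auto simp: admissible_kernel_def)
  obtain r where r: "0 < r" "\<Omega> \<subseteq> ball 0 r" using bounded_dom bounded_subset_ballD by blast
  \<comment> \<open>With this step the direction z = (y - x)/T has norm below \<open>c\<close>,
    where the kernel is bounded away from 0.\<close>
  define T where "T = (norm (x - y) + 1) / c"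
  have T: "0 < T" using c by (simp add: T_def add_nonneg_pos)
  let ?P = "(lborel :: 'a measure) \<Otimes>\<^sub>M (lborel :: 'a measure)"
  \<comment> \<open>The excess of an increment over slope \<open>L\<close>. Taking the positive part
    keeps it subadditive when an increment is cut into steps.\<close>
  define Q where "Q = (\<lambda>t x z. max 0 (\<bar>u (x + t *\<^sub>R z) - u x\<bar> - L * t * norm z))"
  have Qm [measurable]: "(\<lambda>w. Q t (fst w) (snd w)) \<in> borel_measurable ?P" for t unfolding Q_def by measurable
  have Qm1 [measurable]: "(\<lambda>x. Q t (x + v) z) \<in> borel_measurable borel" for t v z unfolding Q_def by measurable
  define t where "t = (\<lambda>n. T / real (Suc n))"
  have t: "0 < t n" "t n \<le> T" for n using T by (auto simp: t_def field_simps)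
  have t0: "t \<longlonglongrightarrow> 0" unfolding t_def by (rule LIMSEQ_Suc[OF lim_const_over_n])
  \<comment> \<open>Indicator of the pairs whose quotient exceeds slope \<open>L\<close>. Off
    \<open>Z\<close> the quotients converge to something strictly smaller, so the kernel-weighted
    measure \<open>m n\<close> of these pairs tends to 0.\<close>
  define E where "E = (\<lambda>n w. if L * norm (snd w) < \<bar>(u (fst w + t n *\<^sub>R snd w) - u (fst w)) / t n\<bar> then 1 else (0::real))"
  have Em [measurable]: "E n \<in> borel_measurable ?P" for n unfolding E_def by measurable
  define m where "m = (\<lambda>n. \<integral>\<^sup>+w. ennreal (\<rho> (norm (snd w)) * E n w) \<partial>?P)"
  have L0: "0 < L" using gL[OF xy(1)] norm_ge_zero[of "g x"] by linarith
  have m0: "m \<longlonglongrightarrow> 0"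
  proof -
    let ?A = "ball (0::'a) (r + T)" and ?B = "ball (0::'a) 1"
    have bound: "\<rho> (norm (snd w)) * E n w \<le> C * indicator ?A (fst w) * indicator ?B (snd w)" for n w
    proof (cases "norm (snd w) < 1 \<and> fst w \<in> ?A")
      case True
      have "\<rho> (norm (snd w)) * E n w \<le> C * 1" using C kernel_nonneg by (intro mult_mono) (auto simp: E_def)
      then show ?thesis using True by simp
    next
      case False
      have zero: "\<rho> (norm (snd w)) * E n w = 0"
      proof (cases "norm (snd w) < 1")
        case True
        then have x: "r + T \<le> norm (fst w)" using False by simp
        have "norm (fst w) \<le> norm (fst w + t n *\<^sub>R snd w) + norm (t n *\<^sub>R snd w)"
          using norm_triangle_ineq4[of "fst w + t n *\<^sub>R snd w" "t n *\<^sub>R snd w"] by simp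
        moreover have "norm (t n *\<^sub>R snd w) \<le> t n" using True t(1)[of n] by simp
        ultimately have "r \<le> norm (fst w)" "r \<le> norm (fst w + t n *\<^sub>R snd w)" using x t[of n] T by linarith+
        then have "fst w \<notin> \<Omega>" "fst w + t n *\<^sub>R snd w \<notin> \<Omega>" by (auto dest!: subsetD[OF r(2)])
        then show ?thesis using L0 by (simp add: E_def u0 mult_less_0_iff)
      qed (simp add: kernel_zero)
      show ?thesis unfolding zero using C(1) by simp
    qed
    have "m \<longlonglongrightarrow> (\<integral>\<^sup>+w. ennreal 0 \<partial>?P)"
      unfolding m_def
    proof (rule nn_integral_dominated_convergence[where w = "\<lambda>w. ennreal C * indicator (?A \<times> ?B) w"])
      show "AE w in ?P. (\<lambda>n. ennreal (\<rho> (norm (snd w)) * E n w)) \<longlonglongrightarrow> ennreal 0"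
        using AE_lborel_pair_fst[OF Z]
      proof eventually_elim
        case (elim w)
        show ?case
        proof (rule tendsto_eventually, cases "snd w = 0")
          case True
          then show "\<forall>\<^sub>F n in sequentially. ennreal (\<rho> (norm (snd w)) * E n w) = ennreal 0" by (simp add: E_def)
        next
          case False
          have "(\<lambda>n. \<bar>(u (fst w + t n *\<^sub>R snd w) - u (fst w)) / t n\<bar>) \<longlonglongrightarrow> \<bar>g (fst w) \<bullet> snd w\<bar>"
            using t(1) by (intro tendsto_rabs directional_quotient_tendsto der elim t0) (auto simp: less_imp_neq[THEN not_sym])
          moreover have "\<bar>g (fst w) \<bullet> snd w\<bar> < L * norm (snd w)"
          proof -
            have "\<bar>g (fst w) \<bullet> snd w\<bar> \<le> norm (g (fst w)) * norm (snd w)" by (rule Cauchy_Schwarz_ineq2)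
            also have "\<dots> < L * norm (snd w)" using gL[OF elim] False by simp
            finally show ?thesis .
          qed
          ultimately have "\<forall>\<^sub>F n in sequentially. \<bar>(u (fst w + t n *\<^sub>R snd w) - u (fst w)) / t n\<bar> < L * norm (snd w)"
            by (rule order_tendstoD(2))
          then show "\<forall>\<^sub>F n in sequentially. ennreal (\<rho> (norm (snd w)) * E n w) = ennreal 0"
            by eventually_elim (simp add: E_def not_less less_imp_le)
        qed
      qed
      show "AE w in ?P. ennreal (\<rho> (norm (snd w)) * E n w) \<le> ennreal C * indicator (?A \<times> ?B) w" for n
      proof (rule AE_I2)
        fix w :: "'a \<times> 'a"
        show "ennreal (\<rho> (norm (snd w)) * E n w) \<le> ennreal C * indicator (?A \<times> ?B) w"
          using ennreal_leI[OF bound[of w n]] by (cases w) (auto simp: indicator_def split: if_splits)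
      qed
      have "(\<integral>\<^sup>+w. ennreal C * indicator (?A \<times> ?B) w \<partial>?P) = ennreal C * (emeasure lborel ?A * emeasure lborel ?B)"
        by (subst nn_integral_cmult_indicator) (auto simp: lborel.emeasure_pair_measure_Times)
      also have "\<dots> < \<infinity>"
        using emeasure_lborel_ball_finite[of "0::'a"] by (simp add: ennreal_mult_less_top)
      finally show "(\<integral>\<^sup>+w. ennreal C * indicator (?A \<times> ?B) w \<partial>?P) < \<infinity>" .
    qed auto
    then show ?thesis by simp
  qed
  define I where "I = (\<integral>\<^sup>+w. ennreal (\<rho> (norm (snd w)) * Q T (fst w) (snd w)) \<partial>?P)"
  \<comment> \<open>The step T consists of n + 1 steps of length \<open>t n\<close>, whose excesses
    all have the same integral by translation invariance; (n + 1) * t n = T gives the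
    factor.\<close>
  have step: "I \<le> ennreal T * (\<integral>\<^sup>+w. ennreal (\<rho> (norm (snd w)) * (Q (t n) (fst w) (snd w) / t n)) \<partial>?P)" for n
  proof -
    let ?k = "Suc n"
    have Tk: "T = real ?k * t n" by (simp add: t_def)
    have pt: "Q T x z \<le> (\<Sum>j<?k. Q (t n) (x + (real j * t n) *\<^sub>R z) z)" for x z
    proof -
      let ?f = "\<lambda>j. u (x + (real j * t n) *\<^sub>R z)"
      have "\<bar>u (x + T *\<^sub>R z) - u x\<bar> = \<bar>\<Sum>j<?k. ?f (Suc j) - ?f j\<bar>"
        using sum_lessThan_telescope[of ?f ?k] by (simp add: Tk)
      also have "\<dots> \<le> (\<Sum>j<?k. \<bar>?f (Suc j) - ?f j\<bar>)" by (rule sum_abs)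
      also have "\<dots> \<le> (\<Sum>j<?k. Q (t n) (x + (real j * t n) *\<^sub>R z) z + L * t n * norm z)"
        by (intro sum_mono) (simp add: Q_def algebra_simps scaleR_add_left)
      also have "\<dots> = (\<Sum>j<?k. Q (t n) (x + (real j * t n) *\<^sub>R z) z) + L * T * norm z"
        unfolding sum.distrib by (simp add: Tk del: sum.lessThan_Suc)
      finally have "\<bar>u (x + T *\<^sub>R z) - u x\<bar> \<le> (\<Sum>j<?k. Q (t n) (x + (real j * t n) *\<^sub>R z) z) + L * T * norm z" .
      moreover have "0 \<le> (\<Sum>j<?k. Q (t n) (x + (real j * t n) *\<^sub>R z) z)"
        by (intro sum_nonneg) (simp add: Q_def)
      moreover have "Q T x z = max 0 (\<bar>u (x + T *\<^sub>R z) - u x\<bar> - L * T * norm z)" by (simp add: Q_def)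
      ultimately show ?thesis by linarith
    qed
    have "I = (\<integral>\<^sup>+z. \<integral>\<^sup>+x. ennreal (\<rho> (norm z) * Q T x z) \<partial>lborel \<partial>lborel)"
      unfolding I_def by (subst lborel_pair.nn_integral_snd[symmetric]) auto
    also have "\<dots> \<le> (\<integral>\<^sup>+z. \<integral>\<^sup>+x. (\<Sum>j<?k. ennreal (\<rho> (norm z) * Q (t n) (x + (real j * t n) *\<^sub>R z) z)) \<partial>lborel \<partial>lborel)"
    proof (intro nn_integral_mono)
      fix x z
      have "\<rho> (norm z) * Q T x z \<le> (\<Sum>j<?k. \<rho> (norm z) * Q (t n) (x + (real j * t n) *\<^sub>R z) z)"
        using mult_left_mono[OF pt[of x z] kernel_nonneg[of "norm z"]] by (simp add: sum_distrib_left del: sum.lessThan_Suc)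
      then show "ennreal (\<rho> (norm z) * Q T x z) \<le> (\<Sum>j<?k. ennreal (\<rho> (norm z) * Q (t n) (x + (real j * t n) *\<^sub>R z) z))"
        by (subst sum_ennreal) (auto simp: kernel_nonneg Q_def simp del: sum.lessThan_Suc intro!: ennreal_leI)
    qed
    also have "\<dots> = (\<integral>\<^sup>+z. ennreal T * (\<integral>\<^sup>+x. ennreal (\<rho> (norm z) * (Q (t n) x z / t n)) \<partial>lborel) \<partial>lborel)"
    proof (rule nn_integral_cong)
      fix z :: 'a
      have "(\<integral>\<^sup>+x. (\<Sum>j<?k. ennreal (\<rho> (norm z) * Q (t n) (x + (real j * t n) *\<^sub>R z) z)) \<partial>lborel) =
          (\<Sum>j<?k. \<integral>\<^sup>+x. ennreal (\<rho> (norm z) * Q (t n) (x + (real j * t n) *\<^sub>R z) z) \<partial>lborel)"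
        by (rule nn_integral_sum) measurable
      also have "\<dots> = (\<Sum>j<?k. \<integral>\<^sup>+x. ennreal (\<rho> (norm z) * Q (t n) x z) \<partial>lborel)"
      proof (rule sum.cong[OF refl])
        fix j
        show "(\<integral>\<^sup>+x. ennreal (\<rho> (norm z) * Q (t n) (x + (real j * t n) *\<^sub>R z) z) \<partial>lborel) = (\<integral>\<^sup>+x. ennreal (\<rho> (norm z) * Q (t n) x z) \<partial>lborel)"
          using Qm1[of "t n" 0 z]
          by (intro nn_integral_lborel_translate[where f = "\<lambda>x. ennreal (\<rho> (norm z) * Q (t n) x z)"]) simp
      qed
      also have "\<dots> = ennreal (real ?k) * (\<integral>\<^sup>+x. ennreal (\<rho> (norm z) * Q (t n) x z) \<partial>lborel)"
        by (simp add: ennreal_of_nat_eq_real_of_nat del: of_nat_Suc)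
      also have "(\<integral>\<^sup>+x. ennreal (\<rho> (norm z) * Q (t n) x z) \<partial>lborel) = (\<integral>\<^sup>+x. ennreal (t n) * ennreal (\<rho> (norm z) * (Q (t n) x z / t n)) \<partial>lborel)"
        using t(1)[of n] by (intro nn_integral_cong) (simp add: ennreal_mult'[symmetric])
      also have "\<dots> = ennreal (t n) * (\<integral>\<^sup>+x. ennreal (\<rho> (norm z) * (Q (t n) x z / t n)) \<partial>lborel)"
        using Qm1[of "t n" 0 z] by (intro nn_integral_cmult) simp
      finally show "(\<integral>\<^sup>+x. (\<Sum>j<?k. ennreal (\<rho> (norm z) * Q (t n) (x + (real j * t n) *\<^sub>R z) z)) \<partial>lborel) =
          ennreal T * (\<integral>\<^sup>+x. ennreal (\<rho> (norm z) * (Q (t n) x z / t n)) \<partial>lborel)"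
        using t(1)[of n] by (simp add: Tk ennreal_mult' mult.assoc del: of_nat_Suc)
    qed
    also have "\<dots> = ennreal T * (\<integral>\<^sup>+z. \<integral>\<^sup>+x. ennreal (\<rho> (norm z) * (Q (t n) x z / t n)) \<partial>lborel \<partial>lborel)"
      by (rule nn_integral_cmult) (unfold Q_def, measurable)
    also have "(\<integral>\<^sup>+z. \<integral>\<^sup>+x. ennreal (\<rho> (norm z) * (Q (t n) x z / t n)) \<partial>lborel \<partial>lborel) =
        (\<integral>\<^sup>+w. ennreal (\<rho> (norm (snd w)) * (Q (t n) (fst w) (snd w) / t n)) \<partial>?P)"
      by (subst lborel_pair.nn_integral_snd[symmetric]) auto
    finally show ?thesis .
  qed
  \<comment> \<open>The excess is 0 where \<open>E\<close> is 0. Elsewhere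
    \<open>le_add_powr\<close> charges the part up to \<open>A\<close> to the measure
    \<open>m n\<close> and the rest to the energy.\<close>
  have split: "(\<integral>\<^sup>+w. ennreal (\<rho> (norm (snd w)) * (Q (t n) (fst w) (snd w) / t n)) \<partial>?P) \<le>
      ennreal A * m n + ennreal (A powr (1 - p)) * ennreal M" if A: "0 < A" for n A
  proof -
    have "(\<integral>\<^sup>+w. ennreal (\<rho> (norm (snd w)) * (Q (t n) (fst w) (snd w) / t n)) \<partial>?P) \<le>
      (\<integral>\<^sup>+w. ennreal A * ennreal (\<rho> (norm (snd w)) * E n w) + ennreal (A powr (1 - p)) * ennreal (nl_integrand p \<rho> (t n) u (fst w) (snd w)) \<partial>?P)"
    proof (rule nn_integral_mono)
      fix w :: "'a \<times> 'a"
      define D where "D = \<bar>(u (fst w + t n *\<^sub>R snd w) - u (fst w)) / t n\<bar>"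
      have "Q (t n) (fst w) (snd w) / t n \<le> A * E n w + A powr (1 - p) * D powr p"
      proof (cases "L * norm (snd w) < D")
        case True
        have "Q (t n) (fst w) (snd w) / t n \<le> \<bar>u (fst w + t n *\<^sub>R snd w) - u (fst w)\<bar> / t n"
          using t(1)[of n] L0 by (intro divide_right_mono) (auto simp: Q_def)
        also have "\<dots> = D" using t(1)[of n] by (simp add: D_def)
        also have "\<dots> \<le> A + A powr (1 - p) * D powr p"
          using A p by (intro le_add_powr) (auto simp: D_def)
        finally show ?thesis using True by (simp add: E_def D_def)
      next
        case False
        then have "\<bar>u (fst w + t n *\<^sub>R snd w) - u (fst w)\<bar> \<le> L * t n * norm (snd w)"
          using t(1)[of n] by (simp add: D_def field_simps)
        then have "Q (t n) (fst w) (snd w) = 0" by (simp add: Q_def)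
        then show ?thesis using A by (simp add: E_def)
      qed
      then have "\<rho> (norm (snd w)) * (Q (t n) (fst w) (snd w) / t n) \<le>
          A * (\<rho> (norm (snd w)) * E n w) + A powr (1 - p) * nl_integrand p \<rho> (t n) u (fst w) (snd w)"
        using mult_left_mono[OF _ kernel_nonneg[of "norm (snd w)"]] by (fastforce simp: nl_integrand_def D_def algebra_simps)
      then have "ennreal (\<rho> (norm (snd w)) * (Q (t n) (fst w) (snd w) / t n)) \<le>
          ennreal (A * (\<rho> (norm (snd w)) * E n w) + A powr (1 - p) * nl_integrand p \<rho> (t n) u (fst w) (snd w))"
        by (rule ennreal_leI)
      also have "\<dots> = ennreal A * ennreal (\<rho> (norm (snd w)) * E n w) + ennreal (A powr (1 - p)) * ennreal (nl_integrand p \<rho> (t n) u (fst w) (snd w))"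
        using A kernel_nonneg[of "norm (snd w)"]
        by (subst ennreal_plus) (auto simp: ennreal_mult' nl_integrand_nonneg E_def)
      finally show "ennreal (\<rho> (norm (snd w)) * (Q (t n) (fst w) (snd w) / t n)) \<le>
        ennreal A * ennreal (\<rho> (norm (snd w)) * E n w) + ennreal (A powr (1 - p)) * ennreal (nl_integrand p \<rho> (t n) u (fst w) (snd w))" .
    qed
    also have "\<dots> = ennreal A * m n + ennreal (A powr (1 - p)) * nl_energy p \<rho> (t n) u"
      unfolding m_def nl_energy_def by (subst nn_integral_add, measurable) (simp add: nn_integral_cmult)
    also have "\<dots> \<le> ennreal A * m n + ennreal (A powr (1 - p)) * ennreal M"
      by (intro add_left_mono mult_left_mono M t) auto
    finally show ?thesis .
  qed
  \<comment> \<open>First n tends to infinity, which removes \<open>m n\<close> for fixed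
    \<open>A\<close>; the remaining factor A^(1-p) is sent to 0 in the next step.\<close>
  have I_le: "I \<le> ennreal T * (ennreal (A powr (1 - p)) * ennreal M)" if A: "0 < A" for A
  proof -
    have "(\<lambda>n. ennreal T * (ennreal A * m n + ennreal (A powr (1 - p)) * ennreal M)) \<longlonglongrightarrow>
        ennreal T * (ennreal A * 0 + ennreal (A powr (1 - p)) * ennreal M)"
      by (intro ennreal_tendsto_cmult tendsto_add m0 tendsto_const) auto
    then have "I \<le> ennreal T * (ennreal A * 0 + ennreal (A powr (1 - p)) * ennreal M)"
    proof (rule LIMSEQ_le_const)
      have "I \<le> ennreal T * (ennreal A * m n + ennreal (A powr (1 - p)) * ennreal M)" for n
        using step[of n] mult_left_mono[OF split[OF A, of n], of "ennreal T"] by (meson order_trans zero_le)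
      then show "\<exists>N. \<forall>n\<ge>N. I \<le> ennreal T * (ennreal A * m n + ennreal (A powr (1 - p)) * ennreal M)" by blast
    qed
    then show ?thesis by simp
  qed
  have "I = 0"
  proof -
    have "((\<lambda>x. x powr (1 - p)) \<longlongrightarrow> 0) at_top" using p by (intro tendsto_neg_powr filterlim_ident) simp
    then have "(\<lambda>n. real (Suc n) powr (1 - p)) \<longlonglongrightarrow> 0"
      by (rule filterlim_compose) (rule filterlim_compose[OF filterlim_real_sequentially filterlim_Suc])
    then have "(\<lambda>n. T * (real (Suc n) powr (1 - p) * M)) \<longlonglongrightarrow> T * (0 * M)" by (intro tendsto_intros)
    then have "(\<lambda>n. ennreal (T * (real (Suc n) powr (1 - p) * M))) \<longlonglongrightarrow> ennreal (T * (0 * M))" by (rule tendsto_ennrealI)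
    then have "I \<le> ennreal (T * (0 * M))"
      by (rule LIMSEQ_le_const) (use I_le T M(1) in \<open>auto intro!: exI[of _ 0] simp: ennreal_mult' simp del: of_nat_Suc\<close>)
    then show ?thesis by simp
  qed
  then have AE: "AE w in ?P. ennreal (\<rho> (norm (snd w)) * Q T (fst w) (snd w)) = 0"
    unfolding I_def by (subst (asm) nn_integral_0_iff_AE) auto
  show ?thesis
  proof (rule ccontr)
    assume neg: "\<not> ?thesis"
    \<comment> \<open>If the bound failed at \<open>x\<close> and \<open>y\<close>, continuity of
      \<open>u\<close> at these two points would make the excess positive on an open set of pairs
      around \<open>w0\<close> on which the kernel is positive. This contradicts the vanishing of
      \<open>I\<close>.\<close>
    define F where "F = (\<lambda>w. \<bar>u (fst w + T *\<^sub>R snd w) - u (fst w)\<bar> - L * T * norm (snd w))"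
    define w0 where "w0 = (x, (y - x) /\<^sub>R T)"
    have fw: "fst w0 = x" "fst w0 + T *\<^sub>R snd w0 = y" using T by (auto simp: w0_def)
    have cu: "isCont u z" if "z \<notin> Z" for z using der[OF that] by (rule has_derivative_continuous)
    have "isCont F w0"
      unfolding F_def
      by (intro continuous_intros isCont_o2[of _ fst u] isCont_o2[of _ "\<lambda>w. fst w + T *\<^sub>R snd w" u]) (use fw cu xy in auto)
    moreover have "0 < F w0"
    proof -
      have "T * norm (snd w0) = norm (x - y)" using T by (simp add: w0_def norm_minus_commute)
      then show ?thesis using neg fw by (simp add: F_def mult.assoc abs_minus_commute)
    qed
    ultimately have "\<forall>\<^sub>F w in nhds w0. 0 < F w"
      by (intro order_tendstoD(1)) (auto simp: isCont_def tendsto_at_iff_tendsto_nhds)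
    moreover have "\<forall>\<^sub>F w in nhds w0. norm (snd w) < c"
    proof (rule order_tendstoD(2))
      show "((\<lambda>w. norm (snd w)) \<longlongrightarrow> norm (snd w0)) (nhds w0)"
        by (intro tendsto_intros filterlim_ident)
      have "norm (snd w0) = norm (x - y) / T" using T by (simp add: w0_def norm_minus_commute divide_inverse mult.commute)
      also have "\<dots> < c" using T c by (simp add: pos_divide_less_eq) (simp add: T_def)
      finally show "norm (snd w0) < c" .
    qed
    ultimately have "\<forall>\<^sub>F w in nhds w0. 0 < F w \<and> norm (snd w) < c" by (rule eventually_conj)
    then obtain S where S: "open S" "w0 \<in> S" "\<And>w. w \<in> S \<Longrightarrow> 0 < F w \<and> norm (snd w) < c"
      by (auto simp: eventually_nhds)
    have "AE w in lborel. w \<notin> S"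
      using AE unfolding lborel_prod
    proof eventually_elim
      case (elim w)
      show "w \<notin> S"
      proof
        assume "w \<in> S"
        then have F: "0 < F w" "norm (snd w) < c" using S(3) by auto
        have "0 < \<rho> (norm (snd w))" using c(3) c(4)[of "norm (snd w)"] F(2) by simp
        moreover have "0 < Q T (fst w) (snd w)" using F(1) by (simp add: F_def Q_def)
        ultimately have "0 < \<rho> (norm (snd w)) * Q T (fst w) (snd w)" by simp
        then show False using elim by (simp add: ennreal_eq_0_iff)
      qed
    qed
    then have "S \<in> null_sets lborel"
      using S(1) by (subst (asm) AE_iff_null_sets[symmetric]) auto
    then have "negligible S" by (simp add: negligible_iff_null_sets null_sets_completionI)
    then show False using open_not_negligible[OF S(1)] S(2) by blast
  qed
qed

end

section \<open>Approximation of Lipschitz functions by test functions\<close>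

text \<open>Difference quotients in the direction z = c - G give |z|^2 \<le> e |z|.\<close>

lemma gradient_close:
  fixes f :: "'a::euclidean_space \<Rightarrow> real"
  assumes der: "(f has_derivative (\<lambda>z. c \<bullet> z)) (at x)" and s: "0 < s"
    and close: "\<And>a. a \<in> ball x s \<Longrightarrow> \<bar>f a - f x - G \<bullet> (a - x)\<bar> \<le> e * norm (a - x)"
  shows "norm (c - G) \<le> e"
proof -
  define z where "z = c - G"
  have e0: "0 \<le> e"
  proof -
    obtain b :: 'a where b: "norm b = 1" by (metis norm_Basis SOME_Basis)
    have "x + (s / 2) *\<^sub>R b \<in> ball x s" using s b by (simp add: dist_norm)
    from order_trans[OF abs_ge_zero close[OF this]] show ?thesis using s b by (simp add: zero_le_mult_iff)
  qed
  show ?thesis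
  proof (cases "z = 0")
    case True then show ?thesis using e0 by (simp add: z_def)
  next
    case False
    define h where "h = (\<lambda>n. s / (2 * norm z) / real (Suc n))"
    have h: "0 < h n" "h n * norm z < s" for n
    proof -
      show "0 < h n" using s False by (simp add: h_def)
      have "h n * norm z = (s / 2) / real (Suc n)" using False by (simp add: h_def)
      also have "\<dots> \<le> s / 2" using s by (simp add: divide_le_eq mult_left_mono)
      finally show "h n * norm z < s" using s by simp
    qed
    have h0: "h \<longlonglongrightarrow> 0" unfolding h_def by (rule LIMSEQ_Suc[OF lim_const_over_n])
    have "(\<lambda>n. (f (x + h n *\<^sub>R z) - f x) / h n - G \<bullet> z) \<longlonglongrightarrow> c \<bullet> z - G \<bullet> z"
    proof (intro tendsto_diff tendsto_const)
      show "(\<lambda>n. (f (x + h n *\<^sub>R z) - f x) / h n) \<longlonglongrightarrow> c \<bullet> z"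
        using h(1) by (intro directional_quotient_tendsto der h0) (auto simp: less_imp_neq[THEN not_sym])
    qed
    moreover have "\<bar>(f (x + h n *\<^sub>R z) - f x) / h n - G \<bullet> z\<bar> \<le> e * norm z" for n
    proof -
      have "\<bar>f (x + h n *\<^sub>R z) - f x - h n * (G \<bullet> z)\<bar> \<le> e * (h n * norm z)"
        using close[of "x + h n *\<^sub>R z"] h[of n] by (simp add: dist_norm)
      moreover have "\<bar>(f (x + h n *\<^sub>R z) - f x) / h n - G \<bullet> z\<bar> = \<bar>f (x + h n *\<^sub>R z) - f x - h n * (G \<bullet> z)\<bar> / h n"
      proof -
        have "(f (x + h n *\<^sub>R z) - f x) / h n - G \<bullet> z = (f (x + h n *\<^sub>R z) - f x - h n * (G \<bullet> z)) / h n"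
          using h(1)[of n] by (simp add: field_simps)
        then show ?thesis using h(1)[of n] by (simp only: abs_divide abs_of_pos)
      qed
      ultimately show ?thesis using h(1)[of n] by (simp add: pos_divide_le_eq mult_ac)
    qed
    ultimately have "\<bar>c \<bullet> z - G \<bullet> z\<bar> \<le> e * norm z"
      by (intro LIMSEQ_le_const2[OF tendsto_rabs]) auto
    then have "norm z * norm z \<le> e * norm z"
      by (simp add: inner_diff_left[symmetric] z_def[symmetric] power2_norm_eq_inner[symmetric] power2_eq_square)
    then show ?thesis using False by (simp add: z_def)
  qed
qed

text \<open>Soft thresholding. Besides annihilating small values it is a mere shift wherever the
  sign is fixed and the size is at least \<open>e\<close>, so gradients are unchanged there; a
  smooth cut-off would alter them.\<close>

definition soft_trunc :: "real \<Rightarrow> real \<Rightarrow> real" where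
  "soft_trunc e t = max (t - e) 0 + min (t + e) 0"

lemma soft_trunc_zero: "\<bar>t\<bar> \<le> e \<Longrightarrow> soft_trunc e t = 0"
  by (auto simp: soft_trunc_def)

lemma soft_trunc_lipschitz: "0 \<le> e \<Longrightarrow> \<bar>soft_trunc e s - soft_trunc e t\<bar> \<le> \<bar>s - t\<bar>"
  by (auto simp: soft_trunc_def max_def min_def)

lemma soft_trunc_close: "0 \<le> e \<Longrightarrow> \<bar>soft_trunc e t - t\<bar> \<le> e"
  by (auto simp: soft_trunc_def max_def min_def)

lemma soft_trunc_diff:
  "0 \<le> e \<Longrightarrow> e \<le> \<bar>s\<bar> \<Longrightarrow> e \<le> \<bar>t\<bar> \<Longrightarrow> 0 \<le> s * t \<Longrightarrow> soft_trunc e s - soft_trunc e t = s - t"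
  by (auto simp: soft_trunc_def max_def min_def zero_le_mult_iff abs_if split: if_splits)

text \<open>The mean value inequality for \<open>u\<close> minus the linear function given by
  \<open>G\<close>. The estimate is stable under averaging over translates, hence under
  mollification.\<close>

lemma lipschitz_near:
  fixes u :: "'a::euclidean_space \<Rightarrow> real"
  assumes der: "\<And>y. y \<in> ball x s \<Longrightarrow> (u has_derivative (\<lambda>z. g y \<bullet> z)) (at y)"
    and close: "\<And>y. y \<in> ball x s \<Longrightarrow> norm (g y - G) \<le> e"
    and ab: "a \<in> ball x s" "b \<in> ball x s"
  shows "\<bar>u a - u b - G \<bullet> (a - b)\<bar> \<le> e * norm (a - b)"
proof -
  have "norm ((u a - G \<bullet> a) - (u b - G \<bullet> b)) \<le> e * norm (a - b)"
  proof (rule differentiable_bound[of "ball x s" "\<lambda>y. u y - G \<bullet> y" "\<lambda>y z. (g y - G) \<bullet> z"])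
    fix y assume y: "y \<in> ball x s"
    show "((\<lambda>y. u y - G \<bullet> y) has_derivative (\<lambda>z. (g y - G) \<bullet> z)) (at y within ball x s)"
      unfolding inner_diff_left
      by (intro has_derivative_diff has_derivative_at_withinI[OF der[OF y]] has_derivative_inner_right has_derivative_ident)
    show "onorm (\<lambda>z. (g y - G) \<bullet> z) \<le> e"
    proof (rule onorm_le)
      fix z
      have "norm ((g y - G) \<bullet> z) \<le> norm (g y - G) * norm z" by (simp add: Cauchy_Schwarz_ineq2)
      also have "\<dots> \<le> e * norm z" using close[OF y] by (intro mult_right_mono) auto
      finally show "norm ((g y - G) \<bullet> z) \<le> e * norm z" .
    qed
  qed (use ab in auto)
  then show ?thesis by (simp add: inner_diff_right algebra_simps)
qed

section \<open>Integration by parts and approximation in the Sobolev norm\<close>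

context nonlocal_setting
begin

text \<open>Difference quotients in direction \<open>i\<close> have integral 0 by translation
  invariance, and the Lipschitz bound lets the limit be taken under the integral. Applied to a
  product it yields integration by parts.\<close>

lemma integral_gradient_zero:
  fixes f :: "'a \<Rightarrow> real"
  assumes f0: "\<And>x. x \<notin> \<Omega> \<Longrightarrow> f x = 0" and lip: "\<And>x y. \<bar>f x - f y\<bar> \<le> L * norm (x - y)"
    and [measurable]: "f \<in> borel_measurable borel" "g \<in> borel_measurable borel"
    and der: "\<And>x. (f has_derivative (\<lambda>z. g x \<bullet> z)) (at x)"
    and i: "i \<in> Basis"
  shows "(\<integral>x. g x \<bullet> i \<partial>lborel) = 0"
proof -
  obtain r where r: "0 < r" "\<Omega> \<subseteq> ball 0 r" using bounded_dom bounded_subset_ballD by blast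
  define s where "s = (\<lambda>n. 1 / real (Suc n))"
  have s: "0 < s n" "s n \<le> 1" for n by (auto simp: s_def field_simps)
  have s0: "s \<longlonglongrightarrow> 0" unfolding s_def by (rule LIMSEQ_Suc[OF lim_const_over_n])
  have L: "0 \<le> L" using order_trans[OF abs_ge_zero lip[of i 0]] i by simp
  have bound: "\<bar>(f (x + s n *\<^sub>R i) - f x) / s n\<bar> \<le> L * indicator (ball 0 (r + 2)) x" for n x
  proof (cases "x \<in> ball 0 (r + 2)")
    case True
    then show ?thesis using lip[of "x + s n *\<^sub>R i" x] s(1)[of n] i by (simp add: pos_divide_le_eq mult.commute)
  next
    case False
    have "norm x \<le> norm (x + s n *\<^sub>R i) + norm (s n *\<^sub>R i)"
      using norm_triangle_ineq4[of "x + s n *\<^sub>R i" "s n *\<^sub>R i"] by simp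
    moreover have "norm (s n *\<^sub>R i) \<le> 1" using s[of n] i by simp
    ultimately have "r \<le> norm x" "r \<le> norm (x + s n *\<^sub>R i)" using False by auto
    then have "x \<notin> \<Omega>" "x + s n *\<^sub>R i \<notin> \<Omega>" by (auto dest!: subsetD[OF r(2)])
    then show ?thesis using False by (simp add: f0)
  qed
  have lim: "(\<lambda>n. \<integral>x. (f (x + s n *\<^sub>R i) - f x) / s n \<partial>lborel) \<longlonglongrightarrow> (\<integral>x. g x \<bullet> i \<partial>lborel)"
  proof (rule integral_dominated_convergence[where w = "\<lambda>x. L * indicator (ball 0 (r + 2)) x"])
    show "AE x in lborel. (\<lambda>n. (f (x + s n *\<^sub>R i) - f x) / s n) \<longlonglongrightarrow> g x \<bullet> i"
      using s(1) by (intro AE_I2 directional_quotient_tendsto der s0) (auto simp: less_imp_neq[THEN not_sym])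
    show "integrable lborel (\<lambda>x::'a. L * indicator (ball 0 (r + 2)) x)"
      using emeasure_lborel_ball_finite[of "0::'a" "r + 2"] by (intro integrable_mult_right integrable_real_indicator) auto
  qed (use bound in auto)
  have zero: "(\<integral>x. (f (x + s n *\<^sub>R i) - f x) / s n \<partial>lborel) = 0" for n
  proof -
    have fi: "integrable lborel f"
    proof (rule Bochner_Integration.integrable_bound[where f = "\<lambda>x::'a. (L * (2 * r)) * indicator (ball 0 r) x"])
      show "integrable lborel (\<lambda>x::'a. (L * (2 * r)) * indicator (ball 0 r) x)"
        using emeasure_lborel_ball_finite[of "0::'a" r] by (intro integrable_mult_right integrable_real_indicator) auto
      have "\<bar>f x\<bar> \<le> (L * (2 * r)) * indicator (ball 0 r) x" for x
      proof (cases "x \<in> ball 0 r")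
        case True
        obtain b :: 'a where b: "norm b = 1" by (metis norm_Basis SOME_Basis)
        have "r *\<^sub>R b \<notin> \<Omega>" using r b by (auto dest!: subsetD[OF r(2)])
        then have "\<bar>f x\<bar> \<le> L * norm (x - r *\<^sub>R b)" using lip[of x "r *\<^sub>R b"] f0 by simp
        also have "\<dots> \<le> L * (norm x + norm (r *\<^sub>R b))" using L by (intro mult_left_mono norm_triangle_ineq4)
        also have "\<dots> \<le> L * (2 * r)" using True L b r by (intro mult_left_mono) auto
        finally show ?thesis using True by simp
      next
        case False
        then have "x \<notin> \<Omega>" by (auto dest!: subsetD[OF r(2)])
        then show ?thesis using False by (simp add: f0)
      qed
      then show "AE x in lborel. norm (f x) \<le> norm ((L * (2 * r)) * indicator (ball 0 r) x)"
        by (auto intro!: AE_I2 order_trans[OF _ abs_ge_self])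
    qed auto
    have eq: "distr lborel borel ((+) (s n *\<^sub>R i)) = (lborel :: 'a measure)" by (rule lborel_distr_plus)
    have "integrable (distr lborel borel ((+) (s n *\<^sub>R i))) f" using fi by (simp only: eq)
    then have fi': "integrable lborel (\<lambda>x. f (x + s n *\<^sub>R i))"
      by (subst (asm) integrable_distr_eq) (auto simp: add.commute)
    have "(\<integral>x. f x \<partial>lborel) = (\<integral>x. f x \<partial>distr lborel borel ((+) (s n *\<^sub>R i)))" by (simp only: eq)
    also have "\<dots> = (\<integral>x. f (x + s n *\<^sub>R i) \<partial>lborel)" by (subst integral_distr) (auto simp: add.commute)
    finally show ?thesis using fi fi' by simp
  qed
  show ?thesis using lim unfolding zero by (simp add: LIMSEQ_const_iff)
qed

lemma integration_by_parts_test: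
  assumes f: "test_fun \<Omega> \<psi>" and t: "test_fun \<Omega> \<phi>" and i: "i \<in> Basis"
  shows "(\<integral>x. \<psi> x * (cgrad \<phi> x \<bullet> i) \<partial>lborel) = - (\<integral>x. (cgrad \<psi> x \<bullet> i) * \<phi> x \<partial>lborel)"
proof -
  obtain A where A: "0 \<le> A" "\<And>x. \<bar>\<psi> x\<bar> \<le> A" "\<And>x. norm (cgrad \<psi> x) \<le> A" "\<And>x y. \<bar>\<psi> x - \<psi> y\<bar> \<le> A * norm (x - y)"
    using test_fun_bounded[OF f] by blast
  obtain B where B: "0 \<le> B" "\<And>x. \<bar>\<phi> x\<bar> \<le> B" "\<And>x. norm (cgrad \<phi> x) \<le> B" "\<And>x y. \<bar>\<phi> x - \<phi> y\<bar> \<le> B * norm (x - y)"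
    using test_fun_bounded[OF t] by blast
  note [measurable] = test_fun_measurable[OF f] test_fun_measurable[OF t]
  have comp: "\<bar>v \<bullet> i\<bar> \<le> norm v" for v :: 'a using Basis_le_norm[OF i] .
  have int: "integrable lborel (\<lambda>x. \<psi> x * (cgrad \<phi> x \<bullet> i))" "integrable lborel (\<lambda>x. (cgrad \<psi> x \<bullet> i) * \<phi> x)"
  proof -
    have *: "integrable lborel h" if [measurable]: "h \<in> borel_measurable borel" and "\<And>x. \<bar>h x\<bar> \<le> A * B * indicator \<Omega> x" for h :: "'a \<Rightarrow> real"
    proof (rule Bochner_Integration.integrable_bound[where f = "\<lambda>x::'a. A * B * indicator \<Omega> x"])
      show "integrable lborel (\<lambda>x::'a. A * B * indicator \<Omega> x)"
        using dom_finite by (intro integrable_mult_right integrable_real_indicator) auto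
      show "AE x in lborel. norm (h x) \<le> norm (A * B * indicator \<Omega> x)"
        using that(2) by (auto intro!: AE_I2 order_trans[OF _ abs_ge_self])
    qed auto
    have "\<bar>\<psi> x * (cgrad \<phi> x \<bullet> i)\<bar> \<le> A * B * indicator \<Omega> x" for x
    proof (cases "x \<in> \<Omega>")
      case True
      have "\<bar>\<psi> x\<bar> * \<bar>cgrad \<phi> x \<bullet> i\<bar> \<le> A * B"
        using A B comp[of "cgrad \<phi> x"] by (intro mult_mono) (auto intro: order_trans)
      then show ?thesis using True by (simp add: abs_mult)
    qed (simp add: test_fun_zero[OF f])
    then show "integrable lborel (\<lambda>x. \<psi> x * (cgrad \<phi> x \<bullet> i))" by (intro *) measurable
    have "\<bar>(cgrad \<psi> x \<bullet> i) * \<phi> x\<bar> \<le> A * B * indicator \<Omega> x" for x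
    proof (cases "x \<in> \<Omega>")
      case True
      have "\<bar>cgrad \<psi> x \<bullet> i\<bar> * \<bar>\<phi> x\<bar> \<le> A * B"
        using A B comp[of "cgrad \<psi> x"] by (intro mult_mono) (auto intro: order_trans)
      then show ?thesis using True by (simp add: abs_mult)
    qed (simp add: test_fun_zero[OF t])
    then show "integrable lborel (\<lambda>x. (cgrad \<psi> x \<bullet> i) * \<phi> x)" by (intro *) measurable
  qed
  have "(\<integral>x. (\<psi> x *\<^sub>R cgrad \<phi> x + \<phi> x *\<^sub>R cgrad \<psi> x) \<bullet> i \<partial>lborel) = 0"
  proof (rule integral_gradient_zero[where f = "\<lambda>x. \<psi> x * \<phi> x" and L = "2 * A * B"])
    show "((\<lambda>x. \<psi> x * \<phi> x) has_derivative (\<lambda>z. (\<psi> x *\<^sub>R cgrad \<phi> x + \<phi> x *\<^sub>R cgrad \<psi> x) \<bullet> z)) (at x)" for x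
      using f t has_derivative_mult[OF smooth_fun_derivative[of \<psi> x] smooth_fun_derivative[of \<phi> x]]
      by (simp add: test_fun_def inner_add_left mult.commute)
    fix x y
    have "\<bar>\<psi> x * \<phi> x - \<psi> y * \<phi> y\<bar> = \<bar>\<psi> x * (\<phi> x - \<phi> y) + (\<psi> x - \<psi> y) * \<phi> y\<bar>" by (simp add: algebra_simps)
    also have "\<dots> \<le> \<bar>\<psi> x\<bar> * \<bar>\<phi> x - \<phi> y\<bar> + \<bar>\<psi> x - \<psi> y\<bar> * \<bar>\<phi> y\<bar>"
      by (rule order_trans[OF abs_triangle_ineq]) (simp add: abs_mult)
    also have "\<dots> \<le> A * (B * norm (x - y)) + (A * norm (x - y)) * B"
      using A B by (intro add_mono mult_mono) auto
    finally show "\<bar>\<psi> x * \<phi> x - \<psi> y * \<phi> y\<bar> \<le> 2 * A * B * norm (x - y)" by (simp add: algebra_simps)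
  qed (use i test_fun_zero[OF f] in auto)
  then have "(\<integral>x. \<psi> x * (cgrad \<phi> x \<bullet> i) + (cgrad \<psi> x \<bullet> i) * \<phi> x \<partial>lborel) = 0"
    by (simp add: inner_add_left mult.commute)
  then show ?thesis using int by (simp add: Bochner_Integration.integral_add)
qed

lemma Lp_norm_tendsto_0I:
  fixes v :: "nat \<Rightarrow> 'a \<Rightarrow> 'b::{real_normed_vector,second_countable_topology}"
  assumes m: "\<And>n. v n \<in> borel_measurable lebesgue" and bd: "\<And>n. AE x in lebesgue. norm (v n x) \<le> K"
    and lim: "AE x in lebesgue. (\<lambda>n. v n x) \<longlonglongrightarrow> 0"
  shows "(\<lambda>n. Lp_norm p \<Omega> (v n)) \<longlonglongrightarrow> 0"
proof -
  have "(\<lambda>n. \<integral>\<^sup>+x\<in>\<Omega>. ennreal (norm (v n x) powr p) \<partial>lebesgue) \<longlonglongrightarrow> (\<integral>\<^sup>+x. ennreal 0 \<partial>(lebesgue :: 'a measure))"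
  proof (rule nn_integral_dominated_convergence[where w = "\<lambda>x. ennreal (K powr p) * indicator \<Omega> x"])
    show "AE x in lebesgue. ennreal (norm (v n x) powr p) * indicator \<Omega> x \<le> ennreal (K powr p) * indicator \<Omega> x" for n
      using bd[of n] by eventually_elim (use p in \<open>auto intro!: mult_right_mono ennreal_leI powr_mono2\<close>)
    show "AE x in lebesgue. (\<lambda>n. ennreal (norm (v n x) powr p) * indicator \<Omega> x) \<longlonglongrightarrow> ennreal 0"
      using lim
    proof eventually_elim
      case (elim x)
      have "(\<lambda>n. norm (v n x) powr p) \<longlonglongrightarrow> 0 powr p"
        using p by (intro tendsto_powr2 tendsto_norm_zero elim tendsto_const) auto
      then have "(\<lambda>n. ennreal (norm (v n x) powr p)) \<longlonglongrightarrow> ennreal 0" using p by (intro tendsto_ennrealI) simp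
      then show ?case by (cases "x \<in> \<Omega>") auto
    qed
    show "(\<integral>\<^sup>+x. ennreal (K powr p) * indicator \<Omega> x \<partial>lebesgue) < \<infinity>"
      using dom_finite by (subst nn_integral_cmult_indicator) (auto simp: ennreal_mult_less_top)
    show "(\<lambda>x. ennreal (norm (v n x) powr p) * indicator \<Omega> x) \<in> borel_measurable lebesgue" for n
      using m[of n] by measurable
  qed auto
  then have "(\<lambda>n. enn2real (\<integral>\<^sup>+x\<in>\<Omega>. ennreal (norm (v n x) powr p) \<partial>lebesgue)) \<longlonglongrightarrow> enn2real 0"
    by (intro tendsto_enn2real) auto
  then have "(\<lambda>n. Lp_norm p \<Omega> (v n)) \<longlonglongrightarrow> 0 powr (1 / p)"
    unfolding Lp_norm_def using p by (intro tendsto_powr2) auto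
  then show ?thesis by simp
qed

lemma Lp_space_bounded:
  fixes v :: "'a \<Rightarrow> 'b::{real_normed_vector,second_countable_topology}"
  assumes m: "v \<in> borel_measurable lebesgue" and bd: "\<And>x. x \<in> \<Omega> \<Longrightarrow> norm (v x) \<le> K"
  shows "Lp_space p \<Omega> v"
  unfolding Lp_space_def
proof
  show "(\<lambda>x. indicator \<Omega> x *\<^sub>R v x) \<in> borel_measurable lebesgue" using m by measurable
  have "(\<integral>\<^sup>+x\<in>\<Omega>. ennreal (norm (v x) powr p) \<partial>lebesgue) \<le> (\<integral>\<^sup>+x. ennreal (K powr p) * indicator \<Omega> x \<partial>lebesgue)"
    using p bd by (intro nn_integral_mono) (auto simp: indicator_def intro!: ennreal_leI powr_mono2)
  also have "\<dots> < \<infinity>"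
    using dom_finite by (subst nn_integral_cmult_indicator) (auto simp: ennreal_mult_less_top)
  finally show "(\<integral>\<^sup>+x\<in>\<Omega>. ennreal (norm (v x) powr p) \<partial>lebesgue) < \<infinity>" .
qed

text \<open>Truncating at height \<open>1 / (k + 1)\<close> and mollifying at a radius at most \<open>1 / (2 (k + 1) (L + 1))\<close>
  gives test functions whose gradients converge pointwise, since near zeros of the function
  the truncation has already removed everything.\<close>
lemma lipschitz_in_W1p0:
  fixes ut u :: "'a \<Rightarrow> real" and g :: "'a \<Rightarrow> 'a"
  assumes lip: "\<And>x y. \<bar>ut x - ut y\<bar> \<le> L * norm (x - y)" and ut0: "\<And>x. x \<notin> \<Omega> \<Longrightarrow> ut x = 0"
    and Zc: "closed Z" and Z: "Z \<in> null_sets lborel"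
    and der: "\<And>x. x \<notin> Z \<Longrightarrow> (ut has_derivative (\<lambda>z. g x \<bullet> z)) (at x)"
    and cont: "\<And>x. x \<notin> Z \<Longrightarrow> isCont g x"
    and gm [measurable]: "g \<in> borel_measurable borel"
    and um [measurable]: "u \<in> borel_measurable borel" and u: "AE x in lborel. u x = ut x"
  shows "\<exists>g'. u \<in> W1p0 p \<Omega> \<and> Lp_space p \<Omega> g' \<and> is_weak_grad \<Omega> u g' \<and> g' \<in> borel_measurable borel \<and> (\<forall>x. norm (g' x) \<le> norm (g x))"
proof -
  obtain a b :: 'a where ab: "\<Omega> \<subseteq> cbox a b" using bounded_subset_cbox_symmetric[OF bounded_dom] by blast
  obtain i0 :: 'a where i0: "norm i0 = 1" by (metis norm_Basis SOME_Basis)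
  have L: "0 \<le> L" using order_trans[OF abs_ge_zero lip[of i0 0]] i0 by simp
  define \<epsilon> where "\<epsilon> = (\<lambda>k. 1 / real (Suc k))"
  \<comment> \<open>Within this radius \<open>ut\<close> varies by at most half the truncation
    height; \<open>L + 1\<close> covers the case L = 0.\<close>
  define r where "r = (\<lambda>k. \<epsilon> k / (2 * (L + 1)))"
  have e: "0 < \<epsilon> k" "\<epsilon> k \<le> 1" for k by (auto simp: \<epsilon>_def field_simps)
  have e0: "\<epsilon> \<longlonglongrightarrow> 0" unfolding \<epsilon>_def by (rule LIMSEQ_Suc[OF lim_const_over_n])
  have r: "0 < r k" "r k \<le> \<epsilon> k" "L * r k \<le> \<epsilon> k / 2" for k
    using e(1)[of k] L by (auto simp: r_def field_simps)
  have "\<forall>k. \<exists>\<eta>::'a \<Rightarrow> real. smooth_fun \<eta> \<and> (\<forall>x. 0 \<le> \<eta> x) \<and> (\<forall>x. r k \<le> norm x \<longrightarrow> \<eta> x = 0) \<and>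
    integrable lborel \<eta> \<and> (\<integral>x. \<eta> x \<partial>lborel) = 1"
    using mollifier_exists r(1) by blast
  then obtain \<eta> :: "nat \<Rightarrow> 'a \<Rightarrow> real" where \<eta>: "\<And>k. smooth_fun (\<eta> k)" "\<And>k x. 0 \<le> \<eta> k x"
    "\<And>k x. r k \<le> norm x \<Longrightarrow> \<eta> k x = 0" "\<And>k. integrable lborel (\<eta> k)" "\<And>k. (\<integral>x. \<eta> k x \<partial>lborel) = 1"
    by metis
  have utc: "continuous_on UNIV ut"
    by (rule lipschitz_on_continuous_on[of L]) (use lip L in \<open>auto intro!: lipschitz_onI simp: dist_norm\<close>)
  have [measurable]: "ut \<in> borel_measurable borel" by (intro borel_measurable_continuous_onI utc)
  define w where "w = (\<lambda>k x. soft_trunc (\<epsilon> k) (ut x))"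
  have wc: "continuous_on UNIV (w k)" for k
    unfolding w_def soft_trunc_def by (intro continuous_intros utc)
  have wc': "continuous_on UNIV (\<lambda>y. w k (x - y))" for k x
    by (rule continuous_on_compose2[OF wc]) (auto intro!: continuous_intros)
  have wlip: "\<bar>w k x - w k y\<bar> \<le> L * norm (x - y)" for k x y
    using soft_trunc_lipschitz[of "\<epsilon> k" "ut x" "ut y"] lip[of x y] e(1)[of k] by (auto simp: w_def)
  define \<phi> where "\<phi> = (\<lambda>k x. integral (cbox a b) (\<lambda>y. w k y * \<eta> k (x - y)))"
  have conv: "\<phi> k x = (\<integral>y. w k (x - y) * \<eta> k y \<partial>lborel)" for k x
    unfolding \<phi>_def
  proof (rule convolution_eq[OF wc \<eta>(1)])
    fix x assume "x \<notin> cbox a b"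
    then have "ut x = 0" using ab ut0 by blast
    then show "w k x = 0" using e(1)[of k] by (simp add: w_def soft_trunc_zero)
  qed
  have smooth: "smooth_fun (\<phi> k)" for k
    unfolding \<phi>_def by (rule smooth_fun_convolution[OF wc \<eta>(1)])
  have near_bd: "\<bar>w k (x - y) - ut x\<bar> \<le> 2 * \<epsilon> k" if "norm y < r k" for k x y
  proof -
    have "\<bar>ut (x - y) - ut x\<bar> \<le> L * norm y" using lip[of "x - y" x] by simp
    also have "\<dots> \<le> L * r k" using that L by (intro mult_left_mono) auto
    finally show ?thesis
      using r(3)[of k] soft_trunc_close[of "\<epsilon> k" "ut (x - y)"] e(1)[of k] by (simp add: w_def)
  qed
  have avg: "integrable lborel (\<lambda>y. f y * \<eta> k y)" "\<bar>(\<integral>y. f y * \<eta> k y \<partial>lborel) - c\<bar> \<le> q"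
    if "continuous_on UNIV f" "\<And>y. norm y < r k \<Longrightarrow> \<bar>f y - c\<bar> \<le> q" for f k c q
    using mollifier_average[OF that(1) \<eta>(1)[of k] \<eta>(2)[of k] \<eta>(3)[of k] \<eta>(4)[of k] \<eta>(5)[of k] that(2)] by auto
  have near: "\<bar>\<phi> k x - ut x\<bar> \<le> 2 * \<epsilon> k" for k x
    unfolding conv by (rule avg(2)[OF wc' near_bd])
  have diff: "\<bar>\<phi> k a' - \<phi> k b' - G \<bullet> (a' - b')\<bar> \<le> q * norm (a' - b')"
    if "\<And>y. norm y < r k \<Longrightarrow> \<bar>w k (a' - y) - w k (b' - y) - G \<bullet> (a' - b')\<bar> \<le> q * norm (a' - b')" for k a' b' G q
  proof -
    have "\<phi> k a' - \<phi> k b' = (\<integral>y. (w k (a' - y) - w k (b' - y)) * \<eta> k y \<partial>lborel)"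
      unfolding conv left_diff_distrib
      by (rule Bochner_Integration.integral_diff[symmetric]; rule avg(1)[OF wc' near_bd])
    then show ?thesis
      using avg(2)[where k = k and q = "q * norm (a' - b')" and f = "\<lambda>y. w k (a' - y) - w k (b' - y)" and c = "G \<bullet> (a' - b')", OF continuous_on_diff[OF wc' wc'] that] by simp
  qed
  have philip: "\<bar>\<phi> k a' - \<phi> k b'\<bar> \<le> L * norm (a' - b')" for k a' b'
  proof -
    have "\<bar>w k (a' - y) - w k (b' - y) - 0 \<bullet> (a' - b')\<bar> \<le> L * norm (a' - b')" for y
      using wlip[of k "a' - y" "b' - y"] by simp
    then show ?thesis using diff[of k a' b' 0 L] by simp
  qed
  \<comment> \<open>If |ut x| is at most half the truncation height, then the truncation vanishes on
    the whole ball seen by the mollifier. This confines the support of \<open>\<phi> k\<close> to a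
    closed set on which \<open>ut\<close> is bounded away from 0, hence inside the domain.\<close>
  have zero: "\<phi> k x = 0" if x: "\<bar>ut x\<bar> \<le> \<epsilon> k / 2" for k x
  proof -
    have "\<bar>w k (x - y) - 0\<bar> \<le> 0" if "norm y < r k" for y
    proof -
      have "\<bar>ut (x - y) - ut x\<bar> \<le> L * norm y" using lip[of "x - y" x] by simp
      also have "\<dots> \<le> L * r k" using that L by (intro mult_left_mono) auto
      finally have "\<bar>ut (x - y)\<bar> \<le> \<epsilon> k" using x r(3)[of k] by linarith
      then show ?thesis by (simp add: w_def soft_trunc_zero)
    qed
    then have "\<bar>\<phi> k x - 0\<bar> \<le> 0" unfolding conv by (rule avg(2)[OF wc'])
    then show ?thesis by simp
  qed
  have test: "test_fun \<Omega> (\<phi> k)" for k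
  proof -
    let ?C = "{x. \<epsilon> k / 2 \<le> \<bar>ut x\<bar>}"
    have C: "closed ?C" by (intro closed_Collect_le continuous_intros utc)
    have sub: "closure {x. \<phi> k x \<noteq> 0} \<subseteq> ?C"
    proof (rule closure_minimal[OF _ C], rule subsetI)
      fix x assume "x \<in> {x. \<phi> k x \<noteq> 0}"
      then show "x \<in> ?C" using zero[of x k] by force
    qed
    have "?C \<subseteq> \<Omega>" using ut0 e(1)[of k] by force
    then show ?thesis
      unfolding test_fun_def using smooth sub bounded_dom
      by (auto simp: compact_eq_bounded_closed intro: bounded_subset)
  qed
  have cb: "norm (cgrad (\<phi> k) x) \<le> L" for k x
    using gradient_close[OF smooth_fun_derivative[OF smooth], where G = 0 and s = 1 and e = L] philip by simp
  have gb: "norm (g x) \<le> L" if "x \<notin> Z" for x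
    using gradient_close[OF der[OF that], where G = 0 and s = 1 and e = L] lip by simp
  \<comment> \<open>At a zero of \<open>ut\<close> each \<open>\<phi> k\<close> vanishes in a
    neighbourhood, so the gradients of the approximations converge to 0 there and not evidently to
    \<open>g\<close>. Cutting off \<open>g\<close> on the zero set gives the true limit, and the
    norm only decreases.\<close>
  define g' where "g' = (\<lambda>x. indicator (- Z \<inter> {x. ut x \<noteq> 0}) x *\<^sub>R g x)"
  have Zm [measurable]: "Z \<in> sets borel" using Zc by auto
  have [measurable]: "{x. ut x \<noteq> 0} \<in> sets borel" by measurable
  have g'm [measurable]: "g' \<in> borel_measurable borel" unfolding g'_def by measurable
  have g'g: "norm (g' x) \<le> norm (g x)" for x by (simp add: g'_def indicator_def)
  have g'L: "norm (g' x) \<le> L" for x using gb[of x] L by (simp add: g'_def indicator_def)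
  have cconv: "(\<lambda>k. cgrad (\<phi> k) x) \<longlonglongrightarrow> g' x" if x: "x \<notin> Z" for x
  proof (cases "ut x = 0")
    case True
    have "norm (cgrad (\<phi> k) x - 0) \<le> 0" for k
    proof (rule gradient_close[OF smooth_fun_derivative[OF smooth] r(1)[of k]])
      fix c assume c: "c \<in> ball x (r k)"
      have "\<bar>ut c\<bar> \<le> L * norm (c - x)" using lip[of c x] True by simp
      also have "\<dots> \<le> L * r k" using c L by (intro mult_left_mono) (auto simp: dist_norm norm_minus_commute)
      finally have "\<phi> k c = 0" using r(3)[of k] by (intro zero) simp
      moreover have "\<phi> k x = 0" using True e(1)[of k] by (intro zero) simp
      ultimately show "\<bar>\<phi> k c - \<phi> k x - 0 \<bullet> (c - x)\<bar> \<le> 0 * norm (c - x)" by simp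
    qed
    then have "cgrad (\<phi> k) x = 0" for k by simp
    then show ?thesis using True by (simp add: g'_def)
  next
    case False
    show ?thesis
    proof (rule LIMSEQ_I)
      fix q :: real assume q: "0 < q"
      obtain d1 where d1: "0 < d1" "ball x d1 \<subseteq> - Z" using Zc x open_contains_ball[of "- Z"] by auto
      obtain d2 where d2: "0 < d2" "\<And>y. dist y x < d2 \<Longrightarrow> dist (g y) (g x) < q / 2"
        using cont[OF x] q unfolding continuous_at_eps_delta by (metis half_gt_zero)
      \<comment> \<open>On the ball of this radius three things hold: it avoids \<open>Z\<close>,
        \<open>g\<close> stays within q/2 of \<open>g x\<close>, and |ut| stays above half of |ut
        x|, so that the truncation acts there as a constant shift.\<close>
      define s where "s = min (min d1 d2) (\<bar>ut x\<bar> / (2 * (L + 1)))"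
      have s: "0 < s" using d1 d2 False L by (simp add: s_def)
      have Ls: "L * s \<le> \<bar>ut x\<bar> / 2"
      proof -
        have "L * s \<le> (L + 1) * (\<bar>ut x\<bar> / (2 * (L + 1)))" using L s by (intro mult_mono) (auto simp: s_def)
        also have "\<dots> = \<bar>ut x\<bar> / 2" using L by (simp add: field_simps)
        finally show ?thesis .
      qed
      have uy: "\<bar>ut y - ut x\<bar> \<le> \<bar>ut x\<bar> / 2" if "y \<in> ball x s" for y
      proof -
        have "\<bar>ut y - ut x\<bar> \<le> L * norm (y - x)" by (rule lip)
        also have "\<dots> \<le> L * s" using that L by (intro mult_left_mono) (auto simp: dist_norm norm_minus_commute)
        finally show ?thesis using Ls by simp
      qed
      obtain N where N: "\<And>k. N \<le> k \<Longrightarrow> \<epsilon> k < min (\<bar>ut x\<bar> / 2) (s / 2)"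
        using order_tendstoD(2)[OF e0, of "min (\<bar>ut x\<bar> / 2) (s / 2)"] False s by (auto simp: eventually_sequentially)
      have "norm (cgrad (\<phi> k) x - g' x) < q" if k: "N \<le> k" for k
      proof -
        have "norm (cgrad (\<phi> k) x - g x) \<le> q / 2"
        proof (rule gradient_close[OF smooth_fun_derivative[OF smooth], where s = "s / 2"])
          fix c assume c: "c \<in> ball x (s / 2)"
          show "\<bar>\<phi> k c - \<phi> k x - g x \<bullet> (c - x)\<bar> \<le> q / 2 * norm (c - x)"
          proof (rule diff)
            fix y :: 'a assume y: "norm y < r k"
            then have ys: "norm y < s / 2" using r(2)[of k] N[OF k] by simp
            have "dist x (c - y) \<le> dist x c + norm y" using norm_triangle_ineq[of "x - c" y] by (simp add: dist_norm algebra_simps)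
            then have cy: "c - y \<in> ball x s" using c ys by simp
            have xy: "x - y \<in> ball x s" using ys s by (simp add: dist_norm)
            have sgn: "0 \<le> ut (c - y) * ut (x - y)" "\<epsilon> k \<le> \<bar>ut (c - y)\<bar>" "\<epsilon> k \<le> \<bar>ut (x - y)\<bar>"
              using uy[OF cy] uy[OF xy] N[OF k] by (auto simp: zero_le_mult_iff abs_if split: if_splits)
            then have "w k (c - y) - w k (x - y) = ut (c - y) - ut (x - y)"
              using e(1)[of k] unfolding w_def by (intro soft_trunc_diff) auto
            moreover have "\<bar>ut (c - y) - ut (x - y) - g x \<bullet> ((c - y) - (x - y))\<bar> \<le> q / 2 * norm ((c - y) - (x - y))"
            proof (rule lipschitz_near[OF _ _ cy xy])
              fix z assume z: "z \<in> ball x s"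
              show "(ut has_derivative (\<lambda>v. g z \<bullet> v)) (at z)"
                using z d1 by (intro der) (auto simp: s_def)
              show "norm (g z - g x) \<le> q / 2"
                using z d2(2)[of z] by (auto simp: s_def dist_norm norm_minus_commute)
            qed
            ultimately show "\<bar>w k (c - y) - w k (x - y) - g x \<bullet> (c - x)\<bar> \<le> q / 2 * norm (c - x)" by simp
          qed
        qed (use s in simp)
        then show ?thesis using False x q by (simp add: g'_def)
      qed
      then show "\<exists>N. \<forall>k\<ge>N. norm (cgrad (\<phi> k) x - g' x) < q" by blast
    qed
  qed
  have phim [measurable]: "\<phi> k \<in> borel_measurable borel" "cgrad (\<phi> k) \<in> borel_measurable borel" for k
    using test_fun_measurable[OF test[of k]] by auto
  have fconv: "(\<lambda>k. \<phi> k x) \<longlonglongrightarrow> ut x" for x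
  proof (rule LIM_zero_cancel, rule Lim_null_comparison)
    show "\<forall>\<^sub>F k in sequentially. norm (\<phi> k x - ut x) \<le> 2 * \<epsilon> k" using near by simp
    show "(\<lambda>k. 2 * \<epsilon> k) \<longlonglongrightarrow> 0" using tendsto_mult_right_zero[OF e0] by simp
  qed
  have AEZ: "AE x in lborel. x \<notin> Z" by (rule AE_not_in[OF Z])
  obtain K where K: "\<And>x. \<bar>ut x\<bar> \<le> K" "0 \<le> K"
  proof -
    have "bounded (ut ` cbox a b)"
      by (intro compact_imp_bounded compact_continuous_image continuous_on_subset[OF utc] compact_cbox) auto
    then obtain K where K: "\<And>x. x \<in> cbox a b \<Longrightarrow> \<bar>ut x\<bar> \<le> K" by (auto simp: bounded_iff)
    have "\<bar>ut x\<bar> \<le> max K 0" for x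
      using K[of x] ut0[of x] ab by (cases "x \<in> \<Omega>") auto
    then show ?thesis using that[of "max K 0"] by simp
  qed
  \<comment> \<open>Integration by parts holds for the test functions \<open>\<phi> k\<close>; both
    sides pass to the limit by dominated convergence.\<close>
  have W: "is_weak_grad \<Omega> u g'"
    unfolding is_weak_grad_def
  proof (intro allI impI ballI)
    fix \<psi> and i :: 'a assume psi: "test_fun \<Omega> \<psi>" and i: "i \<in> Basis"
    obtain B where B: "0 \<le> B" "\<And>x. \<bar>\<psi> x\<bar> \<le> B" "\<And>x. norm (cgrad \<psi> x) \<le> B" using test_fun_bounded[OF psi] by blast
    note [measurable] = test_fun_measurable[OF psi]
    have comp: "\<bar>v \<bullet> i\<bar> \<le> norm v" for v :: 'a using Basis_le_norm[OF i] .
    have indint: "integrable lborel (\<lambda>x::'a. c * indicator \<Omega> x)" for c :: real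
      using dom_finite by (intro integrable_mult_right integrable_real_indicator) auto
    have A: "(\<lambda>k. \<integral>x. \<phi> k x * (cgrad \<psi> x \<bullet> i) \<partial>lborel) \<longlonglongrightarrow> (\<integral>x. ut x * (cgrad \<psi> x \<bullet> i) \<partial>lborel)"
    proof (rule integral_dominated_convergence[where w = "\<lambda>x. ((K + 2) * B) * indicator \<Omega> x"])
      show "AE x in lborel. (\<lambda>k. \<phi> k x * (cgrad \<psi> x \<bullet> i)) \<longlonglongrightarrow> ut x * (cgrad \<psi> x \<bullet> i)"
        by (intro AE_I2 tendsto_intros fconv)
      have "norm (\<phi> k x * (cgrad \<psi> x \<bullet> i)) \<le> ((K + 2) * B) * indicator \<Omega> x" for k x
      proof (cases "x \<in> \<Omega>")
        case True
        have "\<bar>\<phi> k x\<bar> \<le> K + 2" using near[of k x] K(1)[of x] e(2)[of k] by linarith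
        then have "\<bar>\<phi> k x\<bar> * \<bar>cgrad \<psi> x \<bullet> i\<bar> \<le> (K + 2) * B"
          using B(3)[of x] comp[of "cgrad \<psi> x"] K(2) by (intro mult_mono) auto
        then show ?thesis using True by (simp add: abs_mult)
      qed (simp add: test_fun_zero[OF test])
      then show "AE x in lborel. norm (\<phi> k x * (cgrad \<psi> x \<bullet> i)) \<le> ((K + 2) * B) * indicator \<Omega> x" for k by simp
    qed (use indint in auto)
    have D: "(\<lambda>k. \<integral>x. (cgrad (\<phi> k) x \<bullet> i) * \<psi> x \<partial>lborel) \<longlonglongrightarrow> (\<integral>x. (g' x \<bullet> i) * \<psi> x \<partial>lborel)"
    proof (rule integral_dominated_convergence[where w = "\<lambda>x. (L * B) * indicator \<Omega> x"])
      show "AE x in lborel. (\<lambda>k. (cgrad (\<phi> k) x \<bullet> i) * \<psi> x) \<longlonglongrightarrow> (g' x \<bullet> i) * \<psi> x"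
        using AEZ by eventually_elim (intro tendsto_intros cconv)
      have "norm ((cgrad (\<phi> k) x \<bullet> i) * \<psi> x) \<le> (L * B) * indicator \<Omega> x" for k x
      proof (cases "x \<in> \<Omega>")
        case True
        have "\<bar>cgrad (\<phi> k) x \<bullet> i\<bar> * \<bar>\<psi> x\<bar> \<le> L * B"
          using B(2)[of x] comp[of "cgrad (\<phi> k) x"] cb[of k x] L by (intro mult_mono) auto
        then show ?thesis using True by (simp add: abs_mult)
      qed (simp add: test_fun_zero[OF psi])
      then show "AE x in lborel. norm ((cgrad (\<phi> k) x \<bullet> i) * \<psi> x) \<le> (L * B) * indicator \<Omega> x" for k by simp
    qed (use indint in auto)
    have "(\<integral>x. ut x * (cgrad \<psi> x \<bullet> i) \<partial>lborel) = - (\<integral>x. (g' x \<bullet> i) * \<psi> x \<partial>lborel)"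
      using A tendsto_minus[OF D] integration_by_parts_test[OF test psi i] by (simp add: LIMSEQ_unique)
    moreover have "(LINT x:\<Omega>|lebesgue. u x * frechet_derivative \<psi> (at x) i) = (\<integral>x. ut x * (cgrad \<psi> x \<bullet> i) \<partial>lborel)"
    proof -
      have "(LINT x:\<Omega>|lebesgue. u x * frechet_derivative \<psi> (at x) i) = (\<integral>x. indicator \<Omega> x *\<^sub>R (u x * (cgrad \<psi> x \<bullet> i)) \<partial>lebesgue)"
        by (simp add: set_lebesgue_integral_def cgrad_inner[OF i])
      also have "\<dots> = (\<integral>x. indicator \<Omega> x *\<^sub>R (u x * (cgrad \<psi> x \<bullet> i)) \<partial>lborel)"
        by (rule integral_completion) measurable
      also have "\<dots> = (\<integral>x. ut x * (cgrad \<psi> x \<bullet> i) \<partial>lborel)"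
        by (rule integral_cong_AE) (use u in \<open>auto elim!: eventually_mono simp: indicator_def ut0\<close>)
      finally show ?thesis .
    qed
    moreover have "(LINT x:\<Omega>|lebesgue. (g' x \<bullet> i) * \<psi> x) = (\<integral>x. (g' x \<bullet> i) * \<psi> x \<partial>lborel)"
    proof -
      have "(LINT x:\<Omega>|lebesgue. (g' x \<bullet> i) * \<psi> x) = (\<integral>x. (g' x \<bullet> i) * \<psi> x \<partial>lebesgue)"
        unfolding set_lebesgue_integral_def
        by (rule Bochner_Integration.integral_cong) (auto simp: indicator_def test_fun_zero[OF psi])
      also have "\<dots> = (\<integral>x. (g' x \<bullet> i) * \<psi> x \<partial>lborel)"
        by (rule integral_completion) measurable
      finally show ?thesis .
    qed
    ultimately show "(LINT x:\<Omega>|lebesgue. u x * frechet_derivative \<psi> (at x) i) = - (LINT x:\<Omega>|lebesgue. (g' x \<bullet> i) * \<psi> x)"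
      by simp
  qed
  have uL: "AE x in lebesgue. u x = ut x" using u by (rule AE_completion)
  have Lg: "Lp_space p \<Omega> g'" by (rule Lp_space_bounded[OF measurable_completion g'L]) simp
  have Lu: "Lp_space p \<Omega> u"
  proof -
    have "(\<integral>\<^sup>+x\<in>\<Omega>. ennreal (norm (u x) powr p) \<partial>lebesgue) = (\<integral>\<^sup>+x\<in>\<Omega>. ennreal (norm (ut x) powr p) \<partial>lebesgue)"
      using uL by (intro nn_integral_cong_AE) (auto elim!: eventually_mono)
    moreover have "Lp_space p \<Omega> ut" by (rule Lp_space_bounded[OF measurable_completion]) (use K in auto)
    moreover have "(\<lambda>x. indicator \<Omega> x *\<^sub>R u x) \<in> borel_measurable lebesgue" by (rule measurable_completion) measurable
    ultimately show ?thesis by (simp add: Lp_space_def)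
  qed
  have "(\<lambda>k. Lp_norm p \<Omega> (\<lambda>x. \<phi> k x - u x)) \<longlonglongrightarrow> 0"
  proof (rule Lp_norm_tendsto_0I[where K = 2])
    show "(\<lambda>x. \<phi> k x - u x) \<in> borel_measurable lebesgue" for k by (rule measurable_completion) measurable
    show "AE x in lebesgue. norm (\<phi> k x - u x) \<le> 2" for k
      using uL
    proof eventually_elim
      case (elim x)
      then show ?case using near[of k x] e(2)[of k] by simp
    qed
    show "AE x in lebesgue. (\<lambda>k. \<phi> k x - u x) \<longlonglongrightarrow> 0"
      using uL by eventually_elim (use fconv LIM_zero in fastforce)
  qed
  moreover have "(\<lambda>k. Lp_norm p \<Omega> (\<lambda>x. cgrad (\<phi> k) x - g' x)) \<longlonglongrightarrow> 0"
  proof (rule Lp_norm_tendsto_0I[where K = "2 * L"])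
    show "(\<lambda>x. cgrad (\<phi> k) x - g' x) \<in> borel_measurable lebesgue" for k by (rule measurable_completion) measurable
    have "norm (cgrad (\<phi> k) x - g' x) \<le> 2 * L" for k x
      using norm_triangle_ineq4[of "cgrad (\<phi> k) x" "g' x"] cb[of k x] g'L[of x] by simp
    then show "AE x in lebesgue. norm (cgrad (\<phi> k) x - g' x) \<le> 2 * L" for k by simp
    show "AE x in lebesgue. (\<lambda>k. cgrad (\<phi> k) x - g' x) \<longlonglongrightarrow> 0"
      using AE_completion[OF AEZ] by eventually_elim (use cconv LIM_zero in blast)
  qed
  ultimately have "(\<lambda>k. Lp_norm p \<Omega> (\<lambda>x. \<phi> k x - u x) + Lp_norm p \<Omega> (\<lambda>x. cgrad (\<phi> k) x - g' x)) \<longlonglongrightarrow> 0 + 0"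
    by (rule tendsto_add)
  then have "u \<in> W1p0 p \<Omega>"
    unfolding W1p0_def W1p_def using Lu Lg W test by auto
  then show ?thesis using Lg W g'g g'm by blast
qed

end

section \<open>Finite-dimensional compactness and polynomials\<close>

lemma bounded_family_convergent_subseq:
  fixes c :: "nat \<Rightarrow> 'i \<Rightarrow> real"
  assumes "finite I" "\<And>i. i \<in> I \<Longrightarrow> bounded (range (\<lambda>n. c n i))"
  shows "\<exists>r d. strict_mono (r::nat \<Rightarrow> nat) \<and> (\<forall>i\<in>I. (\<lambda>n. c (r n) i) \<longlonglongrightarrow> d i)"
  using assms
proof (induction I rule: finite_induct)
  case empty
  show ?case by (intro exI[of _ id]) (auto simp: strict_mono_def)
next
  case (insert j I)
  then obtain r d where r: "strict_mono (r::nat \<Rightarrow> nat)" "\<And>i. i \<in> I \<Longrightarrow> (\<lambda>n. c (r n) i) \<longlonglongrightarrow> d i" by auto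
  have "bounded (range (\<lambda>n. c (r n) j))"
    by (rule bounded_subset[OF insert.prems[of j]]) auto
  then obtain l s where s: "strict_mono s" "((\<lambda>n. c (r n) j) \<circ> s) \<longlonglongrightarrow> l"
    using bounded_imp_convergent_subsequence by blast
  have "(\<lambda>n. c ((r \<circ> s) n) i) \<longlonglongrightarrow> (d(j := l)) i" if "i \<in> insert j I" for i
    using that s(2) LIMSEQ_subseq_LIMSEQ[OF r(2) s(1), of i] insert.hyps by (cases "i = j") (auto simp: o_def)
  then show ?case using strict_mono_o[OF r(1) s(1)] by blast
qed

text \<open>Bounded sequences in a finite-dimensional function space: if the coefficients do not stay
  bounded, the normalised limit exhibits a linear relation, which eliminates one of the generators.\<close>
lemma finite_dim_compactness:
  fixes f :: "'i \<Rightarrow> 'x \<Rightarrow> real" and N :: "('x \<Rightarrow> real) \<Rightarrow> ennreal" and q :: real and v :: "nat \<Rightarrow> 'x \<Rightarrow> real"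
  assumes fin: "finite I" and q: "0 < q"
    and hom: "\<And>a n. N (\<lambda>x. a * v n x) = ennreal (\<bar>a\<bar> powr q) * N (v n)"
    and key: "\<And>cn c. (\<And>i. i \<in> I \<Longrightarrow> (\<lambda>n. cn n i) \<longlonglongrightarrow> c i) \<Longrightarrow>
        (\<lambda>n::nat. N (\<lambda>x. \<Sum>i\<in>I. cn n i * f i x)) \<longlonglongrightarrow> 0 \<Longrightarrow> (\<And>x. (\<Sum>i\<in>I. c i * f i x) = 0)"
    and v: "\<And>n x. v n x = (\<Sum>i\<in>I. cn n i * f i x)" and bd: "\<And>n. N (v n) \<le> ennreal K"
  shows "\<exists>r c' c. strict_mono (r::nat \<Rightarrow> nat) \<and> (\<forall>k x. v (r k) x = (\<Sum>i\<in>I. c' k i * f i x)) \<and>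
      (\<forall>i\<in>I. (\<lambda>k. c' k i) \<longlonglongrightarrow> c i)"
  using fin key v
proof (induction "card I" arbitrary: I cn rule: less_induct)
  case less
  define S where "S = (\<lambda>n. \<Sum>i\<in>I. \<bar>cn n i\<bar>)"
  have S: "\<bar>cn n i\<bar> \<le> S n" if "i \<in> I" for n i
    unfolding S_def using less.prems(1) that by (intro member_le_sum) auto
  show ?case
  proof (cases "\<exists>B. \<forall>n. S n \<le> B")
    case True
    then obtain B where B: "\<And>n. S n \<le> B" by blast
    have "bounded (range (\<lambda>n. cn n i))" if "i \<in> I" for i
      using S[OF that] B by (auto simp: bounded_iff intro!: exI[of _ B] intro: order_trans)
    then obtain r d where "strict_mono (r::nat \<Rightarrow> nat)" "\<forall>i\<in>I. (\<lambda>n. cn (r n) i) \<longlonglongrightarrow> d i"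
      using bounded_family_convergent_subseq[OF less.prems(1), of cn] by blast
    then show ?thesis using less.prems(3) by (intro exI[of _ r] exI[of _ "\<lambda>k. cn (r k)"] exI[of _ d]) auto
  next
    case False
    then have "\<forall>k::nat. \<exists>n. real (Suc k) < S n" by (meson not_le)
    \<comment> \<open>\<open>m\<close> need not be increasing: only the normalised coefficients and
      their limit are used, to produce a linear relation.\<close>
    then obtain m where m: "\<And>k. real (Suc k) < S (m k)" by metis
    define d where "d = (\<lambda>k i. cn (m k) i / S (m k))"
    have pos: "0 < S (m k)" for k using m[of k] by (simp add: order.strict_trans[rotated])
    have dle: "\<bar>d k i\<bar> \<le> 1" if "i \<in> I" for k i
      using S[OF that, of "m k"] pos[of k] by (simp add: d_def divide_le_eq abs_divide)
    have dsum: "(\<Sum>i\<in>I. \<bar>d k i\<bar>) = 1" for k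
      using pos[of k] by (simp add: d_def abs_divide sum_divide_distrib[symmetric] S_def)
    have "bounded (range (\<lambda>n. d n i))" if "i \<in> I" for i
      using dle[OF that] by (auto simp: bounded_iff)
    then obtain r d' where r: "strict_mono (r::nat \<Rightarrow> nat)" "\<And>i. i \<in> I \<Longrightarrow> (\<lambda>n. d (r n) i) \<longlonglongrightarrow> d' i"
      using bounded_family_convergent_subseq[OF less.prems(1), of d] by blast
    have "(\<lambda>n. \<Sum>i\<in>I. \<bar>d (r n) i\<bar>) \<longlonglongrightarrow> (\<Sum>i\<in>I. \<bar>d' i\<bar>)"
      by (intro tendsto_intros r)
    then have "(\<Sum>i\<in>I. \<bar>d' i\<bar>) = 1" by (simp add: dsum LIMSEQ_const_iff)
    \<comment> \<open>The normalised coefficients have absolute sum one, and so does their limit;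
      hence one limit coefficient is nonzero.\<close>
    then obtain j where j: "j \<in> I" "d' j \<noteq> 0" by (metis abs_zero sum.neutral zero_neq_one)
    \<comment> \<open>\<open>N\<close> is homogeneous and bounded along \<open>v\<close>, so
      dividing by coefficient sums that tend to infinity sends it to 0.\<close>
    have "(\<lambda>n. N (\<lambda>x. \<Sum>i\<in>I. d (r n) i * f i x)) \<longlonglongrightarrow> 0"
    proof (rule tendsto_sandwich[OF _ _ tendsto_const])
      show "\<forall>\<^sub>F n in sequentially. N (\<lambda>x. \<Sum>i\<in>I. d (r n) i * f i x) \<le> ennreal (real (Suc n) powr (- q)) * ennreal K"
      proof (intro always_eventually allI)
        fix n
        let ?s = "S (m (r n))"
        have "(\<lambda>x. \<Sum>i\<in>I. d (r n) i * f i x) = (\<lambda>x. (1 / ?s) * v (m (r n)) x)"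
          by (simp add: d_def less.prems(3) sum_divide_distrib)
        then have "N (\<lambda>x. \<Sum>i\<in>I. d (r n) i * f i x) = N (\<lambda>x. (1 / ?s) * v (m (r n)) x)"
          by (rule arg_cong)
        also have "\<dots> = ennreal (\<bar>1 / ?s\<bar> powr q) * N (v (m (r n)))" by (rule hom)
        also have "\<dots> \<le> ennreal (real (Suc n) powr (- q)) * ennreal K"
        proof (intro mult_mono bd ennreal_leI)
          have "real (Suc n) \<le> real (Suc (r n))" using seq_suble[OF r(1), of n] by simp
          then have le: "real (Suc n) \<le> ?s" using m[of "r n"] by linarith
          have "\<bar>1 / ?s\<bar> powr q = ?s powr (- q)" using pos[of "r n"] by (simp add: powr_divide powr_minus_divide)
          also have "\<dots> \<le> real (Suc n) powr (- q)" using le q by (intro powr_mono2') auto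
          finally show "\<bar>1 / ?s\<bar> powr q \<le> real (Suc n) powr (- q)" .
        qed auto
        finally show "N (\<lambda>x. \<Sum>i\<in>I. d (r n) i * f i x) \<le> ennreal (real (Suc n) powr (- q)) * ennreal K" .
      qed
      have "((\<lambda>x. x powr (- q)) \<longlongrightarrow> 0) at_top" using q by (intro tendsto_neg_powr filterlim_ident) simp
      then have "(\<lambda>n. real (Suc n) powr (- q)) \<longlonglongrightarrow> 0"
        by (rule filterlim_compose) (rule filterlim_compose[OF filterlim_real_sequentially filterlim_Suc])
      then have "(\<lambda>n. ennreal K * ennreal (real (Suc n) powr (- q))) \<longlonglongrightarrow> ennreal K * ennreal 0"
        by (intro ennreal_tendsto_cmult tendsto_ennrealI) auto
      then show "(\<lambda>n. ennreal (real (Suc n) powr (- q)) * ennreal K) \<longlonglongrightarrow> 0" by (simp add: mult.commute)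
    qed auto
    then have rel: "(\<Sum>i\<in>I. d' i * f i x) = 0" for x
      using less.prems(2)[of "\<lambda>n. d (r n)" d'] r(2) by blast
    have fj: "f j x = - (\<Sum>i\<in>I - {j}. (d' i / d' j) * f i x)" for x
    proof -
      have "d' j * f j x = - (\<Sum>i\<in>I - {j}. d' i * f i x)"
        using rel[of x] sum.remove[OF less.prems(1) j(1), of "\<lambda>i. d' i * f i x"] by simp
      then have "f j x = - (\<Sum>i\<in>I - {j}. d' i * f i x) / d' j" using j(2) by (simp add: field_simps)
      then show ?thesis by (simp add: sum_divide_distrib)
    qed
    define e where "e = (\<lambda>n i. cn n i - cn n j * (d' i / d' j))"
    have ve: "v n x = (\<Sum>i\<in>I - {j}. e n i * f i x)" for n x
    proof -
      have "v n x = cn n j * f j x + (\<Sum>i\<in>I - {j}. cn n i * f i x)"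
        unfolding less.prems(3) by (rule sum.remove[OF less.prems(1) j(1)])
      also have "\<dots> = (\<Sum>i\<in>I - {j}. e n i * f i x)"
        by (subst fj) (simp add: e_def sum_distrib_left sum_subtractf[symmetric] algebra_simps sum.distrib[symmetric])
      finally show ?thesis .
    qed
    \<comment> \<open>Coefficients over the smaller index set are padded by 0 at \<open>j\<close>,
      so that the hypotheses on \<open>I\<close> carry over to the induction step and its result
      back to \<open>I\<close>.\<close>
    have ext: "(\<Sum>i\<in>I. (if i = j then 0 else c i) * f i x) = (\<Sum>i\<in>I - {j}. c i * f i x)" for c x
      using sum.remove[OF less.prems(1) j(1), of "\<lambda>i. (if i = j then 0 else c i) * f i x"] by simp
    have "\<exists>r c' c. strict_mono (r::nat \<Rightarrow> nat) \<and> (\<forall>k x. v (r k) x = (\<Sum>i\<in>I - {j}. c' k i * f i x)) \<and>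
      (\<forall>i\<in>I - {j}. (\<lambda>k. c' k i) \<longlonglongrightarrow> c i)"
    proof (rule less.hyps)
      show "card (I - {j}) < card I" using less.prems(1) j(1) by (rule card_Diff1_less)
      show "finite (I - {j})" using less.prems(1) by simp
      show "v n x = (\<Sum>i\<in>I - {j}. e n i * f i x)" for n x by (rule ve)
      fix cn' :: "nat \<Rightarrow> 'i \<Rightarrow> real" and c x
      assume a: "\<And>i. i \<in> I - {j} \<Longrightarrow> (\<lambda>n. cn' n i) \<longlonglongrightarrow> c i"
        "(\<lambda>n. N (\<lambda>x. \<Sum>i\<in>I - {j}. cn' n i * f i x)) \<longlonglongrightarrow> 0"
      have "(\<Sum>i\<in>I. (if i = j then 0 else c i) * f i x) = 0"
      proof (rule less.prems(2)[of "\<lambda>n i. if i = j then 0 else cn' n i"])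
        show "(\<lambda>n. if i = j then 0 else cn' n i) \<longlonglongrightarrow> (if i = j then 0 else c i)" if "i \<in> I" for i
          using a(1)[of i] that by (cases "i = j") auto
        show "(\<lambda>n. N (\<lambda>x. \<Sum>i\<in>I. (if i = j then 0 else cn' n i) * f i x)) \<longlonglongrightarrow> 0"
          unfolding ext by (rule a(2))
      qed
      then show "(\<Sum>i\<in>I - {j}. c i * f i x) = 0" unfolding ext .
    qed
    then obtain s c' c where s: "strict_mono (s::nat \<Rightarrow> nat)" "\<And>k x. v (s k) x = (\<Sum>i\<in>I - {j}. c' k i * f i x)"
      "\<And>i. i \<in> I - {j} \<Longrightarrow> (\<lambda>k. c' k i) \<longlonglongrightarrow> c i" by blast
    show ?thesis
    proof (intro exI conjI ballI allI)
      show "strict_mono s" by (rule s)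
      show "v (s k) x = (\<Sum>i\<in>I. (if i = j then 0 else c' k i) * f i x)" for k x
        unfolding ext by (rule s)
      show "(\<lambda>k. if i = j then 0 else c' k i) \<longlonglongrightarrow> (if i = j then 0 else c i)" if "i \<in> I" for i
        using s(3)[of i] that by (cases "i = j") auto
    qed
  qed
qed

text \<open>Vanishing off \<open>Basis\<close> makes this a finite set of functions;
  \<open>poly_deg_le\<close> leaves exponents outside the basis arbitrary.\<close>

definition multi_indices :: "nat \<Rightarrow> ('a::euclidean_space \<Rightarrow> nat) set" where
  "multi_indices N = {\<alpha>. (\<forall>x. x \<notin> Basis \<longrightarrow> \<alpha> x = 0) \<and> (\<Sum>b\<in>Basis. \<alpha> b) \<le> N}"

definition monomial :: "('a::euclidean_space \<Rightarrow> nat) \<Rightarrow> 'a \<Rightarrow> real" where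
  "monomial \<alpha> x = (\<Prod>b\<in>Basis. (x \<bullet> b) ^ \<alpha> b)"

lemma finite_multi_indices: "finite (multi_indices N :: ('a::euclidean_space \<Rightarrow> nat) set)"
proof (rule finite_subset)
  show "multi_indices N \<subseteq> {\<alpha>::'a \<Rightarrow> nat. \<forall>x. (x \<in> Basis \<longrightarrow> \<alpha> x \<in> {..N}) \<and> (x \<notin> Basis \<longrightarrow> \<alpha> x = 0)}"
  proof (intro subsetI CollectI allI conjI impI)
    fix \<alpha> :: "'a \<Rightarrow> nat" and x :: 'a
    assume a: "\<alpha> \<in> multi_indices N"
    show "\<alpha> x \<in> {..N}" if "x \<in> Basis"
      using a member_le_sum[OF that, of \<alpha>] by (simp add: multi_indices_def)
    show "\<alpha> x = 0" if "x \<notin> Basis" using a that by (simp add: multi_indices_def)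
  qed
  show "finite {\<alpha>::'a \<Rightarrow> nat. \<forall>x. (x \<in> Basis \<longrightarrow> \<alpha> x \<in> {..N}) \<and> (x \<notin> Basis \<longrightarrow> \<alpha> x = 0)}"
    by (rule finite_set_of_finite_funs) auto
qed

text \<open>A common index set gives all polynomials of bounded degree the same finite list of
  coefficients, as the compactness argument requires.\<close>

lemma poly_deg_le_iff:
  "poly_deg_le N q \<longleftrightarrow> (\<exists>c. \<forall>x. q x = (\<Sum>\<alpha>\<in>multi_indices N. c \<alpha> * monomial \<alpha> x))"
proof
  assume "poly_deg_le N q"
  then obtain A c where A: "finite A" "\<forall>\<alpha>\<in>A. (\<Sum>b\<in>Basis. \<alpha> b) \<le> N"
    "\<And>x. q x = (\<Sum>\<alpha>\<in>A. c \<alpha> * monomial \<alpha> x)"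
    by (auto simp: poly_deg_le_def monomial_def)
  \<comment> \<open>Normalising exponents off the basis may identify several indices of
    \<open>A\<close>, so their coefficients are summed over the fibres.\<close>
  define R where "R = (\<lambda>(\<alpha>::'a \<Rightarrow> nat) b. if b \<in> Basis then \<alpha> b else 0)"
  have R: "monomial (R \<alpha>) = monomial \<alpha>" for \<alpha> by (auto simp: monomial_def R_def fun_eq_iff)
  have sub: "R ` A \<subseteq> multi_indices N" using A(2) by (auto simp: multi_indices_def R_def)
  have "q x = (\<Sum>\<beta>\<in>multi_indices N. (\<Sum>\<alpha>\<in>{\<alpha>\<in>A. R \<alpha> = \<beta>}. c \<alpha>) * monomial \<beta> x)" for x
  proof -
    have "q x = (\<Sum>\<beta>\<in>multi_indices N. \<Sum>\<alpha>\<in>{\<alpha>\<in>A. R \<alpha> = \<beta>}. c \<alpha> * monomial \<alpha> x)"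
      unfolding A(3) by (rule sum.group[OF A(1) finite_multi_indices sub, symmetric])
    also have "\<dots> = (\<Sum>\<beta>\<in>multi_indices N. (\<Sum>\<alpha>\<in>{\<alpha>\<in>A. R \<alpha> = \<beta>}. c \<alpha>) * monomial \<beta> x)"
      unfolding sum_distrib_right by (intro sum.cong refl) (auto simp: R)
    finally show ?thesis .
  qed
  then show "\<exists>c. \<forall>x. q x = (\<Sum>\<alpha>\<in>multi_indices N. c \<alpha> * monomial \<alpha> x)"
    by (intro exI[of _ "\<lambda>\<beta>. \<Sum>\<alpha>\<in>{\<alpha>\<in>A. R \<alpha> = \<beta>}. c \<alpha>"] allI)
next
  assume "\<exists>c. \<forall>x. q x = (\<Sum>\<alpha>\<in>multi_indices N. c \<alpha> * monomial \<alpha> x)"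
  then obtain c where "\<forall>x. q x = (\<Sum>\<alpha>\<in>multi_indices N. c \<alpha> * monomial \<alpha> x)" by blast
  then show "poly_deg_le N q"
    unfolding poly_deg_le_def monomial_def
    by (intro exI[of _ "multi_indices N"] exI[of _ c]) (simp add: finite_multi_indices, simp add: multi_indices_def)
qed

lemma monomial_polynomial: "real_polynomial_function (monomial \<alpha>)"
proof -
  have "real_polynomial_function (\<lambda>x. \<Prod>b\<in>Basis. (x \<bullet> b) ^ \<alpha> b)"
    by (intro real_polynomial_function_prod real_polynomial_function_power real_polynomial_function.intros(1)
        bounded_linear_inner_left) auto
  then show ?thesis by (simp add: monomial_def[abs_def])
qed

lemma poly_deg_le_polynomial:
  assumes "poly_deg_le N q" shows "real_polynomial_function q"
proof -
  obtain c where c: "\<And>x. q x = (\<Sum>\<alpha>\<in>multi_indices N. c \<alpha> * monomial \<alpha> x)"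
    using assms poly_deg_le_iff by blast
  have "real_polynomial_function (\<lambda>x. \<Sum>\<alpha>\<in>multi_indices N. c \<alpha> * monomial \<alpha> x)"
    by (intro real_polynomial_function_sum finite_multi_indices real_polynomial_function.intros(2,4)
        monomial_polynomial)
  then show ?thesis using c by (simp add: c[THEN ext])
qed

lemma polynomial_gradient:
  fixes q :: "'a::euclidean_space \<Rightarrow> real"
  assumes "real_polynomial_function q"
  shows "\<exists>G. (\<forall>x. (q has_derivative (\<lambda>z. G x \<bullet> z)) (at x)) \<and> continuous_on UNIV G"
  using assms
proof induction
  case (linear f)
  note bl = this
  then interpret bounded_linear f .
  have "f z = (\<Sum>b\<in>Basis. f b *\<^sub>R b) \<bullet> z" for z
  proof -
    have "f z = f (\<Sum>b\<in>Basis. (z \<bullet> b) *\<^sub>R b)" by (simp add: euclidean_representation)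
    also have "\<dots> = (\<Sum>b\<in>Basis. (z \<bullet> b) * f b)" by (simp add: sum scale)
    finally show ?thesis by (simp add: inner_sum_left inner_commute[of z] mult.commute)
  qed
  then have "(f has_derivative (\<lambda>z. (\<Sum>b\<in>Basis. f b *\<^sub>R b) \<bullet> z)) (at x)" for x
    using bounded_linear_imp_has_derivative[OF bl] by (metis ext)
  then show ?case by (intro exI[of _ "\<lambda>_. \<Sum>b\<in>Basis. f b *\<^sub>R b"]) auto
next
  case (const c)
  show ?case by (intro exI[of _ "\<lambda>_. 0"]) auto
next
  case (add f g)
  then obtain F G where "\<forall>x. (f has_derivative (\<lambda>z. F x \<bullet> z)) (at x)" "continuous_on UNIV F"
    "\<forall>x. (g has_derivative (\<lambda>z. G x \<bullet> z)) (at x)" "continuous_on UNIV G" by blast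
  then show ?case
    by (intro exI[of _ "\<lambda>x. F x + G x"]) (auto intro!: has_derivative_add continuous_intros simp: inner_add_left)
next
  case (mult f g)
  then obtain F G where FG: "\<And>x. (f has_derivative (\<lambda>z. F x \<bullet> z)) (at x)" "continuous_on UNIV F"
    "\<And>x. (g has_derivative (\<lambda>z. G x \<bullet> z)) (at x)" "continuous_on UNIV G" by blast
  have "((\<lambda>x. f x * g x) has_derivative (\<lambda>z. (f x *\<^sub>R G x + g x *\<^sub>R F x) \<bullet> z)) (at x)" for x
    using has_derivative_mult[OF FG(1)[of x] FG(3)[of x]] by (simp add: inner_add_left mult.commute)
  moreover have "continuous_on UNIV f" "continuous_on UNIV g"
    using FG(1,3) by (meson continuous_at_imp_continuous_on has_derivative_continuous)+
  ultimately show ?case using FG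
    by (intro exI[of _ "\<lambda>x. f x *\<^sub>R G x + g x *\<^sub>R F x"]) (auto intro!: continuous_intros)
qed

text \<open>On the line from \<open>c\<close> to \<open>x\<close> the polynomial has one variable
  and vanishes on an interval. All its coefficients are therefore 0, and the parameter 1 reaches
  \<open>x\<close>.\<close>

lemma polynomial_zero_on_ball:
  fixes q :: "'a::euclidean_space \<Rightarrow> real"
  assumes q: "real_polynomial_function q" and e: "0 < e" and zero: "\<And>y. y \<in> ball c e \<Longrightarrow> q y = 0"
  shows "q x = 0"
proof -
  have "real_polynomial_function (q \<circ> (\<lambda>t::real. c + t *\<^sub>R (x - c)))"
  proof (rule real_polynomial_function_compose[OF _ q])
    show "polynomial_function (\<lambda>t::real. c + t *\<^sub>R (x - c))"
      by (intro polynomial_function_add polynomial_function_const polynomial_function_bounded_linear bounded_linear_scaleR_left)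
  qed
  then obtain a n where a: "\<And>t. q (c + t *\<^sub>R (x - c)) = (\<Sum>i\<le>n. a i * t ^ i)"
    by (auto simp: real_polynomial_function_iff_sum o_def fun_eq_iff)
  have "\<forall>k\<le>n. a k = 0"
  proof (rule ccontr)
    assume "\<not> ?thesis"
    then obtain k where "k \<le> n" "a k \<noteq> 0" by blast
    then have "finite {t. (\<Sum>i\<le>n. a i * t ^ i) = 0}" by (intro polyfun_rootbound_finite) auto
    moreover have "{0<..<e / (1 + norm (x - c))} \<subseteq> {t. (\<Sum>i\<le>n. a i * t ^ i) = 0}"
    proof
      fix t assume t: "t \<in> {0<..<e / (1 + norm (x - c))}"
      have p: "0 < 1 + norm (x - c)" by (simp add: add_pos_nonneg)
      have "t * norm (x - c) \<le> t * (1 + norm (x - c))" using t by (intro mult_left_mono) auto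
      also have "\<dots> < e" using t p by (simp add: pos_less_divide_eq)
      finally have "q (c + t *\<^sub>R (x - c)) = 0" using t by (intro zero) (simp add: dist_norm)
      then show "t \<in> {t. (\<Sum>i\<le>n. a i * t ^ i) = 0}" by (simp add: a)
    qed
    ultimately have "finite {0<..<e / (1 + norm (x - c))}" by (rule finite_subset[rotated])
    moreover have "0 < e / (1 + norm (x - c))" using e by (simp add: add_pos_nonneg)
    ultimately show False using infinite_Ioo[of 0 "e / (1 + norm (x - c))"] by simp
  qed
  then have "q (c + 1 *\<^sub>R (x - c)) = 0" unfolding a by simp
  then show ?thesis by simp
qed

section \<open>Piecewise polynomials on a triangulation\<close>

locale mesh = nonlocal_setting p \<rho> \<Omega> for p \<rho> and \<Omega> :: "'a::euclidean_space set" +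
  fixes \<T> :: "'a set set" and N :: nat
  assumes tri: "triangulation \<Omega> \<T>"
begin

text \<open>The intersection with the domain matters when the domain lies on both sides of its
  boundary, as along a slit: frontier points can then be interior to a mesh element. For the same
  reason \<open>skeleton\<close> contains the frontier of the domain.\<close>

definition cell :: "'a set \<Rightarrow> 'a set" where "cell T = interior T \<inter> \<Omega>"

definition skeleton :: "'a set" where "skeleton = frontier \<Omega> \<union> (\<Union>T\<in>\<T>. frontier T)"

text \<open>A pointwise representative that is 0 off the cells. It fixes the values which a
  definition up to null sets leaves open, and it is additive in the family \<open>q\<close>.\<close>

definition piecewise :: "('a set \<Rightarrow> 'a \<Rightarrow> 'b::real_vector) \<Rightarrow> 'a \<Rightarrow> 'b" where
  "piecewise q x = (\<Sum>T\<in>\<T>. indicator (cell T) x *\<^sub>R q T x)"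

definition fe_family :: "('a set \<Rightarrow> 'a \<Rightarrow> real) \<Rightarrow> bool" where
  "fe_family q \<longleftrightarrow> (\<forall>T\<in>\<T>. poly_deg_le N (q T) \<and> (\<forall>x\<in>T \<inter> frontier \<Omega>. q T x = 0))"

lemma finite_mesh: "finite \<T>" using tri by (simp add: triangulation_def)

lemma mesh_simplex: "T \<in> \<T> \<Longrightarrow> convex T \<and> compact T \<and> closed T"
  using tri by (auto simp: triangulation_def intro: convex_simplex compact_simplex closed_simplex)

lemma mesh_interior:
  assumes "T \<in> \<T>" shows "affine hull T = UNIV" "interior T \<noteq> {}" "rel_interior T = interior T"
proof -
  have s: "int DIM('a) simplex T" using tri assms by (simp add: triangulation_def)
  then have d: "aff_dim T = int DIM('a)" by (rule aff_dim_simplex)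
  then show a: "affine hull T = UNIV" by (simp add: aff_dim_eq_full)
  then show r: "rel_interior T = interior T" by (rule rel_interior_interior)
  have "T \<noteq> {}" using d by auto
  then show "interior T \<noteq> {}" using rel_interior_eq_empty[of T] mesh_simplex[OF assms] r by simp
qed

lemma mesh_cover: "\<Union>\<T> = closure \<Omega>" using tri by (simp add: triangulation_def)

text \<open>A face containing a relative interior point of an element is the whole element, so both
  elements equal their intersection.\<close>

lemma interior_disjoint:
  assumes "S \<in> \<T>" "T \<in> \<T>" "x \<in> interior S" "x \<in> interior T" shows "S = T"
proof (rule ccontr)
  assume ne: "S \<noteq> T"
  then have f: "(S \<inter> T) face_of S" "(S \<inter> T) face_of T" using tri assms by (auto simp: triangulation_def)
  have x: "x \<in> S \<inter> T" using assms interior_subset by blast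
  have "S \<subseteq> S \<inter> T" by (rule subset_of_face_of[OF f(1)]) (use x assms mesh_interior(3) in auto)
  moreover have "T \<subseteq> S \<inter> T" by (rule subset_of_face_of[OF f(2)]) (use x assms mesh_interior(3) in auto)
  ultimately show False using ne by blast
qed

lemma open_cell: "open (cell T)" by (simp add: cell_def open_dom open_Int)

lemma cell_measurable [measurable]: "cell T \<in> sets borel" using open_cell by simp

lemma cell_sub: "cell T \<subseteq> \<Omega>" "cell T \<subseteq> T" using interior_subset by (auto simp: cell_def)

lemma skeleton_closed: "closed skeleton"
  unfolding skeleton_def using finite_mesh by (intro closed_Un closed_UN) auto

lemma skeleton_null: "skeleton \<in> null_sets lborel"
proof -
  have "frontier T \<in> null_sets lborel" if "T \<in> \<T>" for T
    using negligible_convex_frontier[of T] mesh_simplex[OF that]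
    by (simp add: negligible_iff_null_sets null_sets_completion_iff)
  then show ?thesis
    unfolding skeleton_def using finite_mesh frontier_null by (intro null_sets.Un null_sets.finite_UN) auto
qed

lemma skeleton_sub: "skeleton \<subseteq> closure \<Omega>"
proof -
  have "frontier T \<subseteq> closure \<Omega>" if "T \<in> \<T>" for T
    using that mesh_cover mesh_simplex[OF that] frontier_subset_closed by blast
  then show ?thesis by (auto simp: skeleton_def frontier_def)
qed

lemma skeleton_dense:
  assumes "open U" shows "U \<subseteq> closure (U - skeleton)"
proof
  fix x assume x: "x \<in> U"
  have "\<not> V \<subseteq> skeleton" if "open V" "V \<noteq> {}" for V
  proof
    assume "V \<subseteq> skeleton"
    moreover have "negligible skeleton" using skeleton_null by (simp add: negligible_iff_null_sets null_sets_completionI)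
    ultimately show False using open_not_negligible that negligible_subset by blast
  qed
  then have "V \<inter> (U - skeleton) \<noteq> {}" if "open V" "x \<in> V" for V
    using that x assms open_Int[OF that(1) assms] by blast
  then show "x \<in> closure (U - skeleton)" by (auto simp: closure_iff_nhds_not_empty)
qed

lemma off_skeleton_dom:
  assumes "x \<notin> skeleton" "x \<in> closure \<Omega>" shows "x \<in> \<Omega>"
  using assms open_dom by (auto simp: skeleton_def frontier_def interior_open)

lemma off_skeleton_cell:
  assumes "x \<notin> skeleton" "T \<in> \<T>" "x \<in> T" shows "x \<in> cell T"
proof -
  have "x \<in> interior T" using assms mesh_simplex[OF assms(2)] by (auto simp: skeleton_def frontier_def)
  moreover have "x \<in> \<Omega>" using assms mesh_cover by (intro off_skeleton_dom) auto
  ultimately show ?thesis by (simp add: cell_def)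
qed

lemma piecewise_cell:
  assumes "T \<in> \<T>" "x \<in> cell T" shows "piecewise q x = q T x"
proof -
  have "x \<notin> cell S" if "S \<in> \<T>" "S \<noteq> T" for S
    using that assms interior_disjoint[of S T x] by (auto simp: cell_def)
  then have "piecewise q x = (\<Sum>S\<in>\<T>. if S = T then q T x else 0)"
    unfolding piecewise_def using assms by (intro sum.cong) auto
  then show ?thesis using assms finite_mesh by simp
qed

lemma piecewise_zero: "x \<notin> \<Omega> \<Longrightarrow> piecewise q x = 0"
  unfolding piecewise_def by (rule sum.neutral) (auto simp: cell_def)

lemma off_skeleton_cases:
  assumes "x \<notin> skeleton"
  obtains T where "T \<in> \<T>" "x \<in> cell T" | "x \<notin> closure \<Omega>"
  using assms off_skeleton_cell mesh_cover by blast

lemma piecewise_measurable [measurable]: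
  fixes q :: "'a set \<Rightarrow> 'a \<Rightarrow> 'b::{real_normed_vector,second_countable_topology}"
  assumes "\<And>T. T \<in> \<T> \<Longrightarrow> q T \<in> borel_measurable borel"
  shows "piecewise q \<in> borel_measurable borel"
proof -
  have "(\<lambda>x. indicator (cell T) x *\<^sub>R q T x) \<in> borel_measurable borel" if "T \<in> \<T>" for T
    using assms[OF that] by measurable
  then have "(\<lambda>x. \<Sum>T\<in>\<T>. indicator (cell T) x *\<^sub>R q T x) \<in> borel_measurable borel"
    by (intro borel_measurable_sum)
  then show ?thesis by (simp add: piecewise_def[abs_def])
qed

lemma piecewise_bounded:
  fixes q :: "'a set \<Rightarrow> 'a \<Rightarrow> 'b::real_normed_vector"
  assumes "\<And>T. T \<in> \<T> \<Longrightarrow> continuous_on UNIV (q T)"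
  shows "\<exists>K\<ge>0. \<forall>x. norm (piecewise q x) \<le> K"
proof -
  have "\<exists>K. \<forall>x\<in>T. norm (q T x) \<le> K" if "T \<in> \<T>" for T
    using compact_imp_bounded[OF compact_continuous_image[OF continuous_on_subset[OF assms[OF that]]], of T] mesh_simplex[OF that]
    by (auto simp: bounded_iff)
  then obtain K where K: "\<And>T x. T \<in> \<T> \<Longrightarrow> x \<in> T \<Longrightarrow> norm (q T x) \<le> K T" by metis
  have "norm (piecewise q x) \<le> (\<Sum>T\<in>\<T>. \<bar>K T\<bar>)" for x
    unfolding piecewise_def
  proof (rule sum_norm_le)
    fix T assume T: "T \<in> \<T>"
    show "norm (indicator (cell T) x *\<^sub>R q T x) \<le> \<bar>K T\<bar>"
      using K[OF T, of x] cell_sub(2)[of T] by (cases "x \<in> cell T") auto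
  qed
  then show ?thesis by (intro exI[of _ "\<Sum>T\<in>\<T>. \<bar>K T\<bar>"]) (auto intro: sum_nonneg)
qed

lemma fe_polynomial: "fe_family q \<Longrightarrow> T \<in> \<T> \<Longrightarrow> real_polynomial_function (q T)"
  by (auto simp: fe_family_def intro: poly_deg_le_polynomial)

lemma fe_continuous: "fe_family q \<Longrightarrow> T \<in> \<T> \<Longrightarrow> continuous_on A (q T)"
  by (meson continuous_at_imp_continuous_on continuous_real_polymonial_function fe_polynomial)

lemma fe_measurable [measurable]: "fe_family q \<Longrightarrow> piecewise q \<in> borel_measurable borel"
  by (intro piecewise_measurable borel_measurable_continuous_onI fe_continuous)

lemma fe_bounded: "fe_family q \<Longrightarrow> \<exists>K\<ge>0. \<forall>x. \<bar>piecewise q x\<bar> \<le> K"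
  using piecewise_bounded[of q] fe_continuous by fastforce

lemma fe_linear:
  assumes "fe_family q" "fe_family q'"
  shows "fe_family (\<lambda>T x. a * q T x + b * q' T x)"
  unfolding fe_family_def
proof (intro ballI conjI)
  fix T assume T: "T \<in> \<T>"
  obtain c c' where c: "\<And>x. q T x = (\<Sum>\<alpha>\<in>multi_indices N. c \<alpha> * monomial \<alpha> x)"
    "\<And>x. q' T x = (\<Sum>\<alpha>\<in>multi_indices N. c' \<alpha> * monomial \<alpha> x)"
    using assms T unfolding fe_family_def poly_deg_le_iff by metis
  show "poly_deg_le N (\<lambda>x. a * q T x + b * q' T x)"
    unfolding poly_deg_le_iff
    by (rule exI[of _ "\<lambda>\<alpha>. a * c \<alpha> + b * c' \<alpha>"]) (simp add: c sum_distrib_left sum.distrib[symmetric] algebra_simps)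
qed (use assms in \<open>auto simp: fe_family_def\<close>)

lemma piecewise_linear: "piecewise (\<lambda>T x. a * q T x + b * q' T x) x = a * piecewise q x + b * piecewise q' x"
  for q q' :: "'a set \<Rightarrow> 'a \<Rightarrow> real"
  by (simp add: piecewise_def sum_distrib_left sum.distrib[symmetric] algebra_simps)

text \<open>Elements of \<open>Wtilde\<close> are determined only almost everywhere; this Borel
  representative replaces them in all estimates.\<close>

lemma Wtilde_piecewise:
  assumes "v \<in> Wtilde p N \<Omega> \<T>"
  shows "\<exists>q. fe_family q \<and> (AE x in lebesgue. v x = piecewise q x)"
proof -
  have "\<forall>T\<in>\<T>. \<exists>q. poly_deg_le N q \<and> (AE x in lebesgue. x \<in> T \<longrightarrow> v x = q x) \<and> (\<forall>x\<in>T \<inter> frontier \<Omega>. q x = 0)"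
    using assms by (simp add: Wtilde_def)
  then obtain q where q: "\<And>T. T \<in> \<T> \<Longrightarrow> poly_deg_le N (q T) \<and> (AE x in lebesgue. x \<in> T \<longrightarrow> v x = q T x) \<and> (\<forall>x\<in>T \<inter> frontier \<Omega>. q T x = 0)"
    by metis
  have "AE x in lebesgue. \<forall>T\<in>\<T>. x \<in> T \<longrightarrow> v x = q T x"
    using q finite_mesh by (intro AE_finite_allI) auto
  moreover have "AE x in lebesgue. x \<notin> skeleton" by (rule AE_completion[OF AE_not_in[OF skeleton_null]])
  ultimately have "AE x in lebesgue. v x = piecewise q x"
  proof eventually_elim
    case (elim x)
    from elim(2) show ?case
    proof (cases rule: off_skeleton_cases)
      case (1 T)
      then show ?thesis using elim(1) piecewise_cell[of T x q] cell_sub(2)[of T] by auto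
    next
      case 2
      then have "x \<notin> \<Omega>" using closure_subset by blast
      then show ?thesis using assms piecewise_zero[of x q] by (simp add: Wtilde_def)
    qed
  qed
  then show ?thesis using q by (intro exI[of _ q]) (auto simp: fe_family_def)
qed

lemma piecewise_Wtilde:
  assumes q: "fe_family q"
  shows "piecewise q \<in> Wtilde p N \<Omega> \<T>"
  unfolding Wtilde_def
proof (intro CollectI conjI allI impI ballI)
  obtain K where K: "\<And>x. \<bar>piecewise q x\<bar> \<le> K" using fe_bounded[OF q] by blast
  show "Lp_space p \<Omega> (piecewise q)"
    by (rule Lp_space_bounded[OF measurable_completion]) (use q K in auto)
  show "piecewise q x = 0" if "x \<notin> \<Omega>" for x using that by (rule piecewise_zero)
  fix T assume T: "T \<in> \<T>"
  have "AE x in lebesgue. x \<in> T \<longrightarrow> piecewise q x = q T x"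
    using AE_completion[OF AE_not_in[OF skeleton_null]]
    by eventually_elim (use T off_skeleton_cell piecewise_cell in blast)
  then show "\<exists>r. poly_deg_le N r \<and> (AE x in lebesgue. x \<in> T \<longrightarrow> piecewise q x = r x) \<and> (\<forall>x\<in>T \<inter> frontier \<Omega>. r x = 0)"
    using q T by (auto simp: fe_family_def)
qed

text \<open>A bounded function vanishing outside the domain has finite energy at every positive
  scale. Thus every \<open>piecewise q\<close> is an admissible competitor for all finite
  \<open>\<sigma>\<close>, discontinuous or not.\<close>

lemma piecewise_Sp0:
  assumes q: "fe_family q" and d: "0 < \<delta>"
  shows "piecewise q \<in> Sp0 p \<rho> \<Omega> \<delta>" "nl_seminorm_p p \<rho> \<Omega> \<delta> (piecewise q) = nl_energy p \<rho> \<delta> (piecewise q)"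
    "nl_energy p \<rho> \<delta> (piecewise q) < \<infinity>"
proof -
  obtain K where K: "\<And>x. \<bar>piecewise q x\<bar> \<le> K" using fe_bounded[OF q] by blast
  have m: "piecewise q \<in> borel_measurable borel" using q by simp
  show eq: "nl_seminorm_p p \<rho> \<Omega> \<delta> (piecewise q) = nl_energy p \<rho> \<delta> (piecewise q)"
    by (rule nl_seminorm_p_eq_energy[OF m piecewise_zero d])
  show fin: "nl_energy p \<rho> \<delta> (piecewise q) < \<infinity>"
    by (rule nl_energy_finite[OF m piecewise_zero K d])
  have "Lp_space p (extended_domain \<Omega> \<delta>) (piecewise q)"
  proof -
    have ind: "(\<lambda>x. indicator (extended_domain \<Omega> \<delta>) x *\<^sub>R piecewise q x) = piecewise q"
    proof
      fix x
      show "indicator (extended_domain \<Omega> \<delta>) x *\<^sub>R piecewise q x = piecewise q x"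
        using piecewise_zero[of x q] by (cases "x \<in> \<Omega>") (auto simp: extended_domain_def)
    qed
    have "(\<integral>\<^sup>+x\<in>extended_domain \<Omega> \<delta>. ennreal (norm (piecewise q x) powr p) \<partial>lebesgue) =
        (\<integral>\<^sup>+x\<in>\<Omega>. ennreal (norm (piecewise q x) powr p) \<partial>lebesgue)"
      using piecewise_zero[of _ q] by (intro nn_integral_cong) (auto simp: indicator_def extended_domain_def)
    moreover have "Lp_space p \<Omega> (piecewise q)"
      by (rule Lp_space_bounded[OF measurable_completion]) (use q K in auto)
    then have "(\<integral>\<^sup>+x\<in>\<Omega>. ennreal (norm (piecewise q x) powr p) \<partial>lebesgue) < \<infinity>" by (simp only: Lp_space_def)
    moreover have "piecewise q \<in> borel_measurable lebesgue" by (rule measurable_completion) (use m in simp)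
    ultimately show ?thesis unfolding Lp_space_def ind by (simp only:)
  qed
  then show "piecewise q \<in> Sp0 p \<rho> \<Omega> \<delta>"
    unfolding Sp0_def Sp_def using eq fin by (simp add: piecewise_zero interaction_layer_def)
qed

lemma fe_gradient:
  assumes q: "fe_family q"
  shows "\<exists>g L. g \<in> borel_measurable borel \<and> 0 < L \<and> (\<forall>x. norm (g x) < L) \<and>
    (\<forall>x. x \<notin> skeleton \<longrightarrow> (piecewise q has_derivative (\<lambda>z. g x \<bullet> z)) (at x) \<and> isCont g x) \<and> (\<forall>x. x \<notin> \<Omega> \<longrightarrow> g x = 0)"
proof -
  have "\<forall>T\<in>\<T>. \<exists>G. (\<forall>x. (q T has_derivative (\<lambda>z. G x \<bullet> z)) (at x)) \<and> continuous_on UNIV G"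
    using polynomial_gradient fe_polynomial[OF q] by blast
  then obtain G where G: "\<And>T x. T \<in> \<T> \<Longrightarrow> (q T has_derivative (\<lambda>z. G T x \<bullet> z)) (at x)"
    "\<And>T. T \<in> \<T> \<Longrightarrow> continuous_on UNIV (G T)" by metis
  have "\<exists>K\<ge>0. \<forall>x. norm (piecewise G x) \<le> K" by (rule piecewise_bounded[OF G(2)])
  then obtain K where K: "0 \<le> K" "\<And>x. norm (piecewise G x) \<le> K" by blast
  have main: "(piecewise q has_derivative (\<lambda>z. piecewise G x \<bullet> z)) (at x) \<and> isCont (piecewise G) x" if x: "x \<notin> skeleton" for x
    using x
  proof (cases rule: off_skeleton_cases)
    case (1 T)
    have "(piecewise q has_derivative (\<lambda>z. G T x \<bullet> z)) (at x)"
      by (rule has_derivative_transform_within_open[OF G(1)[OF 1(1)] open_cell[of T] 1(2)]) (simp add: piecewise_cell[OF 1(1)])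
    moreover have "continuous_on (cell T) (piecewise G)"
      by (rule continuous_on_eq[OF continuous_on_subset[OF G(2)[OF 1(1)] subset_UNIV]]) (simp add: piecewise_cell[OF 1(1)])
    then have "isCont (piecewise G) x" using continuous_on_eq_continuous_at[OF open_cell] 1(2) by blast
    ultimately show ?thesis by (simp add: piecewise_cell[OF 1])
  next
    case 2
    have z: "piecewise r y = 0" if "y \<in> - closure \<Omega>" for y and r :: "'a set \<Rightarrow> 'a \<Rightarrow> 'c::real_vector"
      using that closure_subset by (intro piecewise_zero) blast
    have "((\<lambda>y. 0) has_derivative (\<lambda>z. 0)) (at x)" by simp
    then have "(piecewise q has_derivative (\<lambda>z. 0)) (at x)"
      by (rule has_derivative_transform_within_open[of _ _ _ _ "- closure \<Omega>"]) (use 2 z[of _ q] in auto)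
    moreover have "continuous_on (- closure \<Omega>) (piecewise G)"
      by (rule continuous_on_eq[OF continuous_on_const[of _ 0]]) (simp add: z)
    then have "isCont (piecewise G) x" using continuous_on_eq_continuous_at[of "- closure \<Omega>"] 2 by auto
    ultimately show ?thesis using z[of x G] 2 by simp
  qed
  have "norm (piecewise G x) < K + 1" for x using K(2)[of x] by simp
  then show ?thesis
    using main K(1) piecewise_zero[of _ G] piecewise_measurable[of G] borel_measurable_continuous_onI[OF G(2)]
    by (intro exI[of _ "piecewise G"] exI[of _ "K + 1"]) simp
qed

lemma fe_bounded_energy_in_W1p0:
  assumes q: "fe_family q" and M: "0 \<le> M" "\<And>t. 0 < t \<Longrightarrow> nl_energy p \<rho> t (piecewise q) \<le> ennreal M"
  shows "piecewise q \<in> W1p0 p \<Omega>" "\<exists>g. Lp_space p \<Omega> g \<and> is_weak_grad \<Omega> (piecewise q) g \<and>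
    (\<integral>\<^sup>+x\<in>\<Omega>. ennreal (norm (g x) powr p) \<partial>lebesgue) \<le> ennreal M"
proof -
  obtain g L where g [measurable]: "g \<in> borel_measurable borel" and L: "0 < L" "\<And>x. norm (g x) < L"
    and der: "\<And>x. x \<notin> skeleton \<Longrightarrow> (piecewise q has_derivative (\<lambda>z. g x \<bullet> z)) (at x)"
    and cont: "\<And>x. x \<notin> skeleton \<Longrightarrow> isCont g x"
    using fe_gradient[OF q] by blast
  have m [measurable]: "piecewise q \<in> borel_measurable borel" using q by simp
  \<comment> \<open>The bound relates any two points off the skeleton and not just points of one
    cell, so the continuous extension has no jumps across faces.\<close>
  have "L-lipschitz_on (- skeleton) (piecewise q)"
  proof (rule lipschitz_onI)
    fix x y assume "x \<in> - skeleton" "y \<in> - skeleton"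
    then show "dist (piecewise q x) (piecewise q y) \<le> L * dist x y"
      using bounded_energy_imp_lipschitz[OF m piecewise_zero skeleton_null der L(2) M] by (auto simp: dist_norm)
  qed (use L in simp)
  then obtain ut where ut: "L-lipschitz_on (closure (- skeleton)) ut" "\<And>x. x \<notin> skeleton \<Longrightarrow> ut x = piecewise q x"
    using lipschitz_extend_closure by (metis ComplI)
  have "closure (- skeleton) = UNIV" using skeleton_dense[OF open_UNIV] by (auto simp: Compl_eq_Diff_UNIV)
  then have utL: "L-lipschitz_on UNIV ut" using ut(1) by simp
  have lip: "\<bar>ut x - ut y\<bar> \<le> L * norm (x - y)" for x y
    using lipschitz_onD[OF utL, of x y] by (simp add: dist_norm)
  have utc: "continuous_on A ut" for A
    using lipschitz_on_continuous_on[OF utL] continuous_on_subset by blast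
  \<comment> \<open>A point of the closure outside the domain lies on the frontier and in some
    element \<open>T\<close>. Off-skeleton points are dense in \<open>T\<close> and
    \<open>ut\<close> equals \<open>q T\<close> at them, so the boundary condition on the polynomial
    transfers to \<open>ut\<close>.\<close>
  have ut0: "ut x = 0" if x: "x \<notin> \<Omega>" for x
  proof (cases "x \<in> closure \<Omega>")
    case False
    then show ?thesis using skeleton_sub ut(2)[of x] piecewise_zero[OF x, of q] by auto
  next
    case True
    then obtain T where T: "T \<in> \<T>" "x \<in> T" using mesh_cover by blast
    have fr: "x \<in> frontier \<Omega>" using True x open_dom by (simp add: frontier_def interior_open)
    have "closure (interior T - skeleton) \<subseteq> {y. ut y = q T y}"
    proof (rule closure_minimal)
      show "interior T - skeleton \<subseteq> {y. ut y = q T y}"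
        using ut(2) off_skeleton_cell[OF _ T(1)] piecewise_cell[OF T(1)] interior_subset by fastforce
      show "closed {y. ut y = q T y}"
        by (intro closed_Collect_eq utc fe_continuous[OF q T(1)])
    qed
    moreover have "x \<in> closure (interior T - skeleton)"
    proof -
      have "T = closure (interior T)"
        using convex_closure_interior[of T] mesh_simplex[OF T(1)] mesh_interior(2)[OF T(1)] by simp
      also have "\<dots> \<subseteq> closure (interior T - skeleton)"
        using skeleton_dense[OF open_interior, of T] by (intro closure_minimal) auto
      finally show ?thesis using T(2) by blast
    qed
    ultimately have "ut x = q T x" by blast
    then show ?thesis using q T fr by (auto simp: fe_family_def)
  qed
  have der': "(ut has_derivative (\<lambda>z. g x \<bullet> z)) (at x)" if "x \<notin> skeleton" for x
    by (rule has_derivative_transform_within_open[OF der[OF that], of "- skeleton"])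
       (use that skeleton_closed ut(2) in auto)
  have AE: "AE x in lborel. piecewise q x = ut x"
    using AE_not_in[OF skeleton_null] by eventually_elim (simp add: ut(2))
  obtain g' where g': "piecewise q \<in> W1p0 p \<Omega>" "Lp_space p \<Omega> g'" "is_weak_grad \<Omega> (piecewise q) g'" "\<And>x. norm (g' x) \<le> norm (g x)"
    using lipschitz_in_W1p0[OF lip ut0 skeleton_closed skeleton_null der' cont g m AE] by blast
  then show "piecewise q \<in> W1p0 p \<Omega>" by simp
  have "(\<integral>\<^sup>+x\<in>\<Omega>. ennreal (norm (g' x) powr p) \<partial>lebesgue) \<le> (\<integral>\<^sup>+x. ennreal (norm (g x) powr p) \<partial>lborel)"
    unfolding nn_integral_completion
    using p g'(4) by (intro nn_integral_mono) (auto simp: indicator_def intro!: ennreal_leI powr_mono2)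
  also have "\<dots> \<le> liminf (\<lambda>n. nl_energy p \<rho> (1 / real (Suc n)) (piecewise q))"
    using LIMSEQ_Suc[OF lim_const_over_n[of 1]]
    by (intro gradient_le_liminf_energy[OF m g skeleton_null _ _ der]) simp_all
  also have "\<dots> \<le> liminf (\<lambda>n::nat. ennreal M)"
    by (intro Liminf_mono always_eventually allI M) simp
  also have "\<dots> = ennreal M" by (simp add: Liminf_const)
  finally show "\<exists>g. Lp_space p \<Omega> g \<and> is_weak_grad \<Omega> (piecewise q) g \<and>
    (\<integral>\<^sup>+x\<in>\<Omega>. ennreal (norm (g x) powr p) \<partial>lebesgue) \<le> ennreal M"
    using g' by blast
qed

end

section \<open>Convergence of the discrete minimizers\<close>

context mesh
begin

lemma cell_nonempty:
  assumes "T \<in> \<T>" shows "cell T \<noteq> {}"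
proof -
  have "interior T - skeleton \<noteq> {}"
  proof
    assume "interior T - skeleton = {}"
    then show False using skeleton_dense[OF open_interior, of T] mesh_interior(2)[OF assms] by (metis closure_empty subset_empty)
  qed
  then obtain x where "x \<in> interior T" "x \<notin> skeleton" by blast
  then have "x \<in> cell T" using off_skeleton_cell[OF _ assms] interior_subset by blast
  then show ?thesis by blast
qed

text \<open>The nonzero set within the cell is open and null, hence empty, and a cell contains a
  ball.\<close>

lemma polynomial_zero_AE_cell:
  assumes T: "T \<in> \<T>" and P: "real_polynomial_function P" and AE: "AE x in lborel. x \<in> cell T \<longrightarrow> P x = 0"
  shows "P x = 0"
proof -
  have c: "continuous_on UNIV P"
    using P by (meson continuous_at_imp_continuous_on continuous_real_polymonial_function)
  have op: "open (cell T \<inter> {x. P x \<noteq> 0})"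
    by (intro open_Int open_cell open_Collect_neq c continuous_on_const)
  have "cell T \<inter> {x. P x \<noteq> 0} \<in> null_sets lborel"
    using AE op by (subst AE_iff_null_sets) (auto elim!: eventually_mono)
  then have "negligible (cell T \<inter> {x. P x \<noteq> 0})" by (simp add: negligible_iff_null_sets null_sets_completionI)
  then have z: "cell T \<inter> {x. P x \<noteq> 0} = {}" using open_not_negligible[OF op] by blast
  obtain y where "y \<in> cell T" using cell_nonempty[OF T] by blast
  then obtain e where e: "0 < e" "ball y e \<subseteq> cell T" using open_cell openE by blast
  have "P y' = 0" if "y' \<in> ball y e" for y' using that z e(2) by blast
  then show ?thesis by (rule polynomial_zero_on_ball[OF P e(1)])
qed

text \<open>Bounded p-th means give convergent coefficients on each element. Convergence of
  coefficients is locally uniform, so it survives along moving points \<open>Y k\<close>, the form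
  needed when the step of the difference quotient varies.\<close>

lemma fe_compactness:
  assumes q: "\<And>n. fe_family (q n)"
    and bd: "\<And>n. (\<integral>\<^sup>+x\<in>\<Omega>. ennreal (\<bar>piecewise (q n) x\<bar> powr p) \<partial>lborel) \<le> ennreal K"
  shows "\<exists>r q' B. strict_mono (r::nat \<Rightarrow> nat) \<and> fe_family q' \<and> (\<forall>k x. \<bar>piecewise (q (r k)) x\<bar> \<le> B) \<and>
    (\<forall>x Y. x \<notin> skeleton \<longrightarrow> Y \<longlonglongrightarrow> x \<longrightarrow> (\<lambda>k. piecewise (q (r k)) (Y k)) \<longlonglongrightarrow> piecewise q' x)"
proof -
  let ?MI = "multi_indices N :: ('a \<Rightarrow> nat) set"
  have "\<forall>n. \<forall>T\<in>\<T>. \<exists>c. \<forall>x. q n T x = (\<Sum>\<alpha>\<in>?MI. c \<alpha> * monomial \<alpha> x)"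
    using q by (simp add: fe_family_def poly_deg_le_iff)
  then obtain C where C: "\<And>n T x. T \<in> \<T> \<Longrightarrow> q n T x = (\<Sum>\<alpha>\<in>?MI. C n T \<alpha> * monomial \<alpha> x)" by metis
  \<comment> \<open>The polynomials are regarded as functions on pairs of an element and a point,
    the disjoint union of the elements, so that pieces on different elements do not
    interact.\<close>
  define f :: "'a set \<times> ('a \<Rightarrow> nat) \<Rightarrow> 'a set \<times> 'a \<Rightarrow> real" where
    "f = (\<lambda>i w. if fst w = fst i then monomial (snd i) (snd w) else 0)"
  define v where "v = (\<lambda>n w. if fst w \<in> \<T> then q n (fst w) (snd w) else 0)"
  \<comment> \<open>The p-th mean over the cells only; it still detects polynomials, since each cell
    is open and nonempty.\<close>
  define Nm :: "('a set \<times> 'a \<Rightarrow> real) \<Rightarrow> ennreal" where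
    "Nm = (\<lambda>w. \<Sum>T\<in>\<T>. \<integral>\<^sup>+x\<in>cell T. ennreal (\<bar>w (T, x)\<bar> powr p) \<partial>lborel)"
  have fin: "finite (\<T> \<times> ?MI)" by (intro finite_cartesian_product finite_mesh finite_multi_indices)
  have expand: "(\<Sum>i\<in>\<T> \<times> ?MI. c i * f i w) =
      (if fst w \<in> \<T> then \<Sum>\<alpha>\<in>?MI. c (fst w, \<alpha>) * monomial \<alpha> (snd w) else 0)" for c w
  proof -
    have "(\<Sum>i\<in>\<T> \<times> ?MI. c i * f i w) = (\<Sum>T\<in>\<T>. \<Sum>\<alpha>\<in>?MI. c (T, \<alpha>) * f (T, \<alpha>) w)"
      by (simp add: sum.cartesian_product split_def)
    also have "\<dots> = (\<Sum>T\<in>\<T>. if fst w = T then \<Sum>\<alpha>\<in>?MI. c (T, \<alpha>) * monomial \<alpha> (snd w) else 0)"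
      by (intro sum.cong refl) (auto simp: f_def)
    finally show ?thesis using finite_mesh by simp
  qed
  have qc: "continuous_on UNIV (q n T)" if "T \<in> \<T>" for n T by (rule fe_continuous[OF q that])
  have qm [measurable]: "q n T \<in> borel_measurable borel" if "T \<in> \<T>" for n T
    by (intro borel_measurable_continuous_onI qc that)
  have "\<exists>r c' c. strict_mono (r::nat \<Rightarrow> nat) \<and> (\<forall>k w. v (r k) w = (\<Sum>i\<in>\<T> \<times> ?MI. c' k i * f i w)) \<and>
      (\<forall>i\<in>\<T> \<times> ?MI. (\<lambda>k. c' k i) \<longlonglongrightarrow> c i)"
  proof (rule finite_dim_compactness[where N = Nm and q = p and K = "real (card \<T>) * K" and cn = "\<lambda>n i. C n (fst i) (snd i)"])
    show "finite (\<T> \<times> ?MI)" by (rule fin)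
    show "0 < p" using p by simp
    show "v n w = (\<Sum>i\<in>\<T> \<times> ?MI. C n (fst i) (snd i) * f i w)" for n w
      unfolding expand by (simp add: v_def C)
    show "Nm (\<lambda>w. a * v n w) = ennreal (\<bar>a\<bar> powr p) * Nm (v n)" for a n
    proof -
      have "(\<integral>\<^sup>+x\<in>cell T. ennreal (\<bar>a * v n (T, x)\<bar> powr p) \<partial>lborel) =
          ennreal (\<bar>a\<bar> powr p) * (\<integral>\<^sup>+x\<in>cell T. ennreal (\<bar>v n (T, x)\<bar> powr p) \<partial>lborel)" if T: "T \<in> \<T>" for T
      proof -
        have "(\<integral>\<^sup>+x\<in>cell T. ennreal (\<bar>a * v n (T, x)\<bar> powr p) \<partial>lborel) =
            (\<integral>\<^sup>+x. ennreal (\<bar>a\<bar> powr p) * (ennreal (\<bar>v n (T, x)\<bar> powr p) * indicator (cell T) x) \<partial>lborel)"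
          by (intro nn_integral_cong) (simp add: abs_mult powr_mult ennreal_mult' mult.assoc)
        also have "\<dots> = ennreal (\<bar>a\<bar> powr p) * (\<integral>\<^sup>+x\<in>cell T. ennreal (\<bar>v n (T, x)\<bar> powr p) \<partial>lborel)"
          using qm[OF T] T by (intro nn_integral_cmult) (simp add: v_def)
        finally show ?thesis .
      qed
      then show ?thesis unfolding Nm_def sum_distrib_left by (intro sum.cong) auto
    qed
    show "Nm (v n) \<le> ennreal (real (card \<T>) * K)" for n
    proof -
      have "Nm (v n) \<le> (\<Sum>T\<in>\<T>. ennreal K)"
        unfolding Nm_def
      proof (rule sum_mono)
        fix T assume T: "T \<in> \<T>"
        have "(\<integral>\<^sup>+x\<in>cell T. ennreal (\<bar>v n (T, x)\<bar> powr p) \<partial>lborel) \<le> (\<integral>\<^sup>+x\<in>\<Omega>. ennreal (\<bar>piecewise (q n) x\<bar> powr p) \<partial>lborel)"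
          using T cell_sub(1)[of T] by (intro nn_integral_mono) (auto simp: indicator_def v_def piecewise_cell)
        then show "(\<integral>\<^sup>+x\<in>cell T. ennreal (\<bar>v n (T, x)\<bar> powr p) \<partial>lborel) \<le> ennreal K"
          using bd[of n] by (rule order_trans)
      qed
      also have "\<dots> = ennreal (real (card \<T>) * K)"
        by (simp add: ennreal_mult' ennreal_of_nat_eq_real_of_nat)
      finally show ?thesis .
    qed
    fix cn :: "nat \<Rightarrow> 'a set \<times> ('a \<Rightarrow> nat) \<Rightarrow> real" and c and w :: "'a set \<times> 'a"
    assume cn: "\<And>i. i \<in> \<T> \<times> ?MI \<Longrightarrow> (\<lambda>n. cn n i) \<longlonglongrightarrow> c i"
      and N0: "(\<lambda>n. Nm (\<lambda>w. \<Sum>i\<in>\<T> \<times> ?MI. cn n i * f i w)) \<longlonglongrightarrow> 0"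
    show "(\<Sum>i\<in>\<T> \<times> ?MI. c i * f i w) = 0"
    proof (cases "fst w \<in> \<T>")
      case T: True
      define T where "T = fst w"
      let ?P = "\<lambda>c x. \<Sum>\<alpha>\<in>?MI. c (T, \<alpha>) * monomial \<alpha> x"
      have Pp: "real_polynomial_function (?P c)" for c
        by (intro real_polynomial_function_sum finite_multi_indices real_polynomial_function.intros(2,4) monomial_polynomial)
      have [measurable]: "monomial \<alpha> \<in> borel_measurable borel" for \<alpha> :: "'a \<Rightarrow> nat"
        by (intro borel_measurable_continuous_onI continuous_at_imp_continuous_on ballI continuous_real_polymonial_function monomial_polynomial)
      have "(\<integral>\<^sup>+x\<in>cell T. ennreal (\<bar>?P c x\<bar> powr p) \<partial>lborel) =
          (\<integral>\<^sup>+x. liminf (\<lambda>n. ennreal (\<bar>?P (cn n) x\<bar> powr p) * indicator (cell T) x) \<partial>lborel)"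
      proof (intro nn_integral_cong lim_imp_Liminf[symmetric])
        fix x
        have "(\<lambda>n. \<bar>?P (cn n) x\<bar> powr p) \<longlonglongrightarrow> \<bar>?P c x\<bar> powr p"
          using p T by (intro tendsto_powr2 tendsto_rabs tendsto_sum tendsto_mult tendsto_const cn) (auto simp: T_def)
        then show "(\<lambda>n. ennreal (\<bar>?P (cn n) x\<bar> powr p) * indicator (cell T) x) \<longlonglongrightarrow> ennreal (\<bar>?P c x\<bar> powr p) * indicator (cell T) x"
          by (cases "x \<in> cell T") auto
      qed simp
      also have "\<dots> \<le> liminf (\<lambda>n. \<integral>\<^sup>+x\<in>cell T. ennreal (\<bar>?P (cn n) x\<bar> powr p) \<partial>lborel)"
        by (rule nn_integral_liminf) measurable
      also have "\<dots> \<le> liminf (\<lambda>n. Nm (\<lambda>w. \<Sum>i\<in>\<T> \<times> ?MI. cn n i * f i w))"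
      proof (intro Liminf_mono always_eventually allI)
        fix n
        have "(\<integral>\<^sup>+x\<in>cell T. ennreal (\<bar>?P (cn n) x\<bar> powr p) \<partial>lborel) =
            (\<integral>\<^sup>+x\<in>cell T. ennreal (\<bar>\<Sum>i\<in>\<T> \<times> ?MI. cn n i * f i (T, x)\<bar> powr p) \<partial>lborel)"
          unfolding expand using T by (simp add: T_def)
        also have "\<dots> \<le> Nm (\<lambda>w. \<Sum>i\<in>\<T> \<times> ?MI. cn n i * f i w)"
          unfolding Nm_def using T finite_mesh
          by (intro member_le_sum[where f = "\<lambda>T. \<integral>\<^sup>+x\<in>cell T. ennreal (\<bar>\<Sum>i\<in>\<T> \<times> ?MI. cn n i * f i (T, x)\<bar> powr p) \<partial>lborel"]) (auto simp: T_def)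
        finally show "(\<integral>\<^sup>+x\<in>cell T. ennreal (\<bar>?P (cn n) x\<bar> powr p) \<partial>lborel) \<le> Nm (\<lambda>w. \<Sum>i\<in>\<T> \<times> ?MI. cn n i * f i w)" .
      qed
      also have "\<dots> = 0" by (rule lim_imp_Liminf[OF _ N0]) simp
      finally have "(\<integral>\<^sup>+x\<in>cell T. ennreal (\<bar>?P c x\<bar> powr p) \<partial>lborel) = 0" by simp
      then have "AE x in lborel. ennreal (\<bar>?P c x\<bar> powr p) * indicator (cell T) x = 0"
        by (subst (asm) nn_integral_0_iff_AE) auto
      then have "AE x in lborel. x \<in> cell T \<longrightarrow> ?P c x = 0"
        by eventually_elim auto
      then have "?P c (snd w) = 0"
        using T by (intro polynomial_zero_AE_cell[OF _ Pp]) (auto simp: T_def)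
      then show ?thesis unfolding expand using T by (simp add: T_def)
    next
      case False
      then show ?thesis unfolding expand by simp
    qed
  qed
  then obtain r c' c where r: "strict_mono (r::nat \<Rightarrow> nat)" and c': "\<And>k w. v (r k) w = (\<Sum>i\<in>\<T> \<times> ?MI. c' k i * f i w)"
    and lim: "\<And>i. i \<in> \<T> \<times> ?MI \<Longrightarrow> (\<lambda>k. c' k i) \<longlonglongrightarrow> c i" by blast
  have qr: "q (r k) T x = (\<Sum>\<alpha>\<in>?MI. c' k (T, \<alpha>) * monomial \<alpha> x)" if "T \<in> \<T>" for k T x
    using c'[of k "(T, x)"] that unfolding expand by (simp add: v_def)
  define q' where "q' = (\<lambda>T x. \<Sum>\<alpha>\<in>?MI. c (T, \<alpha>) * monomial \<alpha> x)"
  have mc: "isCont (monomial \<alpha>) x" for \<alpha> :: "'a \<Rightarrow> nat" and x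
    by (rule continuous_real_polymonial_function[OF monomial_polynomial])
  have conv: "(\<lambda>k. q (r k) T (Y k)) \<longlonglongrightarrow> q' T x" if "T \<in> \<T>" "Y \<longlonglongrightarrow> x" for T Y x
    unfolding qr[OF that(1)] q'_def
    by (intro tendsto_sum tendsto_mult lim isCont_tendsto_compose[OF mc that(2)]) (use that in auto)
  have q': "fe_family q'"
    unfolding fe_family_def
  proof (intro ballI conjI)
    fix T assume T: "T \<in> \<T>"
    show "poly_deg_le N (q' T)" unfolding poly_deg_le_iff q'_def by (intro exI[of _ "\<lambda>\<alpha>. c (T, \<alpha>)"]) simp
    fix x assume x: "x \<in> T \<inter> frontier \<Omega>"
    have "(\<lambda>k. q (r k) T x) \<longlonglongrightarrow> q' T x" by (rule conv[OF T tendsto_const])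
    moreover have "q (r k) T x = 0" for k using q T x by (auto simp: fe_family_def)
    ultimately show "q' T x = 0" by (simp add: LIMSEQ_const_iff)
  qed
  \<comment> \<open>Off the skeleton the points \<open>Y k\<close> eventually stay in the cell of
    the limit or outside the closure of the domain, so a single polynomial, or 0, has to be
    considered.\<close>
  have pconv: "(\<lambda>k. piecewise (q (r k)) (Y k)) \<longlonglongrightarrow> piecewise q' x" if x: "x \<notin> skeleton" and Y: "Y \<longlonglongrightarrow> x" for x Y
    using x
  proof (cases rule: off_skeleton_cases)
    case (1 T)
    have "\<forall>\<^sub>F k in sequentially. Y k \<in> cell T" using topological_tendstoD[OF Y open_cell 1(2)] .
    then have "\<forall>\<^sub>F k in sequentially. q (r k) T (Y k) = piecewise (q (r k)) (Y k)"
      by eventually_elim (simp add: piecewise_cell[OF 1(1)])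
    then have "(\<lambda>k. piecewise (q (r k)) (Y k)) \<longlonglongrightarrow> q' T x"
      by (rule Lim_transform_eventually[OF conv[OF 1(1) Y]])
    then show ?thesis by (simp add: piecewise_cell[OF 1])
  next
    case 2
    have "\<forall>\<^sub>F k in sequentially. Y k \<in> - closure \<Omega>" using topological_tendstoD[OF Y, of "- closure \<Omega>"] 2 by auto
    then have "\<forall>\<^sub>F k in sequentially. piecewise (q (r k)) (Y k) = 0"
      by eventually_elim (rule piecewise_zero, use closure_subset in blast)
    moreover have "piecewise q' x = 0" using 2 closure_subset by (intro piecewise_zero) blast
    ultimately show ?thesis by (simp add: tendsto_eventually)
  qed
  have "\<exists>b. \<forall>k. \<bar>c' k i\<bar> \<le> b" if "i \<in> \<T> \<times> ?MI" for i
    using convergent_imp_Bseq[of "\<lambda>k. c' k i"] lim[OF that] by (auto simp: convergent_def Bseq_def)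
  then obtain b where b: "\<And>i k. i \<in> \<T> \<times> ?MI \<Longrightarrow> \<bar>c' k i\<bar> \<le> b i" by metis
  have "\<exists>K. \<forall>x\<in>T. \<bar>monomial \<alpha> x\<bar> \<le> K" if "T \<in> \<T>" for T and \<alpha> :: "'a \<Rightarrow> nat"
    using compact_imp_bounded[OF compact_continuous_image[of T "monomial \<alpha>"]] mesh_simplex[OF that] mc
    by (auto simp: bounded_iff continuous_at_imp_continuous_on)
  then obtain m where m: "\<And>T \<alpha> x. T \<in> \<T> \<Longrightarrow> x \<in> T \<Longrightarrow> \<bar>monomial \<alpha> x\<bar> \<le> m T \<alpha>" by metis
  \<comment> \<open>A bound uniform in the sequence, used to dominate the load term.\<close>
  define B where "B = (\<Sum>T\<in>\<T>. \<Sum>\<alpha>\<in>?MI. \<bar>b (T, \<alpha>) * m T \<alpha>\<bar>)"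
  have "\<bar>piecewise (q (r k)) x\<bar> \<le> B" for k x
  proof -
    have "norm (piecewise (q (r k)) x) \<le> B"
      unfolding piecewise_def B_def
    proof (rule sum_norm_le)
      fix T assume T: "T \<in> \<T>"
      show "norm (indicator (cell T) x *\<^sub>R q (r k) T x) \<le> (\<Sum>\<alpha>\<in>?MI. \<bar>b (T, \<alpha>) * m T \<alpha>\<bar>)"
      proof (cases "x \<in> cell T")
        case True
        have "norm (q (r k) T x) \<le> (\<Sum>\<alpha>\<in>?MI. \<bar>b (T, \<alpha>) * m T \<alpha>\<bar>)"
          unfolding qr[OF T]
        proof (rule sum_norm_le)
          fix \<alpha> assume a: "\<alpha> \<in> ?MI"
          have x: "x \<in> T" using True cell_sub(2) by blast
          have "\<bar>c' k (T, \<alpha>)\<bar> * \<bar>monomial \<alpha> x\<bar> \<le> \<bar>b (T, \<alpha>)\<bar> * \<bar>m T \<alpha>\<bar>"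
            using b[of "(T, \<alpha>)" k] m[OF T x, of \<alpha>] T a by (intro mult_mono) (auto intro: order_trans[OF _ abs_ge_self])
          then show "norm (c' k (T, \<alpha>) * monomial \<alpha> x) \<le> \<bar>b (T, \<alpha>) * m T \<alpha>\<bar>" by (simp add: abs_mult)
        qed
        then show ?thesis using True by simp
      qed (simp add: sum_nonneg)
    qed
    then show ?thesis by simp
  qed
  then show ?thesis using r q' pconv by blast
qed

lemma energy_lower_semicontinuous:
  assumes q: "\<And>k. fe_family (q k)" and q': "fe_family q'"
    and conv: "\<And>x Y. x \<notin> skeleton \<Longrightarrow> Y \<longlonglongrightarrow> x \<Longrightarrow> (\<lambda>k. piecewise (q k) (Y k)) \<longlonglongrightarrow> piecewise q' x"
    and d: "\<And>k. 0 < d k" "d \<longlonglongrightarrow> 0" and a: "a \<longlonglongrightarrow> A" "\<And>k. nl_energy p \<rho> (d k) (piecewise (q k)) \<le> ennreal (a k)"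
    and t: "0 < t"
  shows "nl_energy p \<rho> t (piecewise q') \<le> ennreal A"
proof -
  \<comment> \<open>The number of steps of length \<open>d k\<close> that fit into \<open>t\<close>;
    the resulting multiple \<open>s k\<close> is within \<open>d k\<close> of
    \<open>t\<close>.\<close>
  define n where "n = (\<lambda>k. nat \<lfloor>t / d k\<rfloor>)"
  define s where "s = (\<lambda>k. real (n k) * d k)"
  have s: "t - d k \<le> s k" "s k \<le> t" for k
  proof -
    have "0 \<le> t / d k" using t d(1)[of k] by simp
    then have n: "real (n k) = of_int \<lfloor>t / d k\<rfloor>" by (simp add: n_def)
    have "t / d k - 1 \<le> real (n k)" "real (n k) \<le> t / d k" unfolding n by linarith+
    then show "t - d k \<le> s k" "s k \<le> t" using d(1)[of k] by (auto simp: s_def field_simps)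
  qed
  have st: "s \<longlonglongrightarrow> t"
  proof (rule tendsto_sandwich)
    show "(\<lambda>k. t - d k) \<longlonglongrightarrow> t" using tendsto_diff[OF tendsto_const d(2), of t] by simp
  qed (use s in auto)
  have "nl_energy p \<rho> t (piecewise q') \<le> liminf (\<lambda>k. nl_energy p \<rho> (s k) (piecewise (q k)))"
  proof (rule nl_energy_liminf[OF _ _ skeleton_null st])
    show "(\<lambda>k. piecewise (q k) x) \<longlonglongrightarrow> piecewise q' x" if "x \<notin> skeleton" for x
      by (rule conv[OF that tendsto_const])
    show "(\<lambda>k. piecewise (q k) (x + s k *\<^sub>R z)) \<longlonglongrightarrow> piecewise q' (x + t *\<^sub>R z)" if "x + t *\<^sub>R z \<notin> skeleton" for x z
      by (intro conv that tendsto_intros st)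
  qed (use q q' t in auto)
  also have "\<dots> \<le> liminf (\<lambda>k. ennreal (a k))"
  proof (rule Liminf_mono)
    have "\<forall>\<^sub>F k in sequentially. d k < t" using d(2) t by (rule order_tendstoD(2))
    then show "\<forall>\<^sub>F k in sequentially. nl_energy p \<rho> (s k) (piecewise (q k)) \<le> ennreal (a k)"
    proof eventually_elim
      case (elim k)
      have "0 < n k" using elim d(1)[of k] s(1)[of k] by (cases "n k = 0") (auto simp: s_def)
      then have "nl_energy p \<rho> (s k) (piecewise (q k)) \<le> nl_energy p \<rho> (d k) (piecewise (q k))"
        unfolding s_def using q d(1)[of k] by (intro nl_energy_multiple) auto
      then show ?case using a(2)[of k] by (rule order_trans)
    qed
  qed
  also have "\<dots> = ennreal A" using a(1) by (intro lim_imp_Liminf) auto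
  finally show ?thesis .
qed

text \<open>The scalar inequality applied to the two difference quotients at each pair of points,
  then integrated against the nonnegative kernel.\<close>

lemma fe_clarkson:
  assumes q: "fe_family q" and q': "fe_family q'" and d: "0 < \<delta>"
  shows "nl_energy p \<rho> \<delta> (\<lambda>x. (piecewise q x + piecewise q' x) / 2) + nl_energy p \<rho> \<delta> (\<lambda>x. (piecewise q x - piecewise q' x) / 2) \<le>
    ennreal (1 / 2) * (nl_energy p \<rho> \<delta> (piecewise q) + nl_energy p \<rho> \<delta> (piecewise q'))"
proof -
  let ?P = "(lborel :: 'a measure) \<Otimes>\<^sub>M (lborel :: 'a measure)"
  let ?u = "piecewise q" and ?v = "piecewise q'"
  have [measurable]: "?u \<in> borel_measurable borel" "?v \<in> borel_measurable borel" using q q' by auto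
  let ?I = "\<lambda>u w. nl_integrand p \<rho> \<delta> u (fst w) (snd w)"
  let ?h = "\<lambda>x. (?u x + ?v x) / 2" and ?d = "\<lambda>x. (?u x - ?v x) / 2"
  have pt: "?I ?h w + ?I ?d w \<le> (?I ?u w + ?I ?v w) / 2" for w
  proof -
    let ?a = "(?u (fst w + \<delta> *\<^sub>R snd w) - ?u (fst w)) / \<delta>" and ?b = "(?v (fst w + \<delta> *\<^sub>R snd w) - ?v (fst w)) / \<delta>"
    have "\<bar>(?a + ?b) / 2\<bar> powr p + \<bar>(?a - ?b) / 2\<bar> powr p \<le> (\<bar>?a\<bar> powr p + \<bar>?b\<bar> powr p) / 2" by (rule clarkson_powr[OF p])
    from mult_left_mono[OF this kernel_nonneg[of "norm (snd w)"]]
    have "\<rho> (norm (snd w)) * \<bar>(?a + ?b) / 2\<bar> powr p + \<rho> (norm (snd w)) * \<bar>(?a - ?b) / 2\<bar> powr p \<le>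
        (\<rho> (norm (snd w)) * \<bar>?a\<bar> powr p + \<rho> (norm (snd w)) * \<bar>?b\<bar> powr p) / 2"
      by (simp add: algebra_simps)
    moreover have "(?h (fst w + \<delta> *\<^sub>R snd w) - ?h (fst w)) / \<delta> = (?a + ?b) / 2" "(?d (fst w + \<delta> *\<^sub>R snd w) - ?d (fst w)) / \<delta> = (?a - ?b) / 2"
      using d by (simp_all add: field_simps)
    ultimately show ?thesis unfolding nl_integrand_def by (simp only:)
  qed
  have "nl_energy p \<rho> \<delta> ?h + nl_energy p \<rho> \<delta> ?d = (\<integral>\<^sup>+w. ennreal (?I ?h w) + ennreal (?I ?d w) \<partial>?P)"
    unfolding nl_energy_def by (rule nn_integral_add[symmetric]) measurable
  also have "\<dots> \<le> (\<integral>\<^sup>+w. ennreal (1 / 2) * (ennreal (?I ?u w) + ennreal (?I ?v w)) \<partial>?P)"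
  proof (rule nn_integral_mono)
    fix w
    show "ennreal (?I ?h w) + ennreal (?I ?d w) \<le> ennreal (1 / 2) * (ennreal (?I ?u w) + ennreal (?I ?v w))"
    proof -
      have "ennreal (?I ?h w) + ennreal (?I ?d w) = ennreal (?I ?h w + ?I ?d w)"
        by (simp add: ennreal_plus nl_integrand_nonneg)
      also have "\<dots> \<le> ennreal (1 / 2 * (?I ?u w + ?I ?v w))" using pt[of w] by (intro ennreal_leI) simp
      also have "\<dots> = ennreal (1 / 2) * (ennreal (?I ?u w) + ennreal (?I ?v w))"
        by (subst ennreal_mult') (simp_all add: ennreal_plus nl_integrand_nonneg)
      finally show ?thesis .
    qed
  qed
  also have "\<dots> = ennreal (1 / 2) * (\<integral>\<^sup>+w. ennreal (?I ?u w) + ennreal (?I ?v w) \<partial>?P)"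
    by (rule nn_integral_cmult) measurable
  also have "(\<integral>\<^sup>+w. ennreal (?I ?u w) + ennreal (?I ?v w) \<partial>?P) = nl_energy p \<rho> \<delta> ?u + nl_energy p \<rho> \<delta> ?v"
    unfolding nl_energy_def by (rule nn_integral_add) measurable
  finally show ?thesis .
qed

end

lemma (in nonlocal_setting) Lp_integral_eq:
  fixes g :: "'a \<Rightarrow> 'b::{banach,second_countable_topology}"
  assumes g: "Lp_space q \<Omega> g" and q: "0 < q"
  shows "(\<integral>\<^sup>+x\<in>\<Omega>. ennreal (norm (g x) powr q) \<partial>lebesgue) = ennreal (LINT x:\<Omega>|lebesgue. norm (g x) powr q)"
    "set_integrable lebesgue \<Omega> (\<lambda>x. norm (g x) powr q)"
proof -
  have m: "(\<lambda>x. norm (indicator \<Omega> x *\<^sub>R g x) powr q) \<in> borel_measurable lebesgue"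
  proof (rule measurable_compose[where f = "\<lambda>x. indicator \<Omega> x *\<^sub>R g x" and N = borel and g = "\<lambda>y. norm y powr q"])
    show "(\<lambda>x. indicator \<Omega> x *\<^sub>R g x) \<in> borel_measurable lebesgue" using g by (simp add: Lp_space_def)
  qed measurable
  have f: "(\<lambda>x. indicator \<Omega> x *\<^sub>R (norm (g x) powr q)) = (\<lambda>x. norm (indicator \<Omega> x *\<^sub>R g x) powr q)"
    using q by (auto simp: fun_eq_iff indicator_def)
  have n: "(\<integral>\<^sup>+x\<in>\<Omega>. ennreal (norm (g x) powr q) \<partial>lebesgue) = (\<integral>\<^sup>+x. ennreal (norm (indicator \<Omega> x *\<^sub>R g x) powr q) \<partial>lebesgue)"
    using q by (intro nn_integral_cong) (auto simp: indicator_def)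
  have i: "integrable lebesgue (\<lambda>x. norm (indicator \<Omega> x *\<^sub>R g x) powr q)"
  proof (rule integrableI_nonneg[OF m])
    show "(\<integral>\<^sup>+x. ennreal (norm (indicator \<Omega> x *\<^sub>R g x) powr q) \<partial>lebesgue) < \<infinity>"
      using g unfolding n[symmetric] Lp_space_def by simp
  qed simp
  show "set_integrable lebesgue \<Omega> (\<lambda>x. norm (g x) powr q)" unfolding set_integrable_def f by (rule i)
  show "(\<integral>\<^sup>+x\<in>\<Omega>. ennreal (norm (g x) powr q) \<partial>lebesgue) = ennreal (LINT x:\<Omega>|lebesgue. norm (g x) powr q)"
    unfolding n set_lebesgue_integral_def f by (rule nn_integral_eq_integral[OF i]) simp
qed

section \<open>Load term, Poincare bound and the energy gap\<close>

context mesh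
begin

text \<open>\<open>W1p0\<close> supplies a gradient together with approximating test functions,
  whereas \<open>E_inf\<close> uses a chosen gradient; uniqueness of weak gradients identifies the
  two.\<close>

lemma W1p0_fe_energy_le:
  assumes v: "v \<in> W1p0 p \<Omega>" and q: "fe_family q" and AE: "AE x in lebesgue. v x = piecewise q x" and d: "0 < \<delta>"
  shows "nl_energy p \<rho> \<delta> (piecewise q) \<le> ennreal (LINT x:\<Omega>|lebesgue. norm (weak_grad p \<Omega> v x) powr p)"
proof -
  obtain g \<phi> where g: "Lp_space p \<Omega> g" "is_weak_grad \<Omega> v g" and t: "\<And>n. test_fun \<Omega> (\<phi> n)"
    and lim: "(\<lambda>n. Lp_norm p \<Omega> (\<lambda>x. \<phi> n x - v x) + Lp_norm p \<Omega> (\<lambda>x. cgrad (\<phi> n) x - g x)) \<longlonglongrightarrow> 0"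
    using v by (auto simp: W1p0_def)
  have wg: "Lp_space p \<Omega> (weak_grad p \<Omega> v)" "is_weak_grad \<Omega> v (weak_grad p \<Omega> v)"
    using someI_ex[of "\<lambda>g. Lp_space p \<Omega> g \<and> is_weak_grad \<Omega> v g"] g by (auto simp: weak_grad_def)
  have eq: "Lp_norm p \<Omega> (\<lambda>x. \<phi> n x - v x) = Lp_norm p \<Omega> (\<lambda>x. \<phi> n x - piecewise q x)" for n
  proof -
    have "(\<integral>\<^sup>+x\<in>\<Omega>. ennreal (norm (\<phi> n x - v x) powr p) \<partial>lebesgue) = (\<integral>\<^sup>+x\<in>\<Omega>. ennreal (norm (\<phi> n x - piecewise q x) powr p) \<partial>lebesgue)"
      by (rule nn_integral_cong_AE) (use AE in eventually_elim, simp)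
    then show ?thesis by (simp add: Lp_norm_def)
  qed
  have m: "piecewise q \<in> borel_measurable borel" using q by simp
  obtain K where K: "\<And>x. \<bar>piecewise q x\<bar> \<le> K" using fe_bounded[OF q] by blast
  have Lq: "Lp_space p \<Omega> (piecewise q)"
    by (rule Lp_space_bounded[OF measurable_completion]) (use m K in auto)
  have "nl_energy p \<rho> \<delta> (piecewise q) \<le> (\<integral>\<^sup>+x\<in>\<Omega>. ennreal (norm (g x) powr p) \<partial>lebesgue)"
    by (rule W1p0_energy_le[OF m piecewise_zero Lq g(1) d t lim[unfolded eq]])
  also have "\<dots> = (\<integral>\<^sup>+x\<in>\<Omega>. ennreal (norm (weak_grad p \<Omega> v x) powr p) \<partial>lebesgue)"
  proof (rule nn_integral_cong_AE)
    show "AE x in lebesgue. ennreal (norm (g x) powr p) * indicator \<Omega> x = ennreal (norm (weak_grad p \<Omega> v x) powr p) * indicator \<Omega> x"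
      using weak_grad_unique[OF g wg] by eventually_elim (auto simp: indicator_def)
  qed
  also have "\<dots> = ennreal (LINT x:\<Omega>|lebesgue. norm (weak_grad p \<Omega> v x) powr p)"
    by (rule Lp_integral_eq(1)[OF wg(1)]) (use p in simp)
  finally show ?thesis .
qed

lemma piecewise_set_integrable:
  assumes f: "set_integrable lebesgue \<Omega> f" and q: "fe_family q"
  shows "set_integrable lebesgue \<Omega> (\<lambda>x. f x * piecewise q x)"
proof -
  obtain K where K: "\<And>x. \<bar>piecewise q x\<bar> \<le> K" using fe_bounded[OF q] by blast
  let ?f = "\<lambda>x. indicator \<Omega> x *\<^sub>R f x"
  have i: "integrable lebesgue ?f" using f by (simp add: set_integrable_def)
  have m: "piecewise q \<in> borel_measurable lebesgue" by (rule measurable_completion) (use q in simp)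
  have "integrable lebesgue (\<lambda>x. ?f x * piecewise q x)"
  proof (rule Bochner_Integration.integrable_bound[OF integrable_mult_right[OF i, of K]])
    show "(\<lambda>x. ?f x * piecewise q x) \<in> borel_measurable lebesgue"
      by (rule borel_measurable_times[OF borel_measurable_integrable[OF i] m])
    have "norm (?f x * piecewise q x) \<le> norm (K * ?f x)" for x
      using mult_right_mono[OF order_trans[OF K abs_ge_self], of "\<bar>?f x\<bar>" x] by (simp add: abs_mult mult.commute)
    then show "AE x in lebesgue. norm (?f x * piecewise q x) \<le> norm (K * ?f x)" by simp
  qed
  then show ?thesis by (simp add: set_integrable_def mult.assoc)
qed

lemma pairing_cong_AE:
  assumes f: "set_integrable lebesgue \<Omega> f" and q: "fe_family q" and v: "Lp_space p \<Omega> v"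
    and AE: "AE x in lebesgue. v x = piecewise q x"
  shows "pairing \<Omega> f v = pairing \<Omega> f (piecewise q)"
  unfolding pairing_def set_lebesgue_integral_def
proof (rule integral_cong_AE)
  show "(\<lambda>x. indicator \<Omega> x *\<^sub>R (f x * piecewise q x)) \<in> borel_measurable lebesgue"
    using piecewise_set_integrable[OF f q] by (simp add: set_integrable_def)
  show "AE x in lebesgue. indicator \<Omega> x *\<^sub>R (f x * v x) = indicator \<Omega> x *\<^sub>R (f x * piecewise q x)"
    using AE by eventually_elim simp
  \<comment> \<open>Measurability of \<open>f\<close> and \<open>v\<close> is available only after
    cutting off to the domain, so both factors carry the indicator.\<close>
  have "(\<lambda>x. (indicator \<Omega> x *\<^sub>R f x) * (indicator \<Omega> x *\<^sub>R v x)) \<in> borel_measurable lebesgue"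
    using f v by (intro borel_measurable_times) (auto simp: set_integrable_def Lp_space_def)
  moreover have "(\<lambda>x. (indicator \<Omega> x *\<^sub>R f x) * (indicator \<Omega> x *\<^sub>R v x)) = (\<lambda>x. indicator \<Omega> x *\<^sub>R (f x * v x))"
    by (auto simp: fun_eq_iff indicator_def)
  ultimately show "(\<lambda>x. indicator \<Omega> x *\<^sub>R (f x * v x)) \<in> borel_measurable lebesgue" by simp
qed

lemma pairing_linear:
  assumes f: "set_integrable lebesgue \<Omega> f" and q: "fe_family q" and q': "fe_family q'"
  shows "pairing \<Omega> f (piecewise (\<lambda>T x. a * q T x + b * q' T x)) = a * pairing \<Omega> f (piecewise q) + b * pairing \<Omega> f (piecewise q')"
proof -
  have "pairing \<Omega> f (piecewise (\<lambda>T x. a * q T x + b * q' T x)) =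
      (LINT x:\<Omega>|lebesgue. a * (f x * piecewise q x) + b * (f x * piecewise q' x))"
    unfolding pairing_def piecewise_linear by (simp add: algebra_simps)
  also have "\<dots> = a * pairing \<Omega> f (piecewise q) + b * pairing \<Omega> f (piecewise q')"
    unfolding pairing_def using piecewise_set_integrable[OF f q] piecewise_set_integrable[OF f q']
    by (subst set_integral_add) auto
  finally show ?thesis .
qed

text \<open>Young's inequality after rescaling by \<open>l\<close>: a small \<open>l\<close> makes
  the coefficient of the p-th power small at the expense of the term in \<open>f\<close>. The factor
  1/p' of the first term is estimated by one.\<close>

lemma pairing_young:
  assumes f: "Lp_space (p / (p - 1)) \<Omega> f" and q: "fe_family q" and l: "0 < l"
  shows "pairing \<Omega> f (piecewise q) \<le>
    l powr (- (p / (p - 1))) * (LINT x:\<Omega>|lebesgue. norm (f x) powr (p / (p - 1))) +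
    l powr p / p * (LINT x:\<Omega>|lebesgue. norm (piecewise q x) powr p)"
proof -
  let ?r = "p / (p - 1)"
  have r: "1 < ?r" "0 < ?r" "1 / ?r + 1 / p = 1" using p by (auto simp: field_simps)
  obtain K where K: "\<And>x. \<bar>piecewise q x\<bar> \<le> K" using fe_bounded[OF q] by blast
  have Lq: "Lp_space p \<Omega> (piecewise q)"
    by (rule Lp_space_bounded[OF measurable_completion]) (use q K in auto)
  have p0: "0 < p" using p by simp
  note i1 = Lp_integral_eq(2)[OF f r(2)] and i2 = Lp_integral_eq(2)[OF Lq p0]
  have f1: "set_integrable lebesgue \<Omega> f" using Lp_space_set_integrable[OF _ f] r by simp
  have pt: "f x * piecewise q x \<le> l powr (- ?r) * norm (f x) powr ?r + l powr p / p * norm (piecewise q x) powr p" for x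
  proof -
    have "f x * piecewise q x \<le> \<bar>f x * piecewise q x\<bar>" by (rule abs_ge_self)
    also have "\<dots> = (\<bar>f x\<bar> / l) * (l * \<bar>piecewise q x\<bar>)" using l by (simp add: abs_mult)
    also have "\<dots> \<le> (\<bar>f x\<bar> / l) powr ?r / ?r + (l * \<bar>piecewise q x\<bar>) powr p / p"
      using r p l by (intro Youngs_inequality) auto
    also have "\<dots> \<le> (\<bar>f x\<bar> / l) powr ?r + (l * \<bar>piecewise q x\<bar>) powr p / p"
    proof -
      have "(\<bar>f x\<bar> / l) powr ?r / ?r \<le> (\<bar>f x\<bar> / l) powr ?r / 1" using r by (intro divide_left_mono) auto
      then show ?thesis by simp
    qed
    also have "\<dots> = l powr (- ?r) * norm (f x) powr ?r + l powr p / p * norm (piecewise q x) powr p"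
      using l by (simp add: powr_divide powr_mult powr_minus_divide)
    finally show ?thesis .
  qed
  have "pairing \<Omega> f (piecewise q) \<le> (LINT x:\<Omega>|lebesgue. l powr (- ?r) * norm (f x) powr ?r + l powr p / p * norm (piecewise q x) powr p)"
    unfolding pairing_def
    by (rule set_integral_mono) (use piecewise_set_integrable[OF f1 q] i1 i2 pt in \<open>auto intro!: set_integral_add\<close>)
  also have "\<dots> = l powr (- ?r) * (LINT x:\<Omega>|lebesgue. norm (f x) powr ?r) + l powr p / p * (LINT x:\<Omega>|lebesgue. norm (piecewise q x) powr p)"
    by (subst set_integral_add) (use i1 i2 in auto)
  finally show ?thesis .
qed

lemma fe_poincare:
  assumes poincare: "\<forall>v\<in>Sp0 p \<rho> \<Omega> \<delta>. Lp_norm p \<Omega> v \<le> C * nl_seminorm p \<rho> \<Omega> \<delta> v"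
    and C: "0 < C" and d: "0 < \<delta>" and q: "fe_family q"
  shows "(LINT x:\<Omega>|lebesgue. norm (piecewise q x) powr p) \<le> C powr p * enn2real (nl_energy p \<rho> \<delta> (piecewise q))"
    "Lp_norm p \<Omega> (piecewise q) powr p = (LINT x:\<Omega>|lebesgue. norm (piecewise q x) powr p)"
proof -
  have p0: "0 < p" using p by simp
  let ?X = "LINT x:\<Omega>|lebesgue. norm (piecewise q x) powr p" and ?J = "enn2real (nl_energy p \<rho> \<delta> (piecewise q))"
  obtain K where K: "\<And>x. \<bar>piecewise q x\<bar> \<le> K" using fe_bounded[OF q] by blast
  have Lq: "Lp_space p \<Omega> (piecewise q)"
    by (rule Lp_space_bounded[OF measurable_completion]) (use q K in auto)
  have X0: "0 \<le> ?X" unfolding set_lebesgue_integral_def by (intro integral_nonneg_AE) auto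
  have n: "Lp_norm p \<Omega> (piecewise q) = ?X powr (1 / p)"
    unfolding Lp_norm_def Lp_integral_eq(1)[OF Lq p0] using X0 by simp
  then show eq: "Lp_norm p \<Omega> (piecewise q) powr p = ?X" using X0 p0 by (simp add: powr_powr)
  have "Lp_norm p \<Omega> (piecewise q) \<le> C * ?J powr (1 / p)"
    using poincare piecewise_Sp0(1)[OF q d] by (auto simp: nl_seminorm_def piecewise_Sp0(2)[OF q d])
  then have "Lp_norm p \<Omega> (piecewise q) powr p \<le> (C * ?J powr (1 / p)) powr p"
    using p0 by (intro powr_mono2) (auto simp: n)
  also have "\<dots> = C powr p * ?J" using C p0 by (simp add: powr_mult powr_powr)
  finally show "?X \<le> C powr p * ?J" unfolding eq .
qed

lemma pairing_tendsto:
  assumes f: "set_integrable lebesgue \<Omega> f" and q: "\<And>k. fe_family (q k)" "fe_family q'"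
    and B: "\<And>k x. \<bar>piecewise (q k) x\<bar> \<le> B"
    and conv: "\<And>x. x \<notin> skeleton \<Longrightarrow> (\<lambda>k. piecewise (q k) x) \<longlonglongrightarrow> piecewise q' x"
  shows "(\<lambda>k. pairing \<Omega> f (piecewise (q k))) \<longlonglongrightarrow> pairing \<Omega> f (piecewise q')"
  unfolding pairing_def set_lebesgue_integral_def
proof (rule integral_dominated_convergence[where w = "\<lambda>x. B * \<bar>indicator \<Omega> x *\<^sub>R f x\<bar>"])
  show "integrable lebesgue (\<lambda>x. B * \<bar>indicator \<Omega> x *\<^sub>R f x\<bar>)"
    using f by (intro integrable_mult_right integrable_abs) (simp add: set_integrable_def)
  show "AE x in lebesgue. (\<lambda>k. indicator \<Omega> x *\<^sub>R (f x * piecewise (q k) x)) \<longlonglongrightarrow> indicator \<Omega> x *\<^sub>R (f x * piecewise q' x)"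
    using AE_completion[OF AE_not_in[OF skeleton_null]] by eventually_elim (intro tendsto_intros conv)
  have "norm (indicator \<Omega> x *\<^sub>R (f x * piecewise (q k) x)) \<le> B * \<bar>indicator \<Omega> x *\<^sub>R f x\<bar>" for k x
    using mult_right_mono[OF B[of k x], of "\<bar>f x\<bar>"] by (auto simp: indicator_def abs_mult mult.commute)
  then show "AE x in lebesgue. norm (indicator \<Omega> x *\<^sub>R (f x * piecewise (q k) x)) \<le> B * \<bar>indicator \<Omega> x *\<^sub>R f x\<bar>" for k by simp
qed (use piecewise_set_integrable[OF f q(1)] piecewise_set_integrable[OF f q(2)] in \<open>auto simp: set_integrable_def\<close>)

lemma E_inf_le:
  assumes v: "Lp_space p \<Omega> g" "is_weak_grad \<Omega> v g" and M: "0 \<le> M" "(\<integral>\<^sup>+x\<in>\<Omega>. ennreal (norm (g x) powr p) \<partial>lebesgue) \<le> ennreal M"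
  shows "E_inf p \<Omega> f v \<le> M / p - pairing \<Omega> f v"
proof -
  have p0: "0 < p" using p by simp
  have wg: "Lp_space p \<Omega> (weak_grad p \<Omega> v)" "is_weak_grad \<Omega> v (weak_grad p \<Omega> v)"
    using someI_ex[of "\<lambda>g. Lp_space p \<Omega> g \<and> is_weak_grad \<Omega> v g"] v by (auto simp: weak_grad_def)
  have "ennreal (LINT x:\<Omega>|lebesgue. norm (weak_grad p \<Omega> v x) powr p) = (\<integral>\<^sup>+x\<in>\<Omega>. ennreal (norm (weak_grad p \<Omega> v x) powr p) \<partial>lebesgue)"
    by (rule Lp_integral_eq(1)[OF wg(1) p0, symmetric])
  also have "\<dots> = (\<integral>\<^sup>+x\<in>\<Omega>. ennreal (norm (g x) powr p) \<partial>lebesgue)"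
  proof (rule nn_integral_cong_AE)
    show "AE x in lebesgue. ennreal (norm (weak_grad p \<Omega> v x) powr p) * indicator \<Omega> x = ennreal (norm (g x) powr p) * indicator \<Omega> x"
      using weak_grad_unique[OF v wg] by eventually_elim (auto simp: indicator_def)
  qed
  also note M(2)
  finally have "(LINT x:\<Omega>|lebesgue. norm (weak_grad p \<Omega> v x) powr p) \<le> M" using M(1) by (simp add: ennreal_le_iff)
  then show ?thesis using p0 by (simp add: E_inf_def divide_right_mono)
qed

text \<open>Argument by contradiction along a sequence of parameters. The bound \<open>main\<close>
  controls the distance by the energy gap for each \<open>\<sigma>\<close>, and compactness shows
  that the gap has a nonpositive limit along a subsequence.\<close>

lemma minimizers_converge:
  fixes u :: "real \<Rightarrow> 'a \<Rightarrow> real" and ui f :: "'a \<Rightarrow> real"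
  assumes delta0: "0 < \<delta>0"
    and poincare: "\<exists>C>0. \<forall>\<delta>\<in>{0<..\<delta>0}. \<forall>v\<in>Sp0 p \<rho> \<Omega> \<delta>. Lp_norm p \<Omega> v \<le> C * nl_seminorm p \<rho> \<Omega> \<delta> v"
    and f: "Lp_space (p / (p - 1)) (extended_domain \<Omega> \<delta>0) f"
    and min_sigma: "\<And>\<sigma>. 0 < \<sigma> \<Longrightarrow> u \<sigma> \<in> W_sigma_h p \<rho> N \<Omega> \<delta>0 \<T> \<sigma> \<and>
         (\<forall>v\<in>W_sigma_h p \<rho> N \<Omega> \<delta>0 \<T> \<sigma>. E_sigma p \<rho> \<Omega> \<delta>0 f \<sigma> (u \<sigma>) \<le> E_sigma p \<rho> \<Omega> \<delta>0 f \<sigma> v)"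
    and min_inf: "ui \<in> W_inf_h p N \<Omega> \<T>" "\<And>v. v \<in> W_inf_h p N \<Omega> \<T> \<Longrightarrow> E_inf p \<Omega> f ui \<le> E_inf p \<Omega> f v"
  shows "((\<lambda>\<sigma>. Lp_norm p \<Omega> (\<lambda>x. u \<sigma> x - ui x)) \<longlongrightarrow> 0) at_top"
proof -
  define \<delta> where "\<delta> = (\<lambda>\<sigma>. delta_sigma \<delta>0 \<sigma>)"
  have d: "0 < \<delta> \<sigma>" "\<delta> \<sigma> \<in> {0<..\<delta>0}" if "0 < \<sigma>" for \<sigma> using that delta0 by (auto simp: \<delta>_def delta_sigma_def)
  obtain C where C: "0 < C" "\<And>\<delta>. \<delta> \<in> {0<..\<delta>0} \<Longrightarrow> \<forall>v\<in>Sp0 p \<rho> \<Omega> \<delta>. Lp_norm p \<Omega> v \<le> C * nl_seminorm p \<rho> \<Omega> \<delta> v"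
    using poincare by blast
  have p0: "0 < p" "1 < p" using p by auto
  have fL: "Lp_space (p / (p - 1)) \<Omega> f"
  proof -
    let ?E = "extended_domain \<Omega> \<delta>0"
    have sub: "\<Omega> \<subseteq> ?E" by (auto simp: extended_domain_def)
    have "(\<lambda>x. indicator ?E x *\<^sub>R f x) \<in> borel_measurable lebesgue" using f by (simp only: Lp_space_def)
    then have "(\<lambda>x. indicator \<Omega> x *\<^sub>R (indicator ?E x *\<^sub>R f x)) \<in> borel_measurable lebesgue"
      by (rule borel_measurable_scaleR[OF borel_measurable_indicator[OF dom_measurable(2)]])
    moreover have "(\<lambda>x. indicator \<Omega> x *\<^sub>R (indicator ?E x *\<^sub>R f x)) = (\<lambda>x. indicator \<Omega> x *\<^sub>R f x)"
      using sub by (auto simp: fun_eq_iff indicator_def)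
    moreover have "(\<integral>\<^sup>+x\<in>\<Omega>. ennreal (norm (f x) powr (p / (p - 1))) \<partial>lebesgue) \<le> (\<integral>\<^sup>+x\<in>?E. ennreal (norm (f x) powr (p / (p - 1))) \<partial>lebesgue)"
      using sub by (intro nn_integral_mono) (auto simp: indicator_def)
    ultimately show ?thesis using f by (auto simp: Lp_space_def intro: le_less_trans)
  qed
  have f1: "set_integrable lebesgue \<Omega> f"
    by (rule Lp_space_set_integrable[OF _ fL]) (use p in simp)
  have "\<forall>\<sigma>. \<exists>q. 0 < \<sigma> \<longrightarrow> fe_family q \<and> (AE x in lebesgue. u \<sigma> x = piecewise q x)"
    using min_sigma Wtilde_piecewise by (auto simp: W_sigma_h_def)
  then obtain qs where qs: "\<And>\<sigma>. 0 < \<sigma> \<Longrightarrow> fe_family (qs \<sigma>)" "\<And>\<sigma>. 0 < \<sigma> \<Longrightarrow> AE x in lebesgue. u \<sigma> x = piecewise (qs \<sigma>) x"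
    by metis
  obtain qi where qi: "fe_family qi" "AE x in lebesgue. ui x = piecewise qi x"
    using min_inf(1) Wtilde_piecewise by (auto simp: W_inf_h_def)
  define J where "J = (\<lambda>\<sigma> q. enn2real (nl_energy p \<rho> (\<delta> \<sigma>) (piecewise q)))"
  have J: "nl_energy p \<rho> (\<delta> \<sigma>) (piecewise q) = ennreal (J \<sigma> q)" if "0 < \<sigma>" "fe_family q" for \<sigma> q
    using piecewise_Sp0(3)[OF that(2) d(1)[OF that(1)]] by (simp add: J_def)
  have J0: "0 \<le> J \<sigma> q" for \<sigma> q by (simp add: J_def)
  define En where "En = (\<lambda>\<sigma> q. J \<sigma> q / p - pairing \<Omega> f (piecewise q))"
  have En: "E_sigma p \<rho> \<Omega> \<delta>0 f \<sigma> (piecewise q) = En \<sigma> q" if "0 < \<sigma>" "fe_family q" for \<sigma> q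
    using piecewise_Sp0(2)[OF that(2) d(1)[OF that(1)]] by (simp add: E_sigma_def En_def J_def \<delta>_def)
  have Enu: "E_sigma p \<rho> \<Omega> \<delta>0 f \<sigma> (u \<sigma>) = En \<sigma> (qs \<sigma>)" if s: "0 < \<sigma>" for \<sigma>
  proof -
    have "Lp_space p \<Omega> (u \<sigma>)" using min_sigma[OF s] by (simp add: W_sigma_h_def Wtilde_def)
    then have "pairing \<Omega> f (u \<sigma>) = pairing \<Omega> f (piecewise (qs \<sigma>))"
      by (rule pairing_cong_AE[OF f1 qs(1)[OF s] _ qs(2)[OF s]])
    then have "E_sigma p \<rho> \<Omega> \<delta>0 f \<sigma> (u \<sigma>) = E_sigma p \<rho> \<Omega> \<delta>0 f \<sigma> (piecewise (qs \<sigma>))"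
      unfolding E_sigma_def nl_seminorm_p_cong_AE[OF qs(2)[OF s]] by simp
    then show ?thesis using En[OF s qs(1)[OF s]] by simp
  qed
  have minim: "En \<sigma> (qs \<sigma>) \<le> En \<sigma> q" if s: "0 < \<sigma>" and q: "fe_family q" for \<sigma> q
  proof -
    have "piecewise q \<in> W_sigma_h p \<rho> N \<Omega> \<delta>0 \<T> \<sigma>"
      using piecewise_Wtilde[OF q] piecewise_Sp0(1)[OF q d(1)[OF s]] by (simp add: W_sigma_h_def T_sigma_def \<delta>_def)
    then show ?thesis using min_sigma[OF s] by (metis En[OF s q] Enu[OF s])
  qed
  let ?X = "\<lambda>q. LINT x:\<Omega>|lebesgue. norm (piecewise q x) powr p"
  have poin: "?X q \<le> C powr p * J \<sigma> q" if "0 < \<sigma>" "fe_family q" for \<sigma> q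
    unfolding J_def by (rule fe_poincare(1)[OF C(2) C(1) d(1)]) (use d that in auto)
  \<comment> \<open>Young's inequality with a parameter small enough for the Poincare inequality to absorb the load term.\<close>
  define J1 where "J1 = 2 * p * ((1 / (2 * C powr p)) powr (1 / p)) powr (- (p / (p - 1))) * (LINT x:\<Omega>|lebesgue. norm (f x) powr (p / (p - 1)))"
  have Jb: "J \<sigma> (qs \<sigma>) \<le> J1" if s: "0 < \<sigma>" for \<sigma>
  proof -
    define l where "l = (1 / (2 * C powr p)) powr (1 / p)"
    have l: "0 < l" using C by (simp add: l_def)
    have lp: "l powr p = 1 / (2 * C powr p)" using C p0 by (simp add: l_def powr_powr)
    \<comment> \<open>The zero function as competitor, written as a linear combination so that
      \<open>fe_linear\<close> and \<open>piecewise_linear\<close> apply. It bounds the minimal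
      energies from above by 0.\<close>
    have z: "fe_family (\<lambda>T x. 0 * qi T x + 0 * qi T x)" by (rule fe_linear[OF qi(1) qi(1)])
    have pz: "piecewise (\<lambda>T x. 0 * qi T x + 0 * qi T x) x = 0" for x unfolding piecewise_linear by simp
    have "En \<sigma> (\<lambda>T x. 0 * qi T x + 0 * qi T x) = 0"
      unfolding En_def J_def nl_energy_def nl_integrand_def pairing_def pz using p0 by simp
    then have "En \<sigma> (qs \<sigma>) \<le> 0" using minim[OF s z] by simp
    then have "J \<sigma> (qs \<sigma>) / p \<le> pairing \<Omega> f (piecewise (qs \<sigma>))" by (simp add: En_def)
    also have "\<dots> \<le> l powr (- (p / (p - 1))) * (LINT x:\<Omega>|lebesgue. norm (f x) powr (p / (p - 1))) + l powr p / p * ?X (qs \<sigma>)"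
      by (rule pairing_young[OF fL qs(1)[OF s] l])
    also have "l powr p / p * ?X (qs \<sigma>) \<le> l powr p / p * (C powr p * J \<sigma> (qs \<sigma>))"
      using p0 poin[OF s qs(1)[OF s]] by (intro mult_left_mono) auto
    also have "\<dots> = J \<sigma> (qs \<sigma>) / (2 * p)" using C by (simp add: lp)
    finally have "J \<sigma> (qs \<sigma>) / p \<le> l powr (- (p / (p - 1))) * (LINT x:\<Omega>|lebesgue. norm (f x) powr (p / (p - 1))) + J \<sigma> (qs \<sigma>) / (2 * p)" by simp
    then have "J \<sigma> (qs \<sigma>) \<le> 2 * p * (l powr (- (p / (p - 1))) * (LINT x:\<Omega>|lebesgue. norm (f x) powr (p / (p - 1))))"
      using p0 by (simp add: field_simps)
    then show ?thesis by (simp add: J1_def l_def mult.assoc)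
  qed
  \<comment> \<open>The local minimizer is its own recovery sequence: its nonlocal energy never
    exceeds the local one.\<close>
  have Einf: "En \<sigma> qi \<le> E_inf p \<Omega> f ui" if s: "0 < \<sigma>" for \<sigma>
  proof -
    have ui: "ui \<in> W1p0 p \<Omega>" "Lp_space p \<Omega> ui" using min_inf(1) by (auto simp: W_inf_h_def Wtilde_def)
    have "0 \<le> (LINT x:\<Omega>|lebesgue. norm (weak_grad p \<Omega> ui x) powr p)"
      unfolding set_lebesgue_integral_def by (intro integral_nonneg_AE) auto
    moreover have "ennreal (J \<sigma> qi) \<le> ennreal (LINT x:\<Omega>|lebesgue. norm (weak_grad p \<Omega> ui x) powr p)"
      using W1p0_fe_energy_le[OF ui(1) qi d(1)[OF s]] J[OF s qi(1)] by simp
    ultimately have "J \<sigma> qi \<le> (LINT x:\<Omega>|lebesgue. norm (weak_grad p \<Omega> ui x) powr p)" by (simp add: ennreal_le_iff)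
    then show ?thesis
      using p0 pairing_cong_AE[OF f1 qi(1) ui(2) qi(2)] by (simp add: En_def E_inf_def divide_right_mono)
  qed
  define D where "D = (\<lambda>\<sigma> T x. (1/2) * qs \<sigma> T x + (-1/2) * qi T x)"
  define H where "H = (\<lambda>\<sigma> T x. (1/2) * qs \<sigma> T x + (1/2) * qi T x)"
  have D: "fe_family (D \<sigma>)" and H: "fe_family (H \<sigma>)" if "0 < \<sigma>" for \<sigma>
    unfolding D_def H_def by (rule fe_linear[OF qs(1)[OF that] qi(1)])+
  \<comment> \<open>By Clarkson the energy at the midpoint \<open>H\<close> is at most the mean of
    the two energies minus J(D)/p, and by minimality it is at least that of
    \<open>qs \<sigma>\<close>. The linear load term is exactly averaged and drops out.\<close>
  have key: "J \<sigma> (D \<sigma>) \<le> p / 2 * (E_inf p \<Omega> f ui - En \<sigma> (qs \<sigma>))" if s: "0 < \<sigma>" for \<sigma>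
  proof -
    note q = qs(1)[OF s]
    have pD: "piecewise (D \<sigma>) = (\<lambda>x. (piecewise (qs \<sigma>) x - piecewise qi x) / 2)"
      unfolding D_def piecewise_linear[abs_def] by (simp add: fun_eq_iff field_simps)
    have pH: "piecewise (H \<sigma>) = (\<lambda>x. (piecewise (qs \<sigma>) x + piecewise qi x) / 2)"
      unfolding H_def piecewise_linear[abs_def] by (simp add: fun_eq_iff field_simps)
    have "ennreal (J \<sigma> (H \<sigma>)) + ennreal (J \<sigma> (D \<sigma>)) \<le> ennreal (1/2) * (ennreal (J \<sigma> (qs \<sigma>)) + ennreal (J \<sigma> qi))"
      using fe_clarkson[OF q qi(1) d(1)[OF s]] unfolding pD[symmetric] pH[symmetric] J[OF s D[OF s]] J[OF s H[OF s]] J[OF s q] J[OF s qi(1)] .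
    then have "ennreal (J \<sigma> (H \<sigma>) + J \<sigma> (D \<sigma>)) \<le> ennreal (1/2 * (J \<sigma> (qs \<sigma>) + J \<sigma> qi))"
      by (simp only: ennreal_plus J0 ennreal_mult' zero_le_divide_1_iff zero_le_numeral)
    then have cl: "J \<sigma> (H \<sigma>) + J \<sigma> (D \<sigma>) \<le> (J \<sigma> (qs \<sigma>) + J \<sigma> qi) / 2"
      using J0[of \<sigma> "qs \<sigma>"] J0[of \<sigma> qi] by (subst (asm) ennreal_le_iff) auto
    have "pairing \<Omega> f (piecewise (H \<sigma>)) = (pairing \<Omega> f (piecewise (qs \<sigma>)) + pairing \<Omega> f (piecewise qi)) / 2"
      unfolding H_def pairing_linear[OF f1 q qi(1)] by simp
    moreover have "En \<sigma> (qs \<sigma>) \<le> En \<sigma> (H \<sigma>)" by (rule minim[OF s H[OF s]])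
    ultimately have "En \<sigma> (qs \<sigma>) \<le> J \<sigma> (H \<sigma>) / p - (pairing \<Omega> f (piecewise (qs \<sigma>)) + pairing \<Omega> f (piecewise qi)) / 2"
      unfolding En_def by linarith
    also have "\<dots> \<le> ((J \<sigma> (qs \<sigma>) + J \<sigma> qi) / 2 - J \<sigma> (D \<sigma>)) / p - (pairing \<Omega> f (piecewise (qs \<sigma>)) + pairing \<Omega> f (piecewise qi)) / 2"
    proof -
      have "J \<sigma> (H \<sigma>) \<le> (J \<sigma> (qs \<sigma>) + J \<sigma> qi) / 2 - J \<sigma> (D \<sigma>)" using cl by linarith
      then show ?thesis using p0 by (intro diff_right_mono divide_right_mono) auto
    qed
    also have "\<dots> = (En \<sigma> (qs \<sigma>) + En \<sigma> qi) / 2 - J \<sigma> (D \<sigma>) / p"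
      using p0 by (simp add: En_def field_simps)
    finally have "J \<sigma> (D \<sigma>) / p \<le> (En \<sigma> qi - En \<sigma> (qs \<sigma>)) / 2" by (simp add: field_simps)
    also have "\<dots> \<le> (E_inf p \<Omega> f ui - En \<sigma> (qs \<sigma>)) / 2" using Einf[OF s] by simp
    finally show ?thesis using p0 by (simp add: field_simps)
  qed
  have norm_eq: "Lp_norm p \<Omega> (\<lambda>x. u \<sigma> x - ui x) powr p = 2 powr p * ?X (D \<sigma>)" if s: "0 < \<sigma>" for \<sigma>
  proof -
    let ?F = "\<lambda>T x. 1 * qs \<sigma> T x + (-1) * qi T x"
    have F: "fe_family ?F" by (rule fe_linear[OF qs(1)[OF s] qi(1)])
    have pF: "piecewise ?F x = 2 * piecewise (D \<sigma>) x" "piecewise ?F x = piecewise (qs \<sigma>) x - piecewise qi x" for x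
      unfolding piecewise_linear D_def by simp_all
    have "(\<integral>\<^sup>+x\<in>\<Omega>. ennreal (norm (u \<sigma> x - ui x) powr p) \<partial>lebesgue) = (\<integral>\<^sup>+x\<in>\<Omega>. ennreal (norm (piecewise ?F x) powr p) \<partial>lebesgue)"
    proof (rule nn_integral_cong_AE)
      show "AE x in lebesgue. ennreal (norm (u \<sigma> x - ui x) powr p) * indicator \<Omega> x = ennreal (norm (piecewise ?F x) powr p) * indicator \<Omega> x"
        using qs(2)[OF s] qi(2) by eventually_elim (simp only: pF(2))
    qed
    then have "Lp_norm p \<Omega> (\<lambda>x. u \<sigma> x - ui x) = Lp_norm p \<Omega> (piecewise ?F)" by (simp add: Lp_norm_def)
    then have "Lp_norm p \<Omega> (\<lambda>x. u \<sigma> x - ui x) powr p = ?X ?F"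
      using fe_poincare(2)[OF C(2) C(1) d(1)[OF s] F] d[OF s] by simp
    also have "\<dots> = (LINT x:\<Omega>|lebesgue. 2 powr p * norm (piecewise (D \<sigma>) x) powr p)"
      unfolding pF(1) by (simp add: abs_mult powr_mult)
    also have "\<dots> = 2 powr p * ?X (D \<sigma>)" by (rule set_integral_mult_right)
    finally show ?thesis .
  qed
  \<comment> \<open>2^p undoes the half in the difference \<open>D\<close>, C^p is the Poincare
    constant, and p/2 comes from \<open>key\<close>.\<close>
  define K where "K = 2 powr p * C powr p * (p / 2)"
  have K: "0 < K" using C p0 by (simp add: K_def)
  have main: "Lp_norm p \<Omega> (\<lambda>x. u \<sigma> x - ui x) powr p \<le> K * (E_inf p \<Omega> f ui - En \<sigma> (qs \<sigma>))" if s: "0 < \<sigma>" for \<sigma>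
  proof -
    have "?X (D \<sigma>) \<le> C powr p * (p / 2 * (E_inf p \<Omega> f ui - En \<sigma> (qs \<sigma>)))"
      using poin[OF s D[OF s]] mult_left_mono[OF key[OF s], of "C powr p"] by simp
    then show ?thesis
      unfolding norm_eq[OF s] K_def using mult_left_mono[of "?X (D \<sigma>)" _ "2 powr p"] by (simp add: mult.assoc)
  qed
  show ?thesis
  proof (rule tendsto_at_topI_sequentially)
    fix X :: "nat \<Rightarrow> real" assume X: "filterlim X at_top sequentially"
    let ?E = "\<lambda>\<sigma>. Lp_norm p \<Omega> (\<lambda>x. u \<sigma> x - ui x)"
    show "(\<lambda>n. ?E (X n)) \<longlonglongrightarrow> 0"
    proof (rule ccontr)
      assume "\<not> ?thesis"
      then obtain e where e: "0 < e" "\<not> (\<forall>\<^sub>F n in sequentially. dist (?E (X n)) 0 < e)" by (auto simp: tendsto_iff)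
      have E0: "0 \<le> ?E \<sigma>" for \<sigma> by (simp add: Lp_norm_def)
      have pos: "\<forall>\<^sub>F n in sequentially. 0 < X n" using X by (simp add: filterlim_at_top_dense)
      have "\<exists>\<^sub>F n in sequentially. e \<le> ?E (X n) \<and> 0 < X n"
      proof -
        have "\<exists>\<^sub>F n in sequentially. \<not> dist (?E (X n)) 0 < e" using e(2) by (simp add: not_eventually)
        from frequently_eventually_conj[OF this pos] show ?thesis
          by (rule frequently_elim1) (use E0 in \<open>auto simp: dist_norm\<close>)
      qed
      then have "infinite {n. e \<le> ?E (X n) \<and> 0 < X n}"
        by (simp add: frequently_cofinite cofinite_eq_sequentially[symmetric])
      from infinite_enumerate[OF this] obtain s0 where "strict_mono (s0::nat \<Rightarrow> nat)"
        "\<forall>n. s0 n \<in> {n. e \<le> ?E (X n) \<and> 0 < X n}" by blast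
      then have s0: "strict_mono s0" "\<And>n. e \<le> ?E (X (s0 n)) \<and> 0 < X (s0 n)" by simp_all
      define \<sigma> where "\<sigma> = (\<lambda>n. X (s0 n))"
      have sg: "0 < \<sigma> n" "e \<le> ?E (\<sigma> n)" for n using s0(2) by (auto simp: \<sigma>_def)
      have sinf: "filterlim \<sigma> at_top sequentially"
        unfolding \<sigma>_def by (rule filterlim_compose[OF X filterlim_subseq[OF s0(1)]])
      have Xb: "(\<integral>\<^sup>+x\<in>\<Omega>. ennreal (\<bar>piecewise (qs (\<sigma> n)) x\<bar> powr p) \<partial>lborel) \<le> ennreal (C powr p * J1)" for n
      proof -
        note q = qs(1)[OF sg(1)[of n]]
        obtain B where B: "\<And>x. \<bar>piecewise (qs (\<sigma> n)) x\<bar> \<le> B" using fe_bounded[OF q] by blast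
        have Lq: "Lp_space p \<Omega> (piecewise (qs (\<sigma> n)))"
          by (rule Lp_space_bounded[OF measurable_completion]) (use q B in auto)
        have "(\<integral>\<^sup>+x\<in>\<Omega>. ennreal (\<bar>piecewise (qs (\<sigma> n)) x\<bar> powr p) \<partial>lborel) = ennreal (?X (qs (\<sigma> n)))"
          using Lp_integral_eq(1)[OF Lq p0(1)] by (simp add: nn_integral_completion)
        also have "\<dots> \<le> ennreal (C powr p * J1)"
          using poin[OF sg(1)[of n] q] mult_left_mono[OF Jb[OF sg(1)[of n]], of "C powr p"] by (intro ennreal_leI) simp
        finally show ?thesis .
      qed
      obtain r q' B where r: "strict_mono (r::nat \<Rightarrow> nat)" and q': "fe_family q'"
        and B: "\<And>k x. \<bar>piecewise (qs (\<sigma> (r k))) x\<bar> \<le> B"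
        and conv: "\<And>x Y. x \<notin> skeleton \<Longrightarrow> Y \<longlonglongrightarrow> x \<Longrightarrow> (\<lambda>k. piecewise (qs (\<sigma> (r k))) (Y k)) \<longlonglongrightarrow> piecewise q' x"
      proof -
        have "\<exists>r q' B. strict_mono (r::nat \<Rightarrow> nat) \<and> fe_family q' \<and> (\<forall>k x. \<bar>piecewise (qs (\<sigma> (r k))) x\<bar> \<le> B) \<and>
          (\<forall>x Y. x \<notin> skeleton \<longrightarrow> Y \<longlonglongrightarrow> x \<longrightarrow> (\<lambda>k. piecewise (qs (\<sigma> (r k))) (Y k)) \<longlonglongrightarrow> piecewise q' x)"
          by (rule fe_compactness[of "\<lambda>n. qs (\<sigma> n)", OF qs(1)[OF sg(1)] Xb])
        then obtain r q' B where *: "strict_mono (r::nat \<Rightarrow> nat)" "fe_family q'" "\<forall>k x. \<bar>piecewise (qs (\<sigma> (r k))) x\<bar> \<le> B"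
          "\<forall>x Y. x \<notin> skeleton \<longrightarrow> Y \<longlonglongrightarrow> x \<longrightarrow> (\<lambda>k. piecewise (qs (\<sigma> (r k))) (Y k)) \<longlonglongrightarrow> piecewise q' x"
          by (elim exE conjE)
        show ?thesis by (rule that[OF *(1,2), of B]) (use *(3,4) in simp_all)
      qed
      define \<tau> where "\<tau> = (\<lambda>k. \<sigma> (r k))"
      define a where "a = (\<lambda>k. J (\<tau> k) (qs (\<tau> k)))"
      have tau: "0 < \<tau> k" for k using sg(1) by (simp add: \<tau>_def)
      note qt = qs(1)[OF tau]
      \<comment> \<open>A further subsequence makes the energies themselves converge; their limit
        \<open>A\<close> bounds the energy of the limit function at every fixed scale.\<close>
      have "bounded (range a)"
        using Jb[OF tau] J0 by (auto simp: a_def bounded_iff intro!: exI[of _ J1])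
      then obtain A r2 where r2: "strict_mono (r2::nat \<Rightarrow> nat)" "(a \<circ> r2) \<longlonglongrightarrow> A"
        using bounded_imp_convergent_subsequence by blast
      have A: "(\<lambda>k. a (r2 k)) \<longlonglongrightarrow> A" using r2(2) by (simp add: o_def)
      have A0: "0 \<le> A" using A by (rule LIMSEQ_le_const) (auto simp: a_def J0)
      have conv2: "(\<lambda>k. piecewise (qs (\<tau> (r2 k))) (Y k)) \<longlonglongrightarrow> piecewise q' x" if x: "x \<notin> skeleton" and Y: "Y \<longlonglongrightarrow> x" for x Y
      proof -
        have r2inv: "inj r2" using r2(1) by (rule strict_mono_imp_inj_on)
        \<comment> \<open>Convergence along moving points is known for sequences indexed by the
          first subsequence, so \<open>Y\<close> is filled up with the constant \<open>x\<close>
          outside the range of \<open>r2\<close>.\<close>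
        define Y' where "Y' = (\<lambda>n. if n \<in> range r2 then Y (inv r2 n) else x)"
        have "Y' \<longlonglongrightarrow> x"
        proof (rule LIMSEQ_I)
          fix c :: real assume c: "0 < c"
          obtain k0 where k0: "\<And>k. k0 \<le> k \<Longrightarrow> norm (Y k - x) < c" using LIMSEQ_D[OF Y c] by blast
          have "norm (Y' n - x) < c" if n: "r2 k0 \<le> n" for n
          proof (cases "n \<in> range r2")
            case True
            then obtain k where k: "n = r2 k" by blast
            have "k0 \<le> k" using n k r2(1) by (simp add: strict_mono_less_eq)
            then show ?thesis using k0[of k] k r2inv by (simp add: Y'_def)
          qed (use c in \<open>simp add: Y'_def\<close>)
          then show "\<exists>no. \<forall>n\<ge>no. norm (Y' n - x) < c" by blast
        qed
        from LIMSEQ_subseq_LIMSEQ[OF conv[OF x this] r2(1)]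
        have "(\<lambda>k. piecewise (qs (\<tau> (r2 k))) (Y' (r2 k))) \<longlonglongrightarrow> piecewise q' x" by (simp add: o_def \<tau>_def)
        moreover have "Y' (r2 k) = Y k" for k using r2inv by (simp add: Y'_def)
        ultimately show ?thesis by simp
      qed
      have tinf: "filterlim (\<lambda>k. \<tau> (r2 k)) at_top sequentially"
        unfolding \<tau>_def by (rule filterlim_compose[OF sinf filterlim_compose[OF filterlim_subseq[OF r] filterlim_subseq[OF r2(1)]]])
      have d0: "(\<lambda>k. \<delta> (\<tau> (r2 k))) \<longlonglongrightarrow> 0"
      proof (rule tendsto_sandwich[OF _ _ tendsto_const])
        show "\<forall>\<^sub>F k in sequentially. 0 \<le> \<delta> (\<tau> (r2 k))" using d(1)[OF tau] by (simp add: less_imp_le)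
        show "\<forall>\<^sub>F k in sequentially. \<delta> (\<tau> (r2 k)) \<le> inverse (\<tau> (r2 k))" by (simp add: \<delta>_def delta_sigma_def inverse_eq_divide)
        show "(\<lambda>k. inverse (\<tau> (r2 k))) \<longlonglongrightarrow> 0" by (rule tendsto_inverse_0_at_top[OF tinf])
      qed
      have lsc: "nl_energy p \<rho> t (piecewise q') \<le> ennreal A" if "0 < t" for t
      proof (rule energy_lower_semicontinuous[where q = "\<lambda>k. qs (\<tau> (r2 k))" and d = "\<lambda>k. \<delta> (\<tau> (r2 k))" and a = "\<lambda>k. a (r2 k)"])
        show "nl_energy p \<rho> (\<delta> (\<tau> (r2 k))) (piecewise (qs (\<tau> (r2 k)))) \<le> ennreal (a (r2 k))" for k
          using J[OF tau qt] by (simp add: a_def)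
      qed (use qt q' conv2 d(1)[OF tau] d0 A that in auto)
      have W: "piecewise q' \<in> W_inf_h p N \<Omega> \<T>"
        using fe_bounded_energy_in_W1p0(1)[OF q' A0 lsc] piecewise_Wtilde[OF q'] by (simp add: W_inf_h_def)
      obtain g where g: "Lp_space p \<Omega> g" "is_weak_grad \<Omega> (piecewise q') g" "(\<integral>\<^sup>+x\<in>\<Omega>. ennreal (norm (g x) powr p) \<partial>lebesgue) \<le> ennreal A"
        using fe_bounded_energy_in_W1p0(2)[OF q' A0 lsc] by blast
      \<comment> \<open>The limit function is a competitor in the local problem, so minimality of
        \<open>ui\<close> bounds the local minimum by the limit of the nonlocal minima.\<close>
      have low: "E_inf p \<Omega> f ui \<le> A / p - pairing \<Omega> f (piecewise q')"
        using min_inf(2)[OF W] E_inf_le[OF g(1,2) A0 g(3), of f] by simp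
      have "(\<lambda>k. pairing \<Omega> f (piecewise (qs (\<tau> (r2 k))))) \<longlonglongrightarrow> pairing \<Omega> f (piecewise q')"
        by (rule pairing_tendsto[OF f1 qt q']) (use B conv2[OF _ tendsto_const] in \<open>auto simp: \<tau>_def\<close>)
      then have "(\<lambda>k. K * (E_inf p \<Omega> f ui - (a (r2 k) / p - pairing \<Omega> f (piecewise (qs (\<tau> (r2 k))))))) \<longlonglongrightarrow>
          K * (E_inf p \<Omega> f ui - (A / p - pairing \<Omega> f (piecewise q')))"
        using p0 by (intro tendsto_intros A) auto
      moreover have "e powr p \<le> K * (E_inf p \<Omega> f ui - (a (r2 k) / p - pairing \<Omega> f (piecewise (qs (\<tau> (r2 k))))))" for k
      proof -
        have "e powr p \<le> ?E (\<tau> (r2 k)) powr p" using e(1) sg(2) p0 by (intro powr_mono2) (auto simp: \<tau>_def)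
        also have "\<dots> \<le> K * (E_inf p \<Omega> f ui - En (\<tau> (r2 k)) (qs (\<tau> (r2 k))))" by (rule main[OF tau])
        finally show ?thesis by (simp add: En_def a_def)
      qed
      \<comment> \<open>The lower bound \<open>e\<close> for the distances passes to the limit of
        the gap, which \<open>low\<close> shows to be nonpositive.\<close>
      ultimately have "e powr p \<le> K * (E_inf p \<Omega> f ui - (A / p - pairing \<Omega> f (piecewise q')))"
        by (intro LIMSEQ_le_const) auto
      also have "\<dots> \<le> 0" using low K by (simp add: mult_le_0_iff)
      finally show False using e(1) by simp
    qed
  qed
qed

end

theorem theorem4p7:
  fixes p :: real and \<rho> :: "real \<Rightarrow> real" and \<Omega> :: "'a::euclidean_space set"
    and \<delta>0 h0 :: real and f :: "'a \<Rightarrow> real" and N :: nat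
    and tri :: "real \<Rightarrow> 'a set set"
    and u :: "real \<Rightarrow> real \<Rightarrow> 'a \<Rightarrow> real" and u_inf :: "real \<Rightarrow> 'a \<Rightarrow> real"
  assumes p: "2 \<le> p"
    and dom: "bounded_domain \<Omega>" and flat: "piecewise_flat_boundary \<Omega>"
    and kern: "admissible_kernel TYPE('a) p \<rho>"
    and delta0: "0 < \<delta>0" "\<delta>0 < 1"
    and poincare: "\<exists>C>0. \<forall>\<delta>\<in>{0<..\<delta>0}. \<forall>v\<in>Sp0 p \<rho> \<Omega> \<delta>.
                      Lp_norm p \<Omega> v \<le> C * nl_seminorm p \<rho> \<Omega> \<delta> v"
    and f: "Lp_space (p / (p - 1)) (extended_domain \<Omega> \<delta>0) f"
    and h0: "0 < h0"
    and tri: "admissible_tri_family \<Omega> h0 tri"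
    and incl: "\<forall>h\<in>{0<..h0}. (\<forall>\<sigma>>0. What_inf_h p \<Omega> (tri h) \<subseteq> W_sigma_h p \<rho> N \<Omega> \<delta>0 (tri h) \<sigma>)
                 \<and> What_inf_h p \<Omega> (tri h) \<subseteq> W_inf_h p N \<Omega> (tri h)"
    and min_sigma: "\<forall>h\<in>{0<..h0}. \<forall>\<sigma>>0. u \<sigma> h \<in> W_sigma_h p \<rho> N \<Omega> \<delta>0 (tri h) \<sigma> \<and>
         (\<forall>v\<in>W_sigma_h p \<rho> N \<Omega> \<delta>0 (tri h) \<sigma>.
            E_sigma p \<rho> \<Omega> \<delta>0 f \<sigma> (u \<sigma> h) \<le> E_sigma p \<rho> \<Omega> \<delta>0 f \<sigma> v)"
    and min_inf: "\<forall>h\<in>{0<..h0}. u_inf h \<in> W_inf_h p N \<Omega> (tri h) \<and>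
         (\<forall>v\<in>W_inf_h p N \<Omega> (tri h). E_inf p \<Omega> f (u_inf h) \<le> E_inf p \<Omega> f v)"
  shows "\<forall>h\<in>{0<..h0}.
           ((\<lambda>\<sigma>. Lp_norm p \<Omega> (\<lambda>x. u \<sigma> h x - u_inf h x)) \<longlongrightarrow> 0) at_top"
proof
  fix h assume h: "h \<in> {0<..h0}"
  interpret mesh p \<rho> \<Omega> "tri h" N
    by standard (use p kern dom flat tri h in \<open>auto simp: admissible_tri_family_def\<close>)
  show "((\<lambda>\<sigma>. Lp_norm p \<Omega> (\<lambda>x. u \<sigma> h x - u_inf h x)) \<longlongrightarrow> 0) at_top"
    by (rule minimizers_converge[OF delta0(1) poincare f]) (use min_sigma min_inf h in auto)
qed

end
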